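(* Consider the two-user real Gaussian MIMO interference channel with channel matrices $H_1,H_2,H_3,H_4$ and power constraints $P_1,P_2$ (see context), where all four channel matrices are square and invertible. If $H_2^TH_2\prec H_4^TH_4$ and $H_3^TH_3\succeq H_1^TH_1$, then the sum-rate capacity is $$C^*=\max_{S_1,S_2}\ \min\left\{\begin{array}{c}\tfrac12\log\left|I+H_3S_1H_3^T+H_4S_2H_4^T\right|,\\[2pt] \tfrac12\log\left|I+H_1S_1H_1^T(I+H_2S_2H_2^T)^{-1}\right|+\tfrac12\log\left|I+H_4S_2H_4^T\right|\end{array}\right\},$$ where the maximum is over symmetric positive semidefinite $S_1,S_2$ with $\mathrm{tr}(S_1)\le P_1$ and $\mathrm{tr}(S_2)\le P_2$.
   Context: Channel: at each use, $y_1=H_1x_1+H_2x_2+z_1$ and $y_2=H_3x_1+H_4x_2+z_2$, where $x_i$ is the real vector sent by transmitter $i$, $y_i$ is the vector seen by receiver $i$, the $H_j$ are fixed real matrices of compatible sizes known to all, and $z_1,z_2$ are Gaussian vectors with zero mean and identity covariance, independent of the inputs and i.i.d. over channel uses. A length-$n$ code with rates $(R_1,R_2)$: independent messages $m_i$ uniform on a set of size $\lceil e^{nR_i}\rceil$; transmitter $i$ maps $m_i$ to $(x_{i,1},\dots,x_{i,n})$ subject to the average power constraint $\frac1n\sum_{j=1}^nE\|x_{i,j}\|^2\le P_i$; receiver $i$ estimates $m_i$ from $(y_{i,1},\dots,y_{i,n})$ only. A pair of nonnegative rates is achievable if there are codes with error probabilities at both receivers tending to $0$ as $n\to\infty$;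 the capacity region is the closure of the set of achievable pairs; the sum-rate capacity is the supremum of $R_1+R_2$ over it. Notation: $|X|$ of a matrix is its determinant; $\log$ is natural; $A\succeq B$ means $A-B$ is positive semidefinite and $A\prec B$ means $B-A$ is positive definite. *)

theory Defs
  imports "HOL-Probability.Probability"
begin

text \<open>Both notions include symmetry.  The Loewner relations \<open>A \<succeq> B\<close> and \<open>A \<prec> B\<close> are
  written \<open>psd (A - B)\<close> and \<open>posdef (B - A)\<close>.\<close>

definition psd :: "real^'n^'n \<Rightarrow> bool" where
  "psd A \<longleftrightarrow> transpose A = A \<and> (\<forall>x. 0 \<le> x \<bullet> (A *v x))"

definition posdef :: "real^'n^'n \<Rightarrow> bool" where
  "posdef A \<longleftrightarrow> transpose A = A \<and> (\<forall>x. x \<noteq> 0 \<longrightarrow> 0 < x \<bullet> (A *v x))"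

text \<open>The law of a Gaussian vector with zero mean and identity covariance, and the law of
  \<open>n\<close> independent copies of it (channel uses are numbered \<open>0, \<dots>, n - 1\<close>).\<close>

definition std_gaussian :: "(real^'n) measure" where
  "std_gaussian = density lborel (\<lambda>z. ennreal (\<Prod>i\<in>UNIV. std_normal_density (z $ i)))"

definition noise :: "nat \<Rightarrow> (nat \<Rightarrow> real^'n) measure" where
  "noise n = PiM {..<n} (\<lambda>_. std_gaussian)"

lemma sets_std_gaussian [simp, measurable_cong]: "sets std_gaussian = sets borel"
  by (simp add: std_gaussian_def)

lemma space_std_gaussian [simp]: "space std_gaussian = UNIV"
  by (simp add: std_gaussian_def)

text \<open>Messages are \<open>0, \<dots>, M - 1\<close>.  An encoder maps a message and a channel use to the vector
  sent; a decoder maps the received block, an element of \<^term>\<open>PiM {..<n} (\<lambda>_. borel)\<close>, to a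
  message.\<close>

definition num_msgs :: "nat \<Rightarrow> real \<Rightarrow> nat" where
  "num_msgs n R = nat \<lceil>exp (real n * R)\<rceil>"

record ('t1::finite, 't2::finite, 'r1::finite, 'r2::finite) ic_code =
  enc1 :: "nat \<Rightarrow> nat \<Rightarrow> real^'t1"
  enc2 :: "nat \<Rightarrow> nat \<Rightarrow> real^'t2"
  dec1 :: "(nat \<Rightarrow> real^'r1) \<Rightarrow> nat"
  dec2 :: "(nat \<Rightarrow> real^'r2) \<Rightarrow> nat"

definition avg_power :: "nat \<Rightarrow> nat \<Rightarrow> (nat \<Rightarrow> nat \<Rightarrow> real^'t) \<Rightarrow> real" where
  "avg_power n M f =
     (1 / real n) * (\<Sum>j<n. measure_pmf.expectation (pmf_of_set {..<M}) (\<lambda>m. (norm (f m j))\<^sup>2))"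

definition is_code ::
  "nat \<Rightarrow> real \<Rightarrow> real \<Rightarrow> real \<Rightarrow> real \<Rightarrow> ('t1::finite, 't2::finite, 'r1::finite, 'r2::finite) ic_code \<Rightarrow> bool" where
  "is_code n P1 P2 R1 R2 C \<longleftrightarrow>
     avg_power n (num_msgs n R1) (enc1 C) \<le> P1 \<and>
     avg_power n (num_msgs n R2) (enc2 C) \<le> P2 \<and>
     dec1 C \<in> PiM {..<n} (\<lambda>_. borel) \<rightarrow>\<^sub>M count_space {..<num_msgs n R1} \<and>
     dec2 C \<in> PiM {..<n} (\<lambda>_. borel) \<rightarrow>\<^sub>M count_space {..<num_msgs n R2}"

text \<open>Sample space seen by one receiver: the pair of independent uniform messages, and the
  receiver's noise, independent of the messages.  The joint law of the noises at the two
  receivers is not needed, as each error probability involves one receiver only.\<close>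

definition channel_space :: "nat \<Rightarrow> real \<Rightarrow> real \<Rightarrow> ((nat \<times> nat) \<times> (nat \<Rightarrow> real^'r)) measure" where
  "channel_space n R1 R2 =
     measure_pmf (pmf_of_set ({..<num_msgs n R1} \<times> {..<num_msgs n R2})) \<Otimes>\<^sub>M noise n"

definition received ::
  "nat \<Rightarrow> real^'t1^'r \<Rightarrow> real^'t2^'r \<Rightarrow> (nat \<Rightarrow> real^'t1) \<Rightarrow> (nat \<Rightarrow> real^'t2) \<Rightarrow>
   (nat \<Rightarrow> real^'r) \<Rightarrow> (nat \<Rightarrow> real^'r)" where
  "received n A B x1 x2 z = (\<lambda>j\<in>{..<n}. A *v x1 j + B *v x2 j + z j)"

definition error1 ::
  "real^'t1^'r1 \<Rightarrow> real^'t2^'r1 \<Rightarrow> nat \<Rightarrow> real \<Rightarrow> real \<Rightarrow> ('t1::finite, 't2::finite, 'r1::finite, 'r2::finite) ic_code \<Rightarrow> real" where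
  "error1 H1 H2 n R1 R2 C =
     \<P>(((m1, m2), z) in channel_space n R1 R2.
        dec1 C (received n H1 H2 (enc1 C m1) (enc2 C m2) z) \<noteq> m1)"

definition error2 ::
  "real^'t1^'r2 \<Rightarrow> real^'t2^'r2 \<Rightarrow> nat \<Rightarrow> real \<Rightarrow> real \<Rightarrow> ('t1::finite, 't2::finite, 'r1::finite, 'r2::finite) ic_code \<Rightarrow> real" where
  "error2 H3 H4 n R1 R2 C =
     \<P>(((m1, m2), z) in channel_space n R1 R2.
        dec2 C (received n H3 H4 (enc1 C m1) (enc2 C m2) z) \<noteq> m2)"

definition achievable ::
  "real^'t1^'r1 \<Rightarrow> real^'t2^'r1 \<Rightarrow> real^'t1^'r2 \<Rightarrow> real^'t2^'r2 \<Rightarrow> real \<Rightarrow> real \<Rightarrow>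
   real \<Rightarrow> real \<Rightarrow> bool" where
  "achievable H1 H2 H3 H4 P1 P2 R1 R2 \<longleftrightarrow>
     0 \<le> R1 \<and> 0 \<le> R2 \<and>
     (\<exists>C :: nat \<Rightarrow> ('t1::finite, 't2::finite, 'r1::finite, 'r2::finite) ic_code.
        (\<forall>n\<ge>1. is_code n P1 P2 R1 R2 (C n)) \<and>
        (\<lambda>n. error1 H1 H2 n R1 R2 (C n)) \<longlonglongrightarrow> 0 \<and>
        (\<lambda>n. error2 H3 H4 n R1 R2 (C n)) \<longlonglongrightarrow> 0)"

definition capacity_region ::
  "real^'t1^'r1 \<Rightarrow> real^'t2^'r1 \<Rightarrow> real^'t1^'r2 \<Rightarrow> real^'t2^'r2 \<Rightarrow> real \<Rightarrow> real \<Rightarrow>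
   (real \<times> real) set" where
  "capacity_region H1 H2 H3 H4 P1 P2 =
     closure {(R1, R2). achievable H1 H2 H3 H4 P1 P2 R1 R2}"

text \<open>The supremum is taken in the extended reals, where it is meaningful without knowing
  beforehand that the region is nonempty and bounded.\<close>

definition sum_capacity ::
  "real^'t1^'r1 \<Rightarrow> real^'t2^'r1 \<Rightarrow> real^'t1^'r2 \<Rightarrow> real^'t2^'r2 \<Rightarrow> real \<Rightarrow> real \<Rightarrow> ereal" where
  "sum_capacity H1 H2 H3 H4 P1 P2 =
     (SUP (R1, R2) \<in> capacity_region H1 H2 H3 H4 P1 P2. ereal (R1 + R2))"

definition feasible :: "real \<Rightarrow> real \<Rightarrow> ((real^'n^'n) \<times> (real^'m^'m)) set" where
  "feasible P1 P2 = {(S1, S2). psd S1 \<and> trace S1 \<le> P1 \<and> psd S2 \<and> trace S2 \<le> P2}"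

definition sum_rate ::
  "real^'n^'n \<Rightarrow> real^'n^'n \<Rightarrow> real^'n^'n \<Rightarrow> real^'n^'n \<Rightarrow>
   (real^'n^'n) \<times> (real^'n^'n) \<Rightarrow> real" where
  "sum_rate H1 H2 H3 H4 = (\<lambda>(S1, S2).
     min (1/2 * ln (det (mat 1 + H3 ** S1 ** transpose H3 + H4 ** S2 ** transpose H4)))
         (1/2 * ln (det (mat 1 + H1 ** S1 ** transpose H1
                                   ** matrix_inv (mat 1 + H2 ** S2 ** transpose H2)))
          + 1/2 * ln (det (mat 1 + H4 ** S2 ** transpose H4))))"

end

theory Submission
  imports Defs
begin

text \<open>Upper bound.  Since \<open>H\<^sub>3\<^sup>T H\<^sub>3 \<succeq> H\<^sub>1\<^sup>T H\<^sub>1\<close>, receiver 2, once it knows \<open>m\<^sub>2\<close>, sees a better version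
  of receiver 1's signal and can decode \<open>m\<^sub>1\<close> too; this gives the first term of the minimum.  Since
  \<open>H\<^sub>2\<^sup>T H\<^sub>2 \<preceq> H\<^sub>4\<^sup>T H\<^sub>4\<close>, the interference plus noise \<open>t = H\<^sub>2 x\<^sub>2 + z\<^sub>1\<close> is a degraded version of
  \<open>s = H\<^sub>4 x\<^sub>2 + z\<^sub>2\<close>, so that \<open>I(x\<^sub>2; s) - I(x\<^sub>2; t)\<close> is maximized by Gaussian inputs; this gives the
  second.  Instead of entropies, both bounds use Fano's inequality in the form of a change of measure:
  with an explicit Gaussian likelihood ratio \<open>exp (- W)\<close> relative to a measure under which the
  outputs carry no information on the messages, \<open>E W\<close> is quadratic in the codewords and depends on
  the code only through its empirical covariances \<open>S\<^sub>1, S\<^sub>2\<close>.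

  Lower bound.  Gaussian codebooks with covariances \<open>S\<^sub>1, S\<^sub>2\<close>: receiver 1 treats interference as
  noise and receiver 2 decodes both messages, both by thresholding information densities, whose
  fluctuations are controlled by Chebyshev's inequality.  A factor \<open>t < 1\<close> in front of the covariances
  leaves room for the power constraint.\<close>

text \<open>The single-letter form of the converse needs no concavity argument. Each likelihood
  ratio compares the code with one Gaussian law, i.i.d. about the codebook mean, whose covariance is
  that of the code averaged over messages and channel uses. The averaged quadratic cost then equals
  that of pure noise, and only log-determinants are left. Both bounds hold at the same pair
  \<open>S1\<close>, \<open>S2\<close>, so their minimum can be formed before maximizing. An error
  probability sees the noise of one receiver only, so the two noises may be coupled at will, and
  each bound chooses its own coupling. On the coding side, receiver 2 is not charged for a wrong
  \<open>m1\<close> beside the right \<open>m2\<close>. The conditions are therefore R1 < c1, R2 <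
  c2 and R1 + R2 < c3, where c1 is the rate of user 1 against interference, c2 that of user 2 with
  \<open>m1\<close> known, and c3 that of the pair at receiver 2. The largest sum they allow is
  min(c3, c1 + c2), which is the expression of the theorem.\<close>

section \<open>Positive semidefinite matrices and their factorizations\<close>

lemma inner_matrix_transpose:
  fixes A :: "real^'n^'m"
  shows "x \<bullet> (A *v y) = (transpose A *v x) \<bullet> y"
  by (simp add: dot_lmul_matrix transpose_matrix_vector)

lemma psd_0 [simp]: "psd (0 :: real^'n^'n)"
  by (simp add: psd_def transpose_def vec_eq_iff)

lemma transpose_add: "transpose (A + B) = transpose A + transpose (B :: 'a::plus^'n^'m)"
  by (simp add: transpose_def vec_eq_iff)

lemma transpose_scaleR: "transpose (c *\<^sub>R A) = c *\<^sub>R transpose (A :: real^'n^'m)"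
  by (simp add: transpose_def vec_eq_iff)

lemma psd_add:
  assumes "psd A" "psd B" shows "psd (A + B)"
  using assms by (simp add: psd_def transpose_add matrix_vector_mult_add_rdistrib inner_add_right)

lemma psd_scaleR:
  assumes "psd A" "0 \<le> c" shows "psd (c *\<^sub>R A)"
  using assms by (simp add: psd_def transpose_scaleR scaleR_matrix_vector_assoc [symmetric])

lemma psd_congruence:
  fixes A :: "real^'n^'n" and B :: "real^'n^'m"
  assumes "psd A" shows "psd (B ** A ** transpose B)"
proof -
  have "x \<bullet> (B ** A ** transpose B *v x) = (transpose B *v x) \<bullet> (A *v (transpose B *v x))" for x
    by (simp add: matrix_vector_mul_assoc [symmetric] inner_matrix_transpose [of x B])
  then show ?thesis
    using assms by (simp add: psd_def matrix_transpose_mul matrix_mul_assoc)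
qed

lemma psd_gram: "psd (L ** transpose (L :: real^'n^'m))"
  by (simp add: psd_def matrix_transpose_mul matrix_vector_mul_assoc [symmetric] inner_matrix_transpose)

lemma posdef_mat_1: "posdef (mat 1 :: real^'n^'n)"
  by (simp add: posdef_def)

lemma posdef_add_psd:
  assumes "posdef A" "psd B" shows "posdef (A + B)"
  using assms
  by (auto simp: psd_def posdef_def transpose_add matrix_vector_mult_add_rdistrib inner_add_right
      intro: add_pos_nonneg)

lemma posdef_imp_psd: "posdef A \<Longrightarrow> psd A"
  unfolding posdef_def psd_def by (metis inner_zero_left less_imp_le order_refl)

text \<open>The form is nonnegative at \<open>x + t *\<^sub>R y\<close> for all \<open>t\<close>,
  and a nonnegative quadratic polynomial in \<open>t\<close> has discriminant at most zero. The case
  \<open>c = 0\<close> leaves a linear polynomial, which forces \<open>b = 0\<close>.\<close>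

lemma psd_Cauchy_Schwarz:
  assumes "psd K"
  shows "(x \<bullet> (K *v y))\<^sup>2 \<le> (x \<bullet> (K *v x)) * (y \<bullet> (K *v y))"
proof -
  have sym: "y \<bullet> (K *v x) = x \<bullet> (K *v y)"
    using assms inner_matrix_transpose [of y K x] by (simp add: psd_def inner_commute)
  have q: "0 \<le> x \<bullet> (K *v x) + 2 * t * (x \<bullet> (K *v y)) + t\<^sup>2 * (y \<bullet> (K *v y))" for t
  proof -
    have "0 \<le> (x + t *\<^sub>R y) \<bullet> (K *v (x + t *\<^sub>R y))"
      using assms by (simp add: psd_def)
    then show ?thesis
      by (simp add: matrix_vector_right_distrib matrix_vector_mult_scaleR inner_add_left inner_add_right
          sym distrib_left power2_eq_square)
  qed
  define a b c where "a = x \<bullet> (K *v x)" and "b = x \<bullet> (K *v y)" and "c = y \<bullet> (K *v y)"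
  have q: "0 \<le> a + 2 * t * b + t\<^sup>2 * c" for t
    using q by (simp add: a_def b_def c_def)
  have "0 \<le> c" using assms by (simp add: psd_def c_def)
  have "b\<^sup>2 \<le> a * c"
  proof (cases "c = 0")
    case True
    show ?thesis
    proof (rule ccontr)
      assume "\<not> b\<^sup>2 \<le> a * c"
      then have "b \<noteq> 0" using True by auto
      \<comment> \<open>At this \<open>t\<close> the linear polynomial \<open>a + 2 * t * b\<close>
        takes the value -1.\<close>
      then have "2 * (- (a + 1) / (2 * b)) * b = - (a + 1)" by simp
      then show False using q [of "- (a + 1) / (2 * b)"] True by simp
    qed
  next
    case False
    with \<open>0 \<le> c\<close> have "0 < c" by simp
    have "0 \<le> c * (a + 2 * (- b / c) * b + (- b / c)\<^sup>2 * c)"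
      using q [of "- b / c"] \<open>0 < c\<close> by (intro mult_nonneg_nonneg) auto
    also have "\<dots> = a * c - b\<^sup>2"
      using \<open>0 < c\<close> by (simp add: algebra_simps power2_eq_square)
    finally show ?thesis by simp
  qed
  then show ?thesis by (simp add: a_def b_def c_def)
qed

lemma psd_diagonal_zero:
  assumes "psd K" "K $ i $ i = 0"
  shows "K $ j $ i = 0"
proof -
  have e: "axis j 1 \<bullet> (K *v axis i 1) = K $ j $ i" for i j
    by (simp add: inner_axis' matrix_vector_mult_basis column_def)
  show ?thesis
    using psd_Cauchy_Schwarz [OF assms(1), of "axis j 1" "axis i 1"] assms(2) by (simp add: e)
qed

text \<open>Cholesky elimination: the Schur complement of a nonzero diagonal entry \<open>K\<^sub>i\<^sub>i\<close> is psd and has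
  fewer nonzero rows.  The clause on zero columns keeps column \<open>i\<close> of the factor free.\<close>

lemma psd_factorization_aux:
  fixes K :: "real^'n^'n"
  assumes "psd K"
  shows "\<exists>L. K = L ** transpose L \<and> (\<forall>k. row k K = 0 \<longrightarrow> column k L = 0)"
  using assms
proof (induction "card {k. row k K \<noteq> 0}" arbitrary: K rule: less_induct)
  case (less K)
  show ?case
  proof (cases "\<forall>i. K $ i $ i = 0")
    case True
    then have "K = 0" using psd_diagonal_zero [OF less.prems] by (simp add: vec_eq_iff)
    then show ?thesis by (intro exI [of _ 0]) (simp add: column_def vec_eq_iff transpose_def)
  next
    case False
    then obtain i where i: "K $ i $ i \<noteq> 0" by blast
    have sym: "K $ a $ b = K $ b $ a" for a b
      using less.prems unfolding psd_def transpose_def by (metis vec_lambda_beta)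
    have "0 \<le> axis i 1 \<bullet> (K *v axis i 1)"
      using less.prems unfolding psd_def by blast
    then have ipos: "0 < K $ i $ i"
      using i by (simp add: inner_axis' matrix_vector_mult_basis column_def)
    define v where "v = (\<chi> a. K $ a $ i / sqrt (K $ i $ i))"
    define K' where "K' = (\<chi> a b. K $ a $ b - v $ a * v $ b)"
    have vv: "v $ a * v $ b = K $ a $ i * K $ b $ i / K $ i $ i" for a b
      using ipos by (simp add: v_def)
    have "psd K'"
      unfolding psd_def
    proof safe
      show "transpose K' = K'"
        by (simp add: K'_def transpose_def vec_eq_iff sym mult.commute)
      fix x
      have "K' *v x = K *v x - (v \<bullet> x) *\<^sub>R v"
        by (simp add: vec_eq_iff K'_def matrix_vector_mult_def inner_vec_def algebra_simps
            sum_subtractf sum_distrib_left)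
      then have 1: "x \<bullet> (K' *v x) = x \<bullet> (K *v x) - (x \<bullet> v)\<^sup>2"
        by (simp add: inner_diff_right inner_commute power2_eq_square)
      have "x \<bullet> v = (x \<bullet> (K *v axis i 1)) / sqrt (K $ i $ i)"
        by (simp add: v_def inner_vec_def matrix_vector_mult_basis column_def sum_divide_distrib)
      then have "(x \<bullet> v)\<^sup>2 = (x \<bullet> (K *v axis i 1))\<^sup>2 / K $ i $ i"
        using ipos by (simp add: power_divide)
      also have "\<dots> \<le> x \<bullet> (K *v x)"
        using psd_Cauchy_Schwarz [OF less.prems, of x "axis i 1"] ipos
        by (simp add: inner_axis' matrix_vector_mult_basis column_def field_simps)
      finally show "0 \<le> x \<bullet> (K' *v x)" using 1 by simp
    qed
    have row_i: "row i K' = 0"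
    proof -
      have "K' $ i $ b = 0" for b
        using ipos sym [of i b] by (simp add: K'_def vv)
      then show ?thesis by (simp add: row_def vec_eq_iff)
    qed
    have row_k: "row k K' = 0" if "row k K = 0" for k
    proof -
      have "K $ k $ b = 0" for b using that by (simp add: row_def vec_eq_iff)
      then show ?thesis by (simp add: row_def K'_def vec_eq_iff vv)
    qed
    have "row i K \<noteq> 0" using i by (auto simp: row_def vec_eq_iff)
    then have "{k. row k K' \<noteq> 0} \<subset> {k. row k K \<noteq> 0}"
      using row_i row_k by blast
    then have "card {k. row k K' \<noteq> 0} < card {k. row k K \<noteq> 0}"
      by (intro psubset_card_mono) auto
    from less.hyps [OF this \<open>psd K'\<close>] obtain L' where
      L': "K' = L' ** transpose L'" and zero: "\<And>k. row k K' = 0 \<Longrightarrow> column k L' = 0"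
      by blast
    define L where "L = (\<chi> a k. if k = i then v $ a else L' $ a $ k)"
    have Li: "L' $ a $ i = 0" for a
      using zero [OF row_i] by (simp add: column_def vec_eq_iff)
    have "(L ** transpose L) $ a $ b = K $ a $ b" for a b
    proof -
      have "(L ** transpose L) $ a $ b = (\<Sum>k\<in>UNIV. L' $ a $ k * L' $ b $ k + (if k = i then v $ a * v $ b else 0))"
        unfolding matrix_matrix_mult_def transpose_def L_def
        by (auto intro!: sum.cong simp: Li)
      also have "\<dots> = (L' ** transpose L') $ a $ b + v $ a * v $ b"
        by (simp add: sum.distrib matrix_matrix_mult_def transpose_def)
      also have "\<dots> = K $ a $ b" by (simp add: L' [symmetric] K'_def)
      finally show ?thesis .
    qed
    then have "K = L ** transpose L" by (simp add: vec_eq_iff)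
    moreover have "column k L = 0" if "row k K = 0" for k
      using zero [OF row_k [OF that]] that \<open>row i K \<noteq> 0\<close>
      by (auto simp: column_def L_def vec_eq_iff)
    ultimately show ?thesis by blast
  qed
qed

lemma psd_factorization:
  fixes K :: "real^'n^'n"
  assumes "psd K" obtains L :: "real^'n^'n" where "K = L ** transpose L"
  using psd_factorization_aux [OF assms] by blast

lemma posdef_invertible:
  assumes "posdef K" shows "invertible K"
proof -
  have "inj ((*v) K)"
    unfolding linear_injective_0 [OF matrix_vector_mul_linear]
    using assms unfolding posdef_def by (metis inner_zero_right less_irrefl)
  then show ?thesis
    by (simp add: invertible_left_inverse matrix_left_invertible_injective)
qed

text \<open>The clause on \<open>ln \<bar>det E\<bar>\<close> links the half log-determinants of the
  rate formula to Jacobians of square roots, the form in which changes of variables produce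
  them.\<close>

lemma posdef_factorization:
  fixes K :: "real^'n^'n"
  assumes "posdef K"
  obtains E :: "real^'n^'n" where "invertible E" "K = E ** transpose E" "ln \<bar>det E\<bar> = 1/2 * ln (det K)" "0 < det K"
proof -
  obtain E :: "real^'n^'n" where E: "K = E ** transpose E"
    using psd_factorization [OF posdef_imp_psd [OF assms]] .
  have d: "det K = (det E)\<^sup>2"
    by (simp add: E det_mul power2_eq_square)
  moreover have "det K \<noteq> 0"
    using posdef_invertible [OF assms] by (simp add: invertible_det_nz)
  ultimately have "det E \<noteq> 0" by auto
  then show ?thesis
    using that [of E] E d ln_realpow [of "\<bar>det E\<bar>" 2] by (simp add: invertible_det_nz)
qed

lemma det_posdef_pos: "posdef K \<Longrightarrow> 0 < det K"
  by (erule posdef_factorization)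

lemma matrix_inv_cancel:
  assumes "invertible (A :: real^'n^'n)"
  shows "matrix_inv A ** A = mat 1" "A ** matrix_inv A = mat 1"
    "matrix_inv A *v (A *v x) = x" "A *v (matrix_inv A *v x) = x"
    "transpose (matrix_inv A) ** transpose A = mat 1" "transpose A ** transpose (matrix_inv A) = mat 1"
proof -
  have "A ** matrix_inv A = mat 1 \<and> matrix_inv A ** A = mat 1"
    unfolding matrix_inv_def using assms unfolding invertible_def by (rule someI_ex)
  then show "matrix_inv A ** A = mat 1" "A ** matrix_inv A = mat 1"
    "matrix_inv A *v (A *v x) = x" "A *v (matrix_inv A *v x) = x"
    "transpose (matrix_inv A) ** transpose A = mat 1" "transpose A ** transpose (matrix_inv A) = mat 1"
    by (simp_all add: matrix_vector_mul_assoc matrix_transpose_mul [symmetric])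
qed

text \<open>A contraction has a contraction as its transpose: by Cauchy-Schwarz the squared norm of
  \<open>transpose B *v x\<close> is at most \<open>norm x * norm (transpose B *v x)\<close>, and
  one factor cancels.\<close>

lemma psd_contraction_transpose:
  fixes B :: "real^'n^'n"
  assumes "psd (mat 1 - transpose B ** B)"
  shows "psd (mat 1 - B ** transpose B)"
proof -
  have le: "norm (B *v x) \<le> norm x" for x
  proof -
    have "0 \<le> x \<bullet> ((mat 1 - transpose B ** B) *v x)"
      using assms by (simp add: psd_def)
    then have "(norm (B *v x))\<^sup>2 \<le> (norm x)\<^sup>2"
      by (simp add: matrix_vector_mult_diff_rdistrib matrix_vector_mul_assoc [symmetric]
          inner_diff_right power2_norm_eq_inner inner_matrix_transpose [of x "transpose B"]
          del: transpose_matrix_vector)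
    then show ?thesis by (rule power2_le_imp_le) simp
  qed
  have le': "norm (transpose B *v x) \<le> norm x" for x
  proof -
    have "(norm (transpose B *v x))\<^sup>2 = x \<bullet> (B *v (transpose B *v x))"
      by (simp add: power2_norm_eq_inner inner_matrix_transpose)
    also have "\<dots> \<le> norm x * norm (B *v (transpose B *v x))" by (rule norm_cauchy_schwarz)
    also have "\<dots> \<le> norm x * norm (transpose B *v x)" by (intro mult_left_mono le) simp
    finally show ?thesis
      by (cases "norm (transpose B *v x) = 0") (auto simp: power2_eq_square)
  qed
  show ?thesis
    unfolding psd_def
  proof safe
    have "transpose (B ** transpose B) = B ** transpose B"
      by (simp add: matrix_transpose_mul)
    then show "transpose (mat 1 - B ** transpose B) = mat 1 - B ** transpose B"
      by (simp add: transpose_def vec_eq_iff mat_def)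
    fix x
    have "(norm (transpose B *v x))\<^sup>2 \<le> (norm x)\<^sup>2" by (rule power_mono [OF le']) simp
    then show "0 \<le> x \<bullet> ((mat 1 - B ** transpose B) *v x)"
      by (simp add: matrix_vector_mult_diff_rdistrib matrix_vector_mul_assoc [symmetric]
          inner_diff_right power2_norm_eq_inner inner_matrix_transpose [of x B])
  qed
qed

text \<open>If \<open>G\<^sup>T G \<preceq> H\<^sup>T H\<close>, then \<open>G x + z\<close> is a degraded version of \<open>H x + z\<close>: with independent
  standard Gaussian \<open>w\<close>, the noise \<open>B z + L w\<close> is standard Gaussian.\<close>

lemma degradation_matrices:
  fixes G H :: "real^'n^'n"
  assumes "invertible G" "invertible H" and "psd (transpose H ** H - transpose G ** G)"
  obtains B L :: "real^'n^'n" where "invertible B" "B ** H = G" "B ** transpose B + L ** transpose L = mat 1"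
proof -
  define J where "J = matrix_inv H"
  \<comment> \<open>\<open>B\<close> is forced by \<open>B ** H = G\<close>. It is a contraction, so
    its defect \<open>mat 1 - B ** transpose B\<close> has a square root, which is
    \<open>L\<close>.\<close>
  define B where "B = G ** J"
  have J: "J ** H = mat 1" "H ** J = mat 1" "transpose J ** transpose H = mat 1"
    using matrix_inv_cancel [OF assms(2)] by (simp_all add: J_def)
  have "transpose J ** (transpose H ** H - transpose G ** G) ** transpose (transpose J)
      = transpose J ** (transpose H ** H) ** J - transpose J ** (transpose G ** G) ** J"
    by (simp add: matrix_matrix_mult_def vec_eq_iff algebra_simps sum_subtractf)
  also have "transpose J ** (transpose H ** H) ** J = mat 1"
    by (simp add: matrix_mul_assoc J)
  also have "transpose J ** (transpose G ** G) ** J = transpose B ** B"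
    by (simp add: B_def matrix_transpose_mul matrix_mul_assoc)
  finally have "psd (mat 1 - transpose B ** B)"
    using psd_congruence [OF assms(3), of "transpose J"] by simp
  from psd_factorization [OF psd_contraction_transpose [OF this]]
  obtain L :: "real^'n^'n" where "mat 1 - B ** transpose B = L ** transpose L" .
  then have "B ** transpose B + L ** transpose L = mat 1"
    by (simp add: algebra_simps flip: eq_diff_eq)
  moreover have "invertible B"
    unfolding B_def using assms(1) J invertible_def by (intro invertible_mult) blast+
  moreover have "B ** H = G"
    by (simp add: B_def matrix_mul_assoc [symmetric] J)
  ultimately show ?thesis using that by blast
qed

lemma trace_gram: "trace (L ** transpose L) = (norm (L :: real^'n^'m))\<^sup>2"
  by (simp add: trace_def matrix_matrix_mult_def transpose_def norm_vec_def L2_set_def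
      power2_eq_square sum_nonneg)

text \<open>Entries of \<open>L ** transpose L\<close> are inner products of rows of
  \<open>L\<close>, each of norm at most \<open>norm L\<close>, and the trace is
  \<open>(norm L)\<^sup>2\<close>. This is what bounds the feasible set.\<close>

lemma norm_psd_le_trace:
  assumes "psd (K :: real^'n^'n)"
  shows "norm K \<le> real CARD('n) * real CARD('n) * trace K"
proof -
  obtain L :: "real^'n^'n" where L: "K = L ** transpose L" using psd_factorization [OF assms] .
  have "\<bar>K $ i $ j\<bar> \<le> trace K" for i j
  proof -
    have "K $ i $ j = (L $ i) \<bullet> (L $ j)"
      by (simp add: L matrix_matrix_mult_def transpose_def inner_vec_def)
    also have "\<bar>\<dots>\<bar> \<le> norm (L $ i) * norm (L $ j)" by (rule Cauchy_Schwarz_ineq2)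
    also have "\<dots> \<le> norm L * norm L" by (intro mult_mono) (auto intro: Finite_Cartesian_Product.norm_nth_le)
    finally show ?thesis by (simp add: L trace_gram power2_eq_square)
  qed
  then have "norm (K $ i) \<le> (\<Sum>j\<in>(UNIV::'n set). trace K)" for i
    by (intro order.trans [OF norm_le_l1_cart] sum_mono) 
  then have *: "norm (K $ i) \<le> real CARD('n) * trace K" for i by simp
  have "norm K \<le> (\<Sum>i\<in>UNIV. norm (K $ i))"
    unfolding norm_vec_def by (intro L2_set_le_sum) auto
  also have "\<dots> \<le> (\<Sum>i\<in>(UNIV::'n set). real CARD('n) * trace K)"
    by (intro sum_mono *)
  finally show ?thesis by simp
qed

section \<open>Lebesgue measure on vectors and linear changes of variables\<close>

lemma prod_Basis_cart:
  "(\<Prod>b\<in>(Basis :: (real^'n) set). g b) = (\<Prod>i\<in>UNIV. g (axis i 1))"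
proof -
  have B: "(Basis :: (real^'n) set) = (\<lambda>i. axis i 1) ` UNIV"
    by (auto simp: Basis_vec_def)
  have "inj (\<lambda>i. axis i 1 :: real^'n)"
    by (auto simp: inj_on_def axis_eq_axis)
  then show ?thesis by (simp add: B prod.reindex)
qed

lemma sum_Basis_cart:
  "(\<Sum>b\<in>(Basis :: (real^'n) set). g b) = (\<Sum>i\<in>UNIV. g (axis i 1))"
proof -
  have B: "(Basis :: (real^'n) set) = (\<lambda>i. axis i 1) ` UNIV"
    by (auto simp: Basis_vec_def)
  have "inj (\<lambda>i. axis i 1 :: real^'n)"
    by (auto simp: inj_on_def axis_eq_axis)
  then show ?thesis by (simp add: B sum.reindex)
qed

lemma borel_measurable_matrix_vector_mult [measurable]:
  "(\<lambda>x. A *v x) \<in> borel \<rightarrow>\<^sub>M (borel :: (real^'m) measure)" for A :: "real^'n^'m"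
  by (intro borel_measurable_continuous_onI linear_continuous_on matrix_vector_mul_bounded_linear)

lemma borel_measurable_matrix_vector_mult' [measurable (raw)]:
  fixes A :: "real^'n^'m"
  assumes [measurable]: "f \<in> M \<rightarrow>\<^sub>M borel"
  shows "(\<lambda>x. A *v f x) \<in> M \<rightarrow>\<^sub>M borel"
  by (rule measurable_compose [OF assms borel_measurable_matrix_vector_mult])

lemma emeasure_distr_nn_integral:
  assumes [measurable]: "f \<in> M \<rightarrow>\<^sub>M N" "A \<in> sets N"
  shows "emeasure (distr M N f) A = (\<integral>\<^sup>+x. indicator A (f x) \<partial>M)"
  using nn_integral_distr [of f M N "indicator A"] by simp

lemma nn_integral_lborel_prod_cart:
  fixes f :: "'n::finite \<Rightarrow> real \<Rightarrow> ennreal"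
  assumes [measurable]: "\<And>i. f i \<in> borel_measurable borel"
  shows "(\<integral>\<^sup>+x. (\<Prod>i\<in>UNIV. f i (x $ i)) \<partial>(lborel :: (real^'n) measure)) = (\<Prod>i\<in>UNIV. \<integral>\<^sup>+x. f i x \<partial>lborel)"
proof -
  define g where "g b = f (SOME i. b = axis i 1)" for b :: "real^'n"
  have g: "g (axis i 1) = f i" for i
    by (simp add: g_def axis_eq_axis)
  have gm: "g b \<in> borel_measurable borel" for b by (simp add: g_def)
  show ?thesis
    using nn_integral_lborel_prod [where f = g, OF gm]
    by (simp add: prod_Basis_cart g inner_axis)
qed

lemma nn_integral_lborel_plus:
  fixes a :: "'a::euclidean_space"
  assumes [measurable]: "f \<in> borel_measurable borel"
  shows "(\<integral>\<^sup>+x. f (a + x) \<partial>lborel) = (\<integral>\<^sup>+x. f x \<partial>lborel)"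
  by (subst (2) lborel_distr_plus [of a, symmetric]) (simp add: nn_integral_distr)

text \<open>Tonelli with the coordinate along \<open>m\<close> innermost: the other coordinates,
  among them \<open>x \<bullet> n\<close>, are then fixed, and the shear is a translation of the
  inner variable.\<close>

lemma nn_integral_lborel_shear:
  fixes f :: "'a::euclidean_space \<Rightarrow> ennreal"
  assumes [measurable]: "f \<in> borel_measurable borel" and mn: "m \<in> Basis" "n \<in> Basis" "m \<noteq> n"
  shows "(\<integral>\<^sup>+x. f (x + (c * (x \<bullet> n)) *\<^sub>R m) \<partial>lborel) = (\<integral>\<^sup>+x. f x \<partial>lborel)"
proof -
  interpret P: product_sigma_finite "\<lambda>_::'a. lborel :: real measure" ..
  let ?I = "Basis - {m}"
  have Bm: "Basis = insert m ?I" using mn by blast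
  have split: "(\<integral>\<^sup>+x. g x \<partial>lborel) = (\<integral>\<^sup>+x. \<integral>\<^sup>+y. g ((\<Sum>b\<in>?I. x b *\<^sub>R b) + y *\<^sub>R m) \<partial>lborel \<partial>PiM ?I (\<lambda>_. lborel))"
    if [measurable]: "g \<in> borel_measurable borel" for g :: "'a \<Rightarrow> ennreal"
  proof -
    have "(\<integral>\<^sup>+x. g x \<partial>lborel) = (\<integral>\<^sup>+x. g (\<Sum>b\<in>Basis. x b *\<^sub>R b) \<partial>PiM (insert m ?I) (\<lambda>_. lborel))"
      unfolding Bm [symmetric]
      by (subst lborel_def) (simp add: nn_integral_distr lborel_eq_real [symmetric])
    also have "\<dots> = (\<integral>\<^sup>+x. \<integral>\<^sup>+y. g (\<Sum>b\<in>Basis. (x(m := y)) b *\<^sub>R b) \<partial>lborel \<partial>PiM ?I (\<lambda>_. lborel))"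
      by (rule P.product_nn_integral_insert) auto
    also have "\<dots> = (\<integral>\<^sup>+x. \<integral>\<^sup>+y. g ((\<Sum>b\<in>?I. x b *\<^sub>R b) + y *\<^sub>R m) \<partial>lborel \<partial>PiM ?I (\<lambda>_. lborel))"
      using mn by (simp add: sum.remove [of Basis m] add.commute)
    finally show ?thesis .
  qed
  have inn: "((\<Sum>b\<in>?I. x b *\<^sub>R b) + y *\<^sub>R m) \<bullet> n = x n" for x :: "'a \<Rightarrow> real" and y
    using mn by (simp add: inner_add_left inner_sum_left inner_Basis if_distrib sum.delta cong: if_cong)
  have "(\<integral>\<^sup>+x. f (x + (c * (x \<bullet> n)) *\<^sub>R m) \<partial>lborel)
      = (\<integral>\<^sup>+x. \<integral>\<^sup>+y. f ((\<Sum>b\<in>?I. x b *\<^sub>R b) + (c * x n + y) *\<^sub>R m) \<partial>lborel \<partial>PiM ?I (\<lambda>_. lborel))"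
    by (subst split, simp) (simp only: inn, simp only: scaleR_add_left add_ac)
  also have "\<dots> = (\<integral>\<^sup>+x. \<integral>\<^sup>+y. f ((\<Sum>b\<in>?I. x b *\<^sub>R b) + y *\<^sub>R m) \<partial>lborel \<partial>PiM ?I (\<lambda>_. lborel))"
    by (intro nn_integral_cong nn_integral_lborel_plus [where f = "\<lambda>y. f (_ + y *\<^sub>R m)"]) simp
  also have "\<dots> = (\<integral>\<^sup>+x. f x \<partial>lborel)"
    by (rule split [symmetric]) simp
  finally show ?thesis .
qed

text \<open>The library's change of variables by a linear map requires a well-ordered index type.\<close>

lemma nn_integral_lborel_matrix:
  fixes A :: "real^'n^'n"
  assumes "det A \<noteq> 0" and "f \<in> borel_measurable borel"
  shows "(\<integral>\<^sup>+x. f x \<partial>lborel) = ennreal \<bar>det A\<bar> * (\<integral>\<^sup>+x. f (A *v x) \<partial>lborel)"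
proof -
  \<comment> \<open>Elementary factors may be singular, so \<open>det A \<noteq> 0\<close> becomes a
    premise inside the predicate. \<open>f\<close> is quantified inside because the product case
    uses the hypothesis for \<open>B\<close> at \<open>\<lambda>x. f (A *v x)\<close>.\<close>
  have "det A \<noteq> 0 \<longrightarrow> (\<forall>f \<in> borel_measurable borel.
    (\<integral>\<^sup>+x. f x \<partial>lborel) = ennreal \<bar>det A\<bar> * (\<integral>\<^sup>+x. f (A *v x) \<partial>lborel))" (is "?P A")
  proof (rule induct_matrix_elementary [where P = ?P])
    fix A B :: "real^'n^'n"
    assume A: "?P A" and B: "?P B"
    show "?P (A ** B)"
    proof safe
      fix f :: "real^'n \<Rightarrow> ennreal" assume f [measurable]: "f \<in> borel_measurable borel" and d: "det (A ** B) \<noteq> 0"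
      from d have dA: "det A \<noteq> 0" and dB: "det B \<noteq> 0" by (simp_all add: det_mul)
      have "(\<integral>\<^sup>+x. f x \<partial>lborel) = ennreal \<bar>det A\<bar> * (\<integral>\<^sup>+x. f (A *v x) \<partial>lborel)"
        by (rule A [rule_format, OF dA f])
      also have "(\<integral>\<^sup>+x. f (A *v x) \<partial>lborel) = ennreal \<bar>det B\<bar> * (\<integral>\<^sup>+x. f (A *v (B *v x)) \<partial>lborel)"
        by (rule B [rule_format, OF dB]) simp
      finally show "(\<integral>\<^sup>+x. f x \<partial>lborel) = ennreal \<bar>det (A ** B)\<bar> * (\<integral>\<^sup>+x. f (A ** B *v x) \<partial>lborel)"
        by (simp add: det_mul abs_mult ennreal_mult matrix_vector_mul_assoc mult.assoc)
    qed
  next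
    fix A :: "real^'n^'n" and i assume "row i A = 0"
    then show "?P A" using det_zero_row(2) by blast
  next
    fix A :: "real^'n^'n" assume d: "\<And>i j. i \<noteq> j \<Longrightarrow> A $ i $ j = 0"
    have det: "det A = (\<Prod>i\<in>UNIV. A $ i $ i)" using d by (rule det_diagonal)
    show "?P A"
    proof safe
      fix f :: "real^'n \<Rightarrow> ennreal" assume f [measurable]: "f \<in> borel_measurable borel" and "det A \<noteq> 0"
      then have nz: "A $ i $ i \<noteq> 0" for i by (simp add: det)
      define c where "c b = b \<bullet> (A *v b)" for b
      have c: "c (axis i 1) = A $ i $ i" for i
        by (simp add: c_def inner_axis' matrix_vector_mult_basis column_def)
      have Av: "(A *v x) $ i = A $ i $ i * x $ i" for x i
      proof -
        have "(\<Sum>j\<in>UNIV. A $ i $ j * x $ j) = (\<Sum>j\<in>UNIV. if j = i then A $ i $ i * x $ i else 0)"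
          by (intro sum.cong refl) (use d in auto)
        then show ?thesis by (simp add: matrix_vector_mult_def)
      qed
      have T: "(\<lambda>x. 0 + (\<Sum>j\<in>Basis. (c j * (x \<bullet> j)) *\<^sub>R j)) = (*v) A"
      proof (intro ext)
        fix x
        have "(\<Sum>j\<in>UNIV. (A $ j $ j * x $ j) *\<^sub>R (axis j 1 :: real^'n)) $ i = A $ i $ i * x $ i" for i
        proof -
          have "(\<Sum>j\<in>UNIV. (A $ j $ j * x $ j) *\<^sub>R (axis j 1 :: real^'n)) $ i
             = (\<Sum>j\<in>UNIV. if j = i then A $ i $ i * x $ i else 0)"
            unfolding sum_component by (intro sum.cong) (auto simp: axis_def)
          then show ?thesis by simp
        qed
        then show "0 + (\<Sum>j\<in>Basis. (c j * (x \<bullet> j)) *\<^sub>R j) = A *v x"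
          by (simp add: sum_Basis_cart c inner_axis vec_eq_iff Av)
      qed
      have cnz: "c j \<noteq> 0" if "j \<in> Basis" for j using that nz by (auto simp: Basis_vec_def c)
      have "lborel = density (distr lborel borel ((*v) A)) (\<lambda>_. (\<Prod>j\<in>Basis. \<bar>c j\<bar>))"
        using lborel_affine_euclidean [of c 0, OF cnz] unfolding T .
      also have "(\<Prod>j\<in>Basis. \<bar>c j\<bar>) = \<bar>det A\<bar>"
        by (simp add: prod_Basis_cart c det abs_prod)
      finally have "(\<integral>\<^sup>+x. f x \<partial>lborel) = (\<integral>\<^sup>+x. f x \<partial>density (distr lborel borel ((*v) A)) (\<lambda>_. ennreal \<bar>det A\<bar>))"
        by simp
      then show "(\<integral>\<^sup>+x. f x \<partial>lborel) = ennreal \<bar>det A\<bar> * (\<integral>\<^sup>+x. f (A *v x) \<partial>lborel)"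
        by (simp add: nn_integral_density nn_integral_distr nn_integral_cmult)
    qed
  next
    fix m n :: 'n assume "m \<noteq> n"
    let ?p = "Transposition.transpose m n"
    let ?A = "(\<chi> i j. mat 1 $ i $ ?p j) :: real^'n^'n"
    have Av: "?A *v x = (\<chi> i. x $ ?p i)" for x
    proof -
      have "(\<Sum>j\<in>UNIV. ?A $ i $ j * x $ j) = (\<Sum>j\<in>UNIV. if j = ?p i then x $ ?p i else 0)" for i
        by (intro sum.cong) (auto simp: mat_def)
      then show ?thesis by (simp only: vec_eq_iff matrix_vector_mult_def) simp
    qed
    have det: "\<bar>det ?A\<bar> = 1"
      by (simp add: det_permute_columns permutes_swap_id sign_swap_id abs_mult)
    \<comment> \<open>A permutation of coordinates takes boxes to boxes of the same volume, and
      volumes of boxes determine Lebesgue measure.\<close>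
    have "lborel = distr lborel borel ((*v) ?A)"
    proof (rule lborel_eqI)
      fix l u :: "real^'n" assume le: "\<And>b. b \<in> Basis \<Longrightarrow> l \<bullet> b \<le> u \<bullet> b"
      have le': "l $ i \<le> u $ i" for i using le [of "axis i 1"] by (simp add: inner_axis)
      have "(*v) ?A -` box l u = box (\<chi> i. l $ ?p i) (\<chi> i. u $ ?p i)"
      proof (intro set_eqI)
        have "(\<forall>i. l $ i < x $ ?p i \<and> x $ ?p i < u $ i) \<longleftrightarrow> (\<forall>i. l $ ?p i < x $ i \<and> x $ i < u $ ?p i)" for x :: "real^'n"
          by (metis transpose_involutory)
        then show "x \<in> (*v) ?A -` box l u \<longleftrightarrow> x \<in> box (\<chi> i. l $ ?p i) (\<chi> i. u $ ?p i)" for x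
          by (simp add: mem_box_cart Av)
      qed
      then have "emeasure (distr lborel borel ((*v) ?A)) (box l u) = emeasure lborel (box (\<chi> i. l $ ?p i) (\<chi> i. u $ ?p i))"
        by (simp add: emeasure_distr)
      also have "\<dots> = (\<Prod>b\<in>Basis. ((\<chi> i. u $ ?p i) - (\<chi> i. l $ ?p i)) \<bullet> b)"
        by (rule emeasure_lborel_box) (auto simp: Basis_vec_def inner_axis le')
      also have "(\<Prod>b\<in>Basis. ((\<chi> i. u $ ?p i) - (\<chi> i. l $ ?p i)) \<bullet> b) = (\<Prod>i\<in>UNIV. (u - l) $ ?p i)"
        by (simp add: prod_Basis_cart inner_axis)
      also have "\<dots> = (\<Prod>i\<in>UNIV. (u - l) $ i)"
        by (rule prod.reindex_bij_betw) simp
      also have "\<dots> = (\<Prod>b\<in>Basis. (u - l) \<bullet> b)"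
        by (simp add: prod_Basis_cart inner_axis)
      finally show "emeasure (distr lborel borel ((*v) ?A)) (box l u) = (\<Prod>b\<in>Basis. (u - l) \<bullet> b)" .
    qed simp
    then have "(\<integral>\<^sup>+x. f x \<partial>lborel) = (\<integral>\<^sup>+x. f (?A *v x) \<partial>lborel)" if "f \<in> borel_measurable borel" for f
      using nn_integral_distr [of "(*v) ?A" lborel borel f] that
      unfolding \<open>lborel = distr lborel borel ((*v) ?A)\<close> [symmetric] by simp
    then show "?P ?A" unfolding det ennreal_1 mult_1_left by blast
  next
    fix m n :: 'n and c :: real assume mn: "m \<noteq> n"
    let ?A = "(\<chi> i j. if i = m \<and> j = n then c else of_bool (i = j)) :: real^'n^'n"
    have "?A = (\<chi> k. if k = m then row m (mat 1) + c *s row n (mat 1) else row k (mat 1))"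
      using mn by (auto simp: vec_eq_iff row_def mat_def)
    then have det: "det ?A = 1"
      using det_row_operation [OF mn, of "mat 1" c] by (simp add: det_I)
    have Av: "?A *v x = x + (c * (x \<bullet> axis n 1)) *\<^sub>R axis m 1" for x
    proof -
      have "(\<Sum>j\<in>UNIV. (if i = m \<and> j = n then c else of_bool (i = j)) * x $ j)
        = (\<Sum>j\<in>UNIV. (if j = i then x $ i else 0) + (if j = n then (if i = m then c * x $ n else 0) else 0))" for i
        using mn by (intro sum.cong) auto
      then show ?thesis
        by (simp add: vec_eq_iff matrix_vector_mult_def sum.distrib inner_axis)
           (simp add: axis_def)
    qed
    show "?P ?A"
      unfolding det Av using mn
      by (auto simp: nn_integral_lborel_shear axis_eq_axis)
  qed
  then show ?thesis using assms by blast
qed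

section \<open>The standard Gaussian measure\<close>

definition gauss_density :: "real^'n \<Rightarrow> real" where
  "gauss_density z = (\<Prod>i\<in>UNIV. std_normal_density (z $ i))"

lemma gauss_density_pos [simp]: "0 < gauss_density z"
  by (auto simp: gauss_density_def normal_density_pos intro: prod_pos)

lemma gauss_density_nonneg [simp]: "0 \<le> gauss_density z"
  by (simp add: less_imp_le)

lemma gauss_density_exp:
  "gauss_density (z :: real^'n) = gauss_density (0 :: real^'n) * exp (- (norm z)\<^sup>2 / 2)"
proof -
  have "(norm z)\<^sup>2 = (\<Sum>i\<in>UNIV. (z $ i)\<^sup>2)"
    unfolding power2_norm_eq_inner by (simp add: inner_vec_def power2_eq_square)
  then have "exp (- (norm z)\<^sup>2 / 2) = (\<Prod>i\<in>UNIV. exp (- (z $ i)\<^sup>2 / 2))"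
    by (simp add: exp_sum [symmetric] sum_negf [symmetric] sum_divide_distrib)
  then show ?thesis
    by (simp add: gauss_density_def std_normal_density_def prod_dividef power_one_over)
qed

lemma borel_measurable_gauss_density [measurable]:
  "(gauss_density :: real^'n \<Rightarrow> real) \<in> borel_measurable borel"
  by (subst gauss_density_def [abs_def]) measurable

lemma std_gaussian_eq: "std_gaussian = density lborel (\<lambda>z. ennreal (gauss_density z))"
  by (simp add: std_gaussian_def gauss_density_def)

lemma nn_integral_std_gaussian:
  assumes [measurable]: "f \<in> borel_measurable borel"
  shows "(\<integral>\<^sup>+z. f z \<partial>std_gaussian) = (\<integral>\<^sup>+z. ennreal (gauss_density z) * f z \<partial>lborel)"
  by (simp add: std_gaussian_eq nn_integral_density)

lemma nn_integral_std_gaussian_component: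
  fixes f :: "real \<Rightarrow> ennreal" and i :: "'n::finite"
  assumes [measurable]: "f \<in> borel_measurable borel"
  shows "(\<integral>\<^sup>+z. f (z $ i) \<partial>(std_gaussian :: (real^'n) measure)) = (\<integral>\<^sup>+x. ennreal (std_normal_density x) * f x \<partial>lborel)"
proof -
  have one: "(\<integral>\<^sup>+x. ennreal (std_normal_density x) \<partial>lborel) = 1"
    using prob_space.emeasure_space_1 [OF prob_space_normal_density [of 1 0]]
    by (simp add: emeasure_density)
  have "(\<integral>\<^sup>+z. f (z $ i) \<partial>(std_gaussian :: (real^'n) measure))
    = (\<integral>\<^sup>+z. (\<Prod>j\<in>UNIV. ennreal (std_normal_density (z $ j)) * (if j = i then f (z $ j) else 1)) \<partial>(lborel :: (real^'n) measure))"
    by (simp add: nn_integral_std_gaussian gauss_density_def prod_ennreal [symmetric] prod.distrib)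
  also have "\<dots> = (\<Prod>j\<in>UNIV. \<integral>\<^sup>+x. ennreal (std_normal_density x) * (if j = i then f x else 1) \<partial>lborel)"
    by (rule nn_integral_lborel_prod_cart) simp
  also have "\<dots> = (\<Prod>j\<in>UNIV. if j = i then \<integral>\<^sup>+x. ennreal (std_normal_density x) * f x \<partial>lborel else 1)"
    by (intro prod.cong) (auto simp: one)
  finally show ?thesis by simp
qed

lemma distr_std_gaussian_component:
  "distr (std_gaussian :: (real^'n) measure) borel (\<lambda>z. z $ i) = density lborel (\<lambda>x. ennreal (std_normal_density x))"
proof (rule measure_eqI)
  fix A assume "A \<in> sets (distr (std_gaussian :: (real^'n) measure) borel (\<lambda>z. z $ i))"
  then have A [measurable]: "A \<in> sets borel" by simp
  have "emeasure (distr (std_gaussian :: (real^'n) measure) borel (\<lambda>z. z $ i)) A = (\<integral>\<^sup>+z. indicator A (z $ i) \<partial>(std_gaussian :: (real^'n) measure))"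
    by (rule emeasure_distr_nn_integral) simp_all
  also have "\<dots> = emeasure (density lborel (\<lambda>x. ennreal (std_normal_density x))) A"
    by (subst nn_integral_std_gaussian_component) (simp_all add: emeasure_density)
  finally show "emeasure (distr (std_gaussian :: (real^'n) measure) borel (\<lambda>z. z $ i)) A
    = emeasure (density lborel (\<lambda>x. ennreal (std_normal_density x))) A" .
qed simp

lemma prob_space_std_gaussian: "prob_space (std_gaussian :: (real^'n) measure)"
  using nn_integral_std_gaussian_component [of "\<lambda>_. 1"]
    prob_space.emeasure_space_1 [OF prob_space_normal_density [of 1 0]]
  by (intro prob_spaceI) (simp add: emeasure_density)

interpretation gauss: prob_space std_gaussian
  by (rule prob_space_std_gaussian)

text \<open>Under the reweighted law \<open>T *v v + b\<close> is standard Gaussian, and the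
  right-hand side recovers \<open>v\<close> from that vector. The changes of measure of the converse
  and the likelihood bounds of random coding all come from this.\<close>

lemma std_gaussian_change_of_variables:
  fixes T :: "real^'n^'n"
  assumes T: "invertible T"
  shows "density std_gaussian (\<lambda>v. ennreal (\<bar>det T\<bar> * (gauss_density (T *v v + b) / gauss_density v)))
       = distr std_gaussian std_gaussian (\<lambda>v. matrix_inv T *v (v - b))" (is "?D = ?E")
proof (rule measure_eqI)
  fix A assume "A \<in> sets ?D"
  then have A [measurable]: "A \<in> sets borel" by simp
  have dT: "det T \<noteq> 0" using T by (simp add: invertible_det_nz)
  have "emeasure ?D A = (\<integral>\<^sup>+v. ennreal (gauss_density v) * (ennreal (\<bar>det T\<bar> * (gauss_density (T *v v + b) / gauss_density v)) * indicator A v) \<partial>lborel)"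
    by (simp add: emeasure_density nn_integral_std_gaussian)
  also have "\<dots> = (\<integral>\<^sup>+v. ennreal \<bar>det T\<bar> * (ennreal (gauss_density (T *v v + b)) * indicator A v) \<partial>lborel)"
    by (intro nn_integral_cong)
       (simp add: ennreal_mult' [symmetric] mult.assoc [symmetric] less_imp_neq [OF gauss_density_pos, symmetric])
  also have "\<dots> = ennreal \<bar>det T\<bar> * (\<integral>\<^sup>+v. ennreal (gauss_density (T *v v + b)) * indicator A (matrix_inv T *v (T *v v)) \<partial>lborel)"
    by (simp add: nn_integral_cmult matrix_inv_cancel [OF T])
  also have "\<dots> = (\<integral>\<^sup>+v. ennreal (gauss_density (b + v)) * indicator A (matrix_inv T *v (b + v - b)) \<partial>lborel)"
    by (subst nn_integral_lborel_matrix [OF dT]) (simp_all add: add.commute)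
  also have "\<dots> = (\<integral>\<^sup>+v. ennreal (gauss_density v) * indicator A (matrix_inv T *v (v - b)) \<partial>lborel)"
    by (rule nn_integral_lborel_plus) simp
  also have "\<dots> = emeasure ?E A"
    by (subst emeasure_distr_nn_integral) (simp_all add: nn_integral_std_gaussian)
  finally show "emeasure ?D A = emeasure ?E A" .
qed simp

text \<open>With \<open>w\<close> fixed, \<open>t = B *v u + L *v w\<close> is an invertible
  substitution for \<open>u\<close>; this works for singular \<open>L\<close> too. Integrating
  \<open>w\<close> out leaves the standard density of \<open>t\<close> up to a factor
  \<open>C\<close> independent of \<open>t\<close>, and total mass one gives
  \<open>C = 1\<close>.\<close>

lemma std_gaussian_orthogonal_sum:
  fixes B L :: "real^'n^'n"
  assumes B: "invertible B" and BL: "B ** transpose B + L ** transpose L = mat 1"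
  shows "distr (std_gaussian \<Otimes>\<^sub>M std_gaussian) std_gaussian (\<lambda>(u, w). B *v u + L *v w) = std_gaussian"
    (is "?D = _")
proof -
  interpret P: pair_sigma_finite "std_gaussian :: (real^'n) measure" "std_gaussian :: (real^'n) measure" ..
  define J where "J = matrix_inv B"
  have J: "J ** B = mat 1" "B ** J = mat 1"
    using matrix_inv_cancel [OF B] by (simp_all add: J_def)
  have dJ: "det J \<noteq> 0"
    using J invertible_det_nz invertible_def by blast
  have BJ: "B *v (J *v x) = x" "J *v (B *v x) = x" for x
    by (simp_all add: matrix_vector_mul_assoc J)
  define C where "C = ennreal \<bar>det J\<bar> * (\<integral>\<^sup>+w. ennreal (gauss_density w * exp (- (norm (J *v (L *v w)))\<^sup>2 / 2)) \<partial>lborel)"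
  text \<open>Shifting \<open>w\<close> by its conditional mean \<open>L\<^sup>T t\<close> given \<open>t = B u + L w\<close> completes the square.\<close>
  have square: "gauss_density (transpose L *v t + w) * gauss_density (J *v (t - L *v (transpose L *v t + w)))
      = gauss_density t * (gauss_density w * exp (- (norm (J *v (L *v w)))\<^sup>2 / 2))" for t w
  proof -
    have decomp: "B *v (transpose B *v t) + L *v (transpose L *v t) = t"
      using arg_cong [OF BL, of "\<lambda>M. M *v t"]
      by (simp add: matrix_vector_mult_add_rdistrib matrix_vector_mul_assoc del: transpose_matrix_vector)
    from decomp have "t - L *v (transpose L *v t + w) = B *v (transpose B *v t) - L *v w"
      by (simp add: matrix_vector_right_distrib algebra_simps del: transpose_matrix_vector)
    then have 1: "J *v (t - L *v (transpose L *v t + w)) = transpose B *v t - J *v (L *v w)"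
      by (simp add: matrix_vector_mult_diff_distrib BJ del: transpose_matrix_vector)
    have 2: "(transpose B *v t) \<bullet> (J *v (L *v w)) = t \<bullet> (L *v w)"
      by (simp add: inner_matrix_transpose [symmetric] BJ del: transpose_matrix_vector)
    have 3: "(transpose L *v t) \<bullet> w = t \<bullet> (L *v w)"
      by (simp add: inner_matrix_transpose [symmetric] del: transpose_matrix_vector)
    have "t \<bullet> t = t \<bullet> (B *v (transpose B *v t) + L *v (transpose L *v t))"
      using decomp by simp
    then have 4: "(norm t)\<^sup>2 = (norm (transpose B *v t))\<^sup>2 + (norm (transpose L *v t))\<^sup>2"
      by (simp add: power2_norm_eq_inner inner_add_right inner_matrix_transpose del: transpose_matrix_vector)
    have "(norm (transpose L *v t + w))\<^sup>2 + (norm (transpose B *v t - J *v (L *v w)))\<^sup>2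
       = (norm t)\<^sup>2 + (norm w)\<^sup>2 + (norm (J *v (L *v w)))\<^sup>2"
      unfolding 4 using 2 3
      by (simp add: power2_norm_eq_inner inner_add_left inner_add_right inner_diff_left inner_diff_right inner_commute
          del: transpose_matrix_vector)
    then have "exp (- (norm (transpose L *v t + w))\<^sup>2 / 2) * exp (- (norm (transpose B *v t - J *v (L *v w)))\<^sup>2 / 2)
       = exp (- (norm t)\<^sup>2 / 2) * exp (- (norm w)\<^sup>2 / 2) * exp (- (norm (J *v (L *v w)))\<^sup>2 / 2)"
      unfolding exp_add [symmetric] by (simp add: field_simps del: transpose_matrix_vector)
    then show ?thesis
      unfolding 1
      by (subst (1 2 3 4) gauss_density_exp) (simp only: mult_ac)
  qed
  have main: "emeasure ?D A = C * emeasure std_gaussian A" if A [measurable]: "A \<in> sets borel" for A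
  proof -
    have "emeasure ?D A = (\<integral>\<^sup>+x. indicator A (case x of (u, w) \<Rightarrow> B *v u + L *v w) \<partial>(std_gaussian \<Otimes>\<^sub>M std_gaussian))"
      by (rule emeasure_distr_nn_integral) simp_all
    also have "\<dots> = (\<integral>\<^sup>+w. \<integral>\<^sup>+u. indicator A (B *v u + L *v w) \<partial>std_gaussian \<partial>std_gaussian)"
      by (subst P.nn_integral_snd [symmetric]) simp_all
    also have "\<dots> = (\<integral>\<^sup>+w. (\<integral>\<^sup>+u. ennreal (gauss_density u) * indicator A (B *v u + L *v w) \<partial>lborel) \<partial>std_gaussian)"
      by (simp add: nn_integral_std_gaussian)
    also have "\<dots> = (\<integral>\<^sup>+w. (\<integral>\<^sup>+t. ennreal \<bar>det J\<bar> * (ennreal (gauss_density (J *v (t - L *v w))) * indicator A t) \<partial>lborel) \<partial>std_gaussian)"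
    proof (rule nn_integral_cong)
      fix w :: "real^'n"
      have "(\<integral>\<^sup>+u. ennreal (gauss_density u) * indicator A (B *v u + L *v w) \<partial>lborel)
          = ennreal \<bar>det J\<bar> * (\<integral>\<^sup>+t. ennreal (gauss_density (J *v t)) * indicator A (t + L *v w) \<partial>lborel)"
        by (subst nn_integral_lborel_matrix [OF dJ]) (simp_all add: BJ)
      also have "(\<integral>\<^sup>+t. ennreal (gauss_density (J *v t)) * indicator A (t + L *v w) \<partial>lborel)
          = (\<integral>\<^sup>+t. ennreal (gauss_density (J *v (L *v w + t - L *v w))) * indicator A (L *v w + t) \<partial>lborel)"
        by (simp add: add.commute)
      also have "\<dots> = (\<integral>\<^sup>+t. ennreal (gauss_density (J *v (t - L *v w))) * indicator A t \<partial>lborel)"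
        by (rule nn_integral_lborel_plus) simp
      finally show "(\<integral>\<^sup>+u. ennreal (gauss_density u) * indicator A (B *v u + L *v w) \<partial>lborel)
        = (\<integral>\<^sup>+t. ennreal \<bar>det J\<bar> * (ennreal (gauss_density (J *v (t - L *v w))) * indicator A t) \<partial>lborel)"
        by (simp add: nn_integral_cmult)
    qed
    also have "\<dots> = (\<integral>\<^sup>+w. \<integral>\<^sup>+t. ennreal (gauss_density w) * (ennreal \<bar>det J\<bar> * (ennreal (gauss_density (J *v (t - L *v w))) * indicator A t)) \<partial>lborel \<partial>lborel)"
      by (subst nn_integral_std_gaussian, measurable)
         (rule nn_integral_cong, rule nn_integral_cmult [symmetric], measurable)
    also have "\<dots> = (\<integral>\<^sup>+t. \<integral>\<^sup>+w. ennreal (gauss_density w) * (ennreal \<bar>det J\<bar> * (ennreal (gauss_density (J *v (t - L *v w))) * indicator A t)) \<partial>lborel \<partial>lborel)"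
      by (rule lborel_pair.Fubini') simp
    also have "\<dots> = (\<integral>\<^sup>+t. C * (ennreal (gauss_density t) * indicator A t) \<partial>lborel)"
    proof (rule nn_integral_cong)
      fix t :: "real^'n"
      have "(\<integral>\<^sup>+w. ennreal (gauss_density w) * (ennreal \<bar>det J\<bar> * (ennreal (gauss_density (J *v (t - L *v w))) * indicator A t)) \<partial>lborel)
        = (\<integral>\<^sup>+w. ennreal \<bar>det J\<bar> * indicator A t * ennreal (gauss_density w * gauss_density (J *v (t - L *v w))) \<partial>lborel)"
        by (simp add: ennreal_mult mult_ac)
      also have "\<dots> = ennreal \<bar>det J\<bar> * indicator A t * (\<integral>\<^sup>+w. ennreal (gauss_density w * gauss_density (J *v (t - L *v w))) \<partial>lborel)"
        by (simp add: nn_integral_cmult)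
      also have "(\<integral>\<^sup>+w. ennreal (gauss_density w * gauss_density (J *v (t - L *v w))) \<partial>lborel)
        = (\<integral>\<^sup>+w. ennreal (gauss_density (transpose L *v t + w) * gauss_density (J *v (t - L *v (transpose L *v t + w)))) \<partial>lborel)"
        by (rule nn_integral_lborel_plus [symmetric]) simp
      also have "\<dots> = ennreal (gauss_density t) * (\<integral>\<^sup>+w. ennreal (gauss_density w * exp (- (norm (J *v (L *v w)))\<^sup>2 / 2)) \<partial>lborel)"
        by (simp only: square) (simp add: ennreal_mult nn_integral_cmult)
      finally show "(\<integral>\<^sup>+w. ennreal (gauss_density w) * (ennreal \<bar>det J\<bar> * (ennreal (gauss_density (J *v (t - L *v w))) * indicator A t)) \<partial>lborel)
        = C * (ennreal (gauss_density t) * indicator A t)"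
        by (simp add: C_def mult_ac)
    qed
    also have "\<dots> = C * emeasure std_gaussian A"
      by (simp add: nn_integral_cmult std_gaussian_eq emeasure_density)
    finally show ?thesis .
  qed
  interpret D: prob_space ?D
    by (intro prob_space.prob_space_distr prob_space_pair prob_space_std_gaussian) simp
  have "C = 1"
    using main [of UNIV] D.emeasure_space_1 by (simp add: gauss.emeasure_space_1 [simplified])
  then show ?thesis
    using main by (intro measure_eqI) simp_all
qed

lemma gauss_integrable_component_power:
  "integrable (std_gaussian :: (real^'n) measure) (\<lambda>z. (z $ i) ^ k)"
proof -
  have "integrable (distr (std_gaussian :: (real^'n) measure) borel (\<lambda>z. z $ i)) (\<lambda>x. x ^ k)"
    unfolding distr_std_gaussian_component
    by (subst integrable_density) (simp_all add: integrable_std_normal_moment normal_density_nonneg)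
  then show ?thesis
    by (subst (asm) integrable_distr_eq) simp_all
qed

text \<open>Supplies the finite variance of squared norms on which the Chebyshev bounds of the
  coding argument rest.\<close>

lemma gauss_integrable_norm_power4:
  "integrable (std_gaussian :: (real^'n) measure) (\<lambda>z. norm z ^ 4)"
proof (rule Bochner_Integration.integrable_bound)
  show "integrable (std_gaussian :: (real^'n) measure) (\<lambda>z. real CARD('n) * (\<Sum>i\<in>UNIV. (z $ i) ^ 4))"
    by (intro integrable_mult_right Bochner_Integration.integrable_sum gauss_integrable_component_power)
  show "AE z in (std_gaussian :: (real^'n) measure). norm (norm z ^ 4) \<le> norm (real CARD('n) * (\<Sum>i\<in>UNIV. (z $ i) ^ 4))"
  proof (intro AE_I2)
    fix z :: "real^'n"
    have "(norm z)\<^sup>2 = (\<Sum>i\<in>UNIV. (z $ i)\<^sup>2)"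
      unfolding power2_norm_eq_inner by (simp add: inner_vec_def power2_eq_square)
    moreover have "norm z ^ 4 = ((norm z)\<^sup>2)\<^sup>2"
      by (simp flip: power_mult)
    ultimately have "norm z ^ 4 = (\<Sum>i\<in>UNIV. (z $ i)\<^sup>2)\<^sup>2"
      by simp
    also have "\<dots> \<le> (\<Sum>i\<in>UNIV. ((z $ i)\<^sup>2)\<^sup>2) * real CARD('n)"
      by (rule sum_squared_le_sum_of_squares)
    finally show "norm (norm z ^ 4) \<le> norm (real CARD('n) * (\<Sum>i\<in>UNIV. (z $ i) ^ 4))"
      by (simp add: mult.commute sum_nonneg)
  qed
  show "(\<lambda>z. norm z ^ 4) \<in> borel_measurable (std_gaussian :: (real^'n) measure)" by simp
qed

lemma gauss_integrable_inner_power2: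
  "integrable (std_gaussian :: (real^'n) measure) (\<lambda>z. (c + a \<bullet> z)\<^sup>2)"
  "integrable (std_gaussian :: (real^'n) measure) (\<lambda>z. a \<bullet> z)"
  "integrable (std_gaussian :: (real^'n) measure) (\<lambda>z. z $ i * z $ j)"
proof -
  show ij: "integrable (std_gaussian :: (real^'n) measure) (\<lambda>z. z $ i * z $ j)" for i j
  proof (rule Bochner_Integration.integrable_bound)
    show "integrable (std_gaussian :: (real^'n) measure) (\<lambda>z. (z $ i)\<^sup>2 + (z $ j)\<^sup>2)"
      by (intro Bochner_Integration.integrable_add gauss_integrable_component_power)
    have "\<bar>x * y\<bar> \<le> x\<^sup>2 + y\<^sup>2" for x y :: real
      using sum_squares_bound [of "\<bar>x\<bar>" "\<bar>y\<bar>"] mult_nonneg_nonneg [of "\<bar>x\<bar>" "\<bar>y\<bar>"]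
      unfolding abs_mult power2_abs by linarith
    then show "AE z in (std_gaussian :: (real^'n) measure). norm (z $ i * z $ j) \<le> norm ((z $ i)\<^sup>2 + (z $ j)\<^sup>2)"
      by (intro AE_I2) simp
  qed simp
  show lin: "integrable (std_gaussian :: (real^'n) measure) (\<lambda>z. a \<bullet> z)"
    unfolding inner_vec_def
    using gauss_integrable_component_power [where 'n = 'n and k = 1]
    by (intro Bochner_Integration.integrable_sum) simp
  have "(c + a \<bullet> z)\<^sup>2 = c\<^sup>2 + 2 * c * (a \<bullet> z) + (\<Sum>i\<in>UNIV. \<Sum>j\<in>UNIV. a $ i * a $ j * (z $ i * z $ j))" for z
    by (simp add: power2_eq_square inner_vec_def sum_product algebra_simps)
  then show "integrable (std_gaussian :: (real^'n) measure) (\<lambda>z. (c + a \<bullet> z)\<^sup>2)"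
    using ij lin
    by (simp only:)
       (intro Bochner_Integration.integrable_add Bochner_Integration.integrable_sum integrable_mult_right gauss.integrable_const)
qed

text \<open>Mixed second moments vanish because flipping the sign of a coordinate preserves the measure.\<close>

lemma distr_std_gaussian_sign_flip:
  "distr (std_gaussian :: (real^'n) measure) std_gaussian (\<lambda>z. (\<chi> i. if i \<in> I then - z $ i else z $ i)) = std_gaussian"
proof -
  define S :: "real^'n^'n" where "S = (\<chi> i j. if i = j then (if i \<in> I then - 1 else 1) else 0)"
  have SS: "S ** S = mat 1"
  proof -
    have "(S ** S) $ i $ j = (\<Sum>k\<in>UNIV. if k = i then mat 1 $ i $ j else 0)" for i j
    proof -
      have "(\<Sum>k\<in>UNIV. S $ i $ k * S $ k $ j) = (\<Sum>k\<in>UNIV. if k = i then mat 1 $ i $ j else 0)"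
        by (intro sum.cong) (auto simp: S_def mat_def)
      then show ?thesis by (simp add: matrix_matrix_mult_def)
    qed
    then show ?thesis by (simp add: vec_eq_iff)
  qed
  have "transpose S = S" by (auto simp: S_def transpose_def vec_eq_iff)
  have "invertible S" using SS invertible_def by blast
  have Sz: "S *v z = (\<chi> i. if i \<in> I then - z $ i else z $ i)" for z
  proof -
    have "(\<Sum>j\<in>UNIV. S $ i $ j * z $ j) = (\<Sum>j\<in>UNIV. if j = i then (if i \<in> I then - z $ i else z $ i) else 0)" for i
      by (intro sum.cong) (auto simp: S_def)
    then show ?thesis by (simp add: matrix_vector_mult_def vec_eq_iff)
  qed
  have eq: "(\<lambda>v. matrix_inv S *v (v - 0)) = (\<lambda>v. S *v v)"
  proof
    fix v
    have "matrix_inv S *v (S *v (S *v v)) = S *v v"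
      by (rule matrix_inv_cancel [OF \<open>invertible S\<close>])
    then show "matrix_inv S *v (v - 0) = S *v v"
      by (simp add: matrix_vector_mul_assoc SS)
  qed
  have "(det S)\<^sup>2 = 1" using arg_cong [OF SS, of det] by (simp add: det_mul power2_eq_square)
  then have "\<bar>det S\<bar> = 1" by (simp add: power2_eq_1_iff) auto
  moreover have "norm (S *v v) = norm v" for v
    by (simp add: Sz norm_vec_def L2_set_def if_distrib cong: if_cong)
  then have "gauss_density (S *v v) = gauss_density v" for v
    by (subst (1 2) gauss_density_exp) simp
  ultimately have "density std_gaussian (\<lambda>v. ennreal (\<bar>det S\<bar> * (gauss_density (S *v v + 0) / gauss_density v))) = std_gaussian"
    by (simp add: less_imp_neq [OF gauss_density_pos, symmetric] density_1)
  then show ?thesis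
    using std_gaussian_change_of_variables [OF \<open>invertible S\<close>, of 0] unfolding eq Sz by simp
qed

lemma gauss_moments:
  fixes a :: "real^'n"
  shows "(\<integral>z. a \<bullet> z \<partial>std_gaussian) = 0"
    and "(\<integral>z. (c + a \<bullet> z)\<^sup>2 \<partial>std_gaussian) = c\<^sup>2 + (norm a)\<^sup>2"
proof -
  have flip: "(\<integral>z. f z \<partial>std_gaussian) = (\<integral>z. f (\<chi> i. if i \<in> I then - z $ i else z $ i) \<partial>std_gaussian)"
    if [measurable]: "f \<in> borel_measurable borel" for f :: "real^'n \<Rightarrow> real" and I
  proof -
    have [measurable]: "(\<lambda>z::real^'n. \<chi> i. if i \<in> I then - z $ i else z $ i) \<in> borel \<rightarrow>\<^sub>M borel"
    proof (intro borel_measurable_continuous_onI continuous_on_vec_lambda)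
      show "continuous_on UNIV (\<lambda>z::real^'n. if i \<in> I then - z $ i else z $ i)" for i
        by (cases "i \<in> I") (simp_all add: continuous_on_minus continuous_on_component)
    qed
    show ?thesis
      by (subst distr_std_gaussian_sign_flip [of I, symmetric]) (simp add: integral_distr)
  qed
  have "(\<integral>z. a \<bullet> z \<partial>std_gaussian) = (\<integral>z. - (a \<bullet> z) \<partial>std_gaussian)"
    using flip [of "\<lambda>z. a \<bullet> z" UNIV] by (simp add: inner_vec_def sum_negf)
  then show lin: "(\<integral>z. a \<bullet> z \<partial>std_gaussian) = 0" by simp
  have off: "(\<integral>z. z $ i * z $ j \<partial>(std_gaussian :: (real^'n) measure)) = 0" if "i \<noteq> j" for i j
    using flip [of "\<lambda>z. z $ i * z $ j" "{i}"] that by simp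
  have diag: "(\<integral>z. z $ i * z $ i \<partial>(std_gaussian :: (real^'n) measure)) = 1" for i
  proof -
    have "(\<integral>z. z $ i * z $ i \<partial>(std_gaussian :: (real^'n) measure)) = (\<integral>x. x * x \<partial>distr (std_gaussian :: (real^'n) measure) borel (\<lambda>z. z $ i))"
      by (simp add: integral_distr)
    also have "\<dots> = (\<integral>x. std_normal_density x * x ^ (2 * 1) \<partial>lborel)"
      unfolding distr_std_gaussian_component
      by (subst integral_density) (simp_all add: normal_density_nonneg power2_eq_square)
    also have "\<dots> = 1" by (subst integral_std_normal_moment_even) simp
    finally show ?thesis .
  qed
  have sq: "(c + a \<bullet> z)\<^sup>2 = c\<^sup>2 + 2 * c * (a \<bullet> z) + (\<Sum>i\<in>UNIV. \<Sum>j\<in>UNIV. a $ i * a $ j * (z $ i * z $ j))" for z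
    by (simp add: power2_eq_square inner_vec_def sum_product algebra_simps)
  have "(\<integral>z. (c + a \<bullet> z)\<^sup>2 \<partial>std_gaussian) = c\<^sup>2 + 2 * c * (\<integral>z. a \<bullet> z \<partial>std_gaussian)
      + (\<Sum>i\<in>UNIV. \<Sum>j\<in>UNIV. a $ i * a $ j * (\<integral>z. z $ i * z $ j \<partial>(std_gaussian :: (real^'n) measure)))"
  proof -
    have 1: "integrable std_gaussian (\<lambda>z. c\<^sup>2 + 2 * c * (a \<bullet> z))"
      and 2: "integrable std_gaussian (\<lambda>z. \<Sum>i\<in>UNIV. \<Sum>j\<in>UNIV. a $ i * a $ j * (z $ i * z $ j))"
      by (intro Bochner_Integration.integrable_add Bochner_Integration.integrable_sum integrable_mult_right
          gauss.integrable_const gauss_integrable_inner_power2)+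
    have "(\<integral>z. c\<^sup>2 + 2 * c * (a \<bullet> z) \<partial>std_gaussian) = c\<^sup>2 + 2 * c * (\<integral>z. a \<bullet> z \<partial>std_gaussian)"
      by (subst Bochner_Integration.integral_add)
         (simp_all add: gauss_integrable_inner_power2 gauss.prob_space [simplified])
    moreover have "(\<integral>z. (\<Sum>i\<in>UNIV. \<Sum>j\<in>UNIV. a $ i * a $ j * (z $ i * z $ j)) \<partial>std_gaussian)
      = (\<Sum>i\<in>UNIV. \<Sum>j\<in>UNIV. a $ i * a $ j * (\<integral>z. z $ i * z $ j \<partial>(std_gaussian :: (real^'n) measure)))"
    proof -
      have "(\<integral>z. (\<Sum>j\<in>UNIV. a $ i * a $ j * (z $ i * z $ j)) \<partial>std_gaussian)
        = (\<Sum>j\<in>UNIV. a $ i * a $ j * (\<integral>z. z $ i * z $ j \<partial>(std_gaussian :: (real^'n) measure)))" for i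
        by (simp add: gauss_integrable_inner_power2)
      moreover have "integrable std_gaussian (\<lambda>z. \<Sum>j\<in>UNIV. a $ i * a $ j * (z $ i * z $ j))" for i
        by (intro Bochner_Integration.integrable_sum integrable_mult_right gauss_integrable_inner_power2)
      ultimately show ?thesis by simp
    qed
    ultimately show ?thesis
      unfolding sq by (simp only: Bochner_Integration.integral_add [OF 1 2])
  qed
  also have "(\<Sum>i\<in>UNIV. \<Sum>j\<in>UNIV. a $ i * a $ j * (\<integral>z. z $ i * z $ j \<partial>(std_gaussian :: (real^'n) measure)))
    = (\<Sum>i\<in>UNIV. \<Sum>j\<in>UNIV. if j = i then a $ i * a $ i else 0)"
    by (intro sum.cong refl) (auto simp: off diag)
  also have "\<dots> = (norm a)\<^sup>2"
    by (simp add: power2_norm_eq_inner inner_vec_def)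
  finally show "(\<integral>z. (c + a \<bullet> z)\<^sup>2 \<partial>std_gaussian) = c\<^sup>2 + (norm a)\<^sup>2"
    by (simp add: lin)
qed

lemma norm_affine_power2:
  fixes A :: "real^'n^'m"
  shows "(norm (x + A *v z))\<^sup>2 = (\<Sum>i\<in>UNIV. (x $ i + A $ i \<bullet> z)\<^sup>2)"
  unfolding power2_norm_eq_inner by (simp add: inner_vec_def matrix_vector_mult_def power2_eq_square)

lemma gauss_integrable_norm_affine:
  fixes A :: "real^'n^'m"
  shows "integrable std_gaussian (\<lambda>z. (norm (x + A *v z))\<^sup>2)"
  unfolding norm_affine_power2
  by (intro Bochner_Integration.integrable_sum gauss_integrable_inner_power2)

lemma gauss_integral_norm_affine:
  fixes A :: "real^'n^'m"
  shows "(\<integral>z. (norm (x + A *v z))\<^sup>2 \<partial>std_gaussian) = (norm x)\<^sup>2 + (norm A)\<^sup>2"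
proof -
  have 1: "(norm x)\<^sup>2 = (\<Sum>i\<in>UNIV. (x $ i)\<^sup>2)"
    unfolding power2_norm_eq_inner by (simp add: inner_vec_def power2_eq_square)
  have 2: "(norm A)\<^sup>2 = (\<Sum>i\<in>UNIV. (norm (A $ i))\<^sup>2)"
    by (simp add: norm_vec_def L2_set_def sum_nonneg)
  show ?thesis
    unfolding norm_affine_power2 1 2
    by (simp add: Bochner_Integration.integral_sum gauss_integrable_inner_power2 gauss_moments sum.distrib)
qed

section \<open>Product measures\<close>

lemma product_sigma_finite_prob:
  assumes "\<And>i. prob_space (M i)" shows "product_sigma_finite M"
  by (rule product_sigma_finite.intro) (rule prob_space_imp_sigma_finite [OF assms])

text \<open>Indicators of boxes factor over the coordinates, so by Tonelli a box receives the
  product of its one-coordinate masses, and this determines a product measure.\<close>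

lemma distr_PiM_pair:
  assumes I: "finite I"
    and M: "\<And>i. prob_space (M i)" and N: "\<And>i. prob_space (N i)" and K: "\<And>i. prob_space (K i)"
    and f [measurable]: "\<And>i. f i \<in> M i \<Otimes>\<^sub>M N i \<rightarrow>\<^sub>M K i"
    and distr: "\<And>i. distr (M i \<Otimes>\<^sub>M N i) (K i) (f i) = K i"
  shows "distr (PiM I M \<Otimes>\<^sub>M PiM I N) (PiM I K) (\<lambda>(x, y). \<lambda>i\<in>I. f i (x i, y i)) = PiM I K"
proof -
  interpret PM: product_sigma_finite M using M by (rule product_sigma_finite_prob)
  interpret PN: product_sigma_finite N using N by (rule product_sigma_finite_prob)
  interpret PK: product_sigma_finite K using K by (rule product_sigma_finite_prob)
  interpret N': sigma_finite_measure "PiM I N"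
    by (rule prob_space_imp_sigma_finite [OF prob_space_PiM]) (rule N)
  have F [measurable]: "(\<lambda>(x, y). \<lambda>i\<in>I. f i (x i, y i)) \<in> PiM I M \<Otimes>\<^sub>M PiM I N \<rightarrow>\<^sub>M PiM I K"
    by measurable
  show ?thesis
  proof (rule PK.PiM_eqI [OF I])
    fix A assume A [measurable]: "\<And>i. i \<in> I \<Longrightarrow> A i \<in> sets (K i)"
    \<comment> \<open>Nothing is known about \<open>A i\<close> outside \<open>I\<close>; the value
      1 there makes every \<open>?h i\<close> measurable, and the products below run over
      \<open>I\<close> only.\<close>
    let ?h = "\<lambda>i p. if i \<in> I then indicator (A i) (f i p) else (1 :: ennreal)"
    have h [measurable]: "?h i \<in> borel_measurable (M i \<Otimes>\<^sub>M N i)" for i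
      by (cases "i \<in> I") auto
    have ind: "indicator (Pi\<^sub>E I A) (\<lambda>i\<in>I. f i (x i, y i)) = (\<Prod>i\<in>I. ?h i (x i, y i))" for x y
      using I by (auto simp: indicator_def prod_zero_iff PiE_iff extensional_def)
    have "Pi\<^sub>E I A \<in> sets (PiM I K)" using I A by auto
    then have "emeasure (distr (PiM I M \<Otimes>\<^sub>M PiM I N) (PiM I K) (\<lambda>(x, y). \<lambda>i\<in>I. f i (x i, y i))) (Pi\<^sub>E I A)
      = (\<integral>\<^sup>+p. indicator (Pi\<^sub>E I A) (case p of (x, y) \<Rightarrow> \<lambda>i\<in>I. f i (x i, y i)) \<partial>(PiM I M \<Otimes>\<^sub>M PiM I N))"
      by (rule emeasure_distr_nn_integral [OF F])
    also have "\<dots> = (\<integral>\<^sup>+p. (\<Prod>i\<in>I. ?h i (fst p i, snd p i)) \<partial>(PiM I M \<Otimes>\<^sub>M PiM I N))"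
      by (intro nn_integral_cong) (auto simp: ind split: prod.split)
    also have "\<dots> = (\<integral>\<^sup>+x. \<integral>\<^sup>+y. (\<Prod>i\<in>I. ?h i (x i, y i)) \<partial>PiM I N \<partial>PiM I M)"
      by (subst N'.nn_integral_fst [symmetric]) simp_all
    also have "\<dots> = (\<integral>\<^sup>+x. (\<Prod>i\<in>I. \<integral>\<^sup>+y. ?h i (x i, y) \<partial>N i) \<partial>PiM I M)"
    proof (rule nn_integral_cong)
      fix x assume "x \<in> space (PiM I M)"
      then have x [simp]: "x i \<in> space (M i)" if "i \<in> I" for i using that by (auto simp: space_PiM)
      show "(\<integral>\<^sup>+y. (\<Prod>i\<in>I. ?h i (x i, y i)) \<partial>PiM I N) = (\<Prod>i\<in>I. \<integral>\<^sup>+y. ?h i (x i, y) \<partial>N i)"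
        by (rule PN.product_nn_integral_prod [OF I, of "\<lambda>i y. ?h i (x i, y)"])
           (rule measurable_compose_Pair1 [OF x h])
    qed
    also have "\<dots> = (\<Prod>i\<in>I. \<integral>\<^sup>+x. \<integral>\<^sup>+y. ?h i (x, y) \<partial>N i \<partial>M i)"
      by (rule PM.product_nn_integral_prod [OF I, of "\<lambda>i x. \<integral>\<^sup>+y. ?h i (x, y) \<partial>N i"])
         (rule sigma_finite_measure.borel_measurable_nn_integral_fst [OF prob_space_imp_sigma_finite [OF N] h])
    also have "\<dots> = (\<Prod>i\<in>I. emeasure (K i) (A i))"
    proof (rule prod.cong [OF refl])
      fix i assume "i \<in> I"
      have "emeasure (K i) (A i) = emeasure (distr (M i \<Otimes>\<^sub>M N i) (K i) (f i)) (A i)"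
        by (simp add: distr)
      also have "\<dots> = (\<integral>\<^sup>+p. ?h i p \<partial>(M i \<Otimes>\<^sub>M N i))"
        using \<open>i \<in> I\<close> by (subst emeasure_distr_nn_integral) auto
      also have "\<dots> = (\<integral>\<^sup>+x. \<integral>\<^sup>+y. ?h i (x, y) \<partial>N i \<partial>M i)"
        by (rule sigma_finite_measure.nn_integral_fst [OF prob_space_imp_sigma_finite [OF N] h, symmetric])
      finally show "(\<integral>\<^sup>+x. \<integral>\<^sup>+y. ?h i (x, y) \<partial>N i \<partial>M i) = emeasure (K i) (A i)" ..
    qed
    finally show "emeasure (distr (PiM I M \<Otimes>\<^sub>M PiM I N) (PiM I K) (\<lambda>(x, y). \<lambda>i\<in>I. f i (x i, y i))) (Pi\<^sub>E I A)
      = (\<Prod>i\<in>I. emeasure (K i) (A i))" .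
  qed simp
qed

text \<open>Either side is the product of the one-coordinate measures \<open>K i\<close>, as a
  comparison on boxes shows.\<close>

lemma density_PiM:
  assumes I: "finite I"
    and M: "\<And>i. prob_space (M i)" and N: "\<And>i. prob_space (N i)"
    and \<rho> [measurable]: "\<And>i. \<rho> i \<in> borel_measurable (M i)"
    and \<tau> [measurable]: "\<And>i. \<tau> i \<in> N i \<rightarrow>\<^sub>M M i"
    and eq: "\<And>i. density (M i) (\<rho> i) = distr (N i) (M i) (\<tau> i)"
  shows "density (PiM I M) (\<lambda>x. \<Prod>i\<in>I. \<rho> i (x i)) = distr (PiM I N) (PiM I M) (\<lambda>x. \<lambda>i\<in>I. \<tau> i (x i))"
proof -
  interpret PM: product_sigma_finite M using M by (rule product_sigma_finite_prob)
  interpret PN: product_sigma_finite N using N by (rule product_sigma_finite_prob)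
  define K where "K i = distr (N i) (M i) (\<tau> i)" for i
  have setsK [simp, measurable_cong]: "sets (K i) = sets (M i)" for i by (simp add: K_def)
  have "prob_space (K i)" for i
    unfolding K_def by (rule prob_space.prob_space_distr [OF N \<tau>])
  then interpret PK: product_sigma_finite K by (rule product_sigma_finite_prob)
  have setsPK: "sets (PiM I K) = sets (PiM I M)" by (rule sets_PiM_cong) simp_all
  have ind: "indicator (Pi\<^sub>E I A) x = (\<Prod>i\<in>I. indicator (A i) (x i) :: ennreal)" if "x \<in> extensional I" for A x
    using I that by (auto simp: indicator_def prod_zero_iff PiE_iff)
  have "density (PiM I M) (\<lambda>x. \<Prod>i\<in>I. \<rho> i (x i)) = PiM I K"
  proof (rule PK.PiM_eqI [OF I])
    fix A assume A: "\<And>i. i \<in> I \<Longrightarrow> A i \<in> sets (K i)"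
    then have A' [measurable]: "A i \<in> sets (M i)" if "i \<in> I" for i using that by simp
    have "Pi\<^sub>E I A \<in> sets (PiM I M)" using I A' by auto
    then have "emeasure (density (PiM I M) (\<lambda>x. \<Prod>i\<in>I. \<rho> i (x i))) (Pi\<^sub>E I A)
      = (\<integral>\<^sup>+x. (\<Prod>i\<in>I. \<rho> i (x i)) * indicator (Pi\<^sub>E I A) x \<partial>PiM I M)"
      by (subst emeasure_density) simp_all
    also have "\<dots> = (\<integral>\<^sup>+x. (\<Prod>i\<in>I. \<rho> i (x i) * indicator (A i) (x i)) \<partial>PiM I M)"
      by (intro nn_integral_cong) (simp add: ind prod.distrib space_PiM PiE_iff)
    also have "\<dots> = (\<Prod>i\<in>I. \<integral>\<^sup>+x. \<rho> i x * indicator (A i) x \<partial>M i)"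
      by (rule PM.product_nn_integral_prod [OF I, of "\<lambda>i x. \<rho> i x * indicator (A i) x"]) simp
    also have "\<dots> = (\<Prod>i\<in>I. emeasure (K i) (A i))"
      by (intro prod.cong refl) (simp add: K_def eq [symmetric] emeasure_density)
    finally show "emeasure (density (PiM I M) (\<lambda>x. \<Prod>i\<in>I. \<rho> i (x i))) (Pi\<^sub>E I A) = (\<Prod>i\<in>I. emeasure (K i) (A i))" .
  qed (simp add: setsPK)
  moreover have "distr (PiM I N) (PiM I M) (\<lambda>x. \<lambda>i\<in>I. \<tau> i (x i)) = PiM I K"
  proof (rule PK.PiM_eqI [OF I])
    fix A assume A: "\<And>i. i \<in> I \<Longrightarrow> A i \<in> sets (K i)"
    then have A' [measurable]: "A i \<in> sets (M i)" if "i \<in> I" for i using that by simp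
    have "Pi\<^sub>E I A \<in> sets (PiM I M)" using I A' by auto
    then have "emeasure (distr (PiM I N) (PiM I M) (\<lambda>x. \<lambda>i\<in>I. \<tau> i (x i))) (Pi\<^sub>E I A)
      = (\<integral>\<^sup>+x. indicator (Pi\<^sub>E I A) (\<lambda>i\<in>I. \<tau> i (x i)) \<partial>PiM I N)"
      by (intro emeasure_distr_nn_integral) simp_all
    also have "\<dots> = (\<integral>\<^sup>+x. (\<Prod>i\<in>I. indicator (A i) (\<tau> i (x i))) \<partial>PiM I N)"
      by (intro nn_integral_cong) (simp add: ind cong: prod.cong)
    also have "\<dots> = (\<Prod>i\<in>I. \<integral>\<^sup>+x. indicator (A i) (\<tau> i x) \<partial>N i)"
      by (rule PN.product_nn_integral_prod [OF I, of "\<lambda>i x. indicator (A i) (\<tau> i x)"]) simp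
    also have "\<dots> = (\<Prod>i\<in>I. emeasure (K i) (A i))"
      by (intro prod.cong refl) (simp add: K_def emeasure_distr_nn_integral)
    finally show "emeasure (distr (PiM I N) (PiM I M) (\<lambda>x. \<lambda>i\<in>I. \<tau> i (x i))) (Pi\<^sub>E I A) = (\<Prod>i\<in>I. emeasure (K i) (A i))" .
  qed (simp add: setsPK)
  ultimately show ?thesis by simp
qed

lemma integral_PiM_component:
  fixes f :: "'a \<Rightarrow> real"
  assumes "\<And>i. prob_space (M i)" "i \<in> I" and [measurable]: "f \<in> borel_measurable (M i)"
  shows "(\<integral>x. f (x i) \<partial>PiM I M) = (\<integral>x. f x \<partial>M i)"
    and "integrable (PiM I M) (\<lambda>x. f (x i)) \<longleftrightarrow> integrable (M i) f"
proof -
  have d: "distr (PiM I M) (M i) (\<lambda>x. x i) = M i"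
    using assms by (intro distr_PiM_component) auto
  have [measurable]: "(\<lambda>x. x i) \<in> PiM I M \<rightarrow>\<^sub>M M i" using assms(2) by simp
  show "(\<integral>x. f (x i) \<partial>PiM I M) = (\<integral>x. f x \<partial>M i)"
    using integral_distr [of "\<lambda>x. x i" "PiM I M" "M i" f] by (simp add: d)
  show "integrable (PiM I M) (\<lambda>x. f (x i)) \<longleftrightarrow> integrable (M i) f"
    using integrable_distr_eq [of "\<lambda>x. x i" "PiM I M" "M i" f] by (simp add: d)
qed

text \<open>Centred functions of distinct coordinates are orthogonal by independence, so only the
  \<open>n\<close> diagonal terms of the squared sum survive.\<close>

lemma variance_sum_PiM:
  fixes f :: "'a \<Rightarrow> real"
  assumes M: "prob_space M" and f [measurable]: "f \<in> borel_measurable M"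
    and f2: "integrable M (\<lambda>x. (f x)\<^sup>2)"
  defines "m \<equiv> (\<integral>x. f x \<partial>M)"
  shows "integrable (PiM {..<n} (\<lambda>_. M)) (\<lambda>\<omega>. ((\<Sum>j<n. f (\<omega> j)) - real n * m)\<^sup>2)"
    and "(\<integral>\<omega>. ((\<Sum>j<n. f (\<omega> j)) - real n * m)\<^sup>2 \<partial>PiM {..<n} (\<lambda>_. M)) = real n * (\<integral>x. (f x - m)\<^sup>2 \<partial>M)"
proof -
  interpret M: prob_space M by fact
  let ?P = "PiM {..<n} (\<lambda>_. M)"
  interpret PS: product_sigma_finite "\<lambda>_::nat. M" by (rule product_sigma_finite_prob) (rule M)
  define g where "g x = f x - m" for x
  have [measurable]: "g \<in> borel_measurable M" by (simp add: g_def [abs_def])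
  have f1: "integrable M f" by (rule M.square_integrable_imp_integrable [OF f f2])
  have g1: "integrable M g" using f1 by (simp add: g_def [abs_def])
  have g2: "integrable M (\<lambda>x. (g x)\<^sup>2)"
    using f1 f2 by (simp add: g_def [abs_def] power2_diff)
  have g0: "(\<integral>x. g x \<partial>M) = 0"
    using f1 by (simp add: g_def [abs_def] m_def M.prob_space)
  define V where "V = (\<integral>x. (g x)\<^sup>2 \<partial>M)"
  have pair: "integrable ?P (\<lambda>\<omega>. g (\<omega> j) * g (\<omega> k)) \<and> (\<integral>\<omega>. g (\<omega> j) * g (\<omega> k) \<partial>?P) = (if j = k then V else 0)"
    if "j < n" "k < n" for j k
  proof (cases "j = k")
    case True
    then show ?thesis
      using integral_PiM_component [of "\<lambda>_. M" j "{..<n}" "\<lambda>x. (g x)\<^sup>2"] M that g2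
      by (simp add: V_def power2_eq_square)
  next
    case False
    \<comment> \<open>Padding with the constant 1 turns a product of two coordinates into one over
      all coordinates, whose integral factors; the factor at \<open>j\<close> is zero.\<close>
    let ?G = "\<lambda>i x. if i = j \<or> i = k then g x else 1"
    have "(\<Prod>i<n. ?G i (\<omega> i)) = g (\<omega> j) * g (\<omega> k)" for \<omega> :: "nat \<Rightarrow> 'a"
    proof -
      have "(\<Prod>i<n. ?G i (\<omega> i)) = (\<Prod>i\<in>{j, k}. g (\<omega> i))"
        using that by (intro prod.mono_neutral_cong_right) auto
      then show ?thesis using False by simp
    qed
    moreover have Gi: "integrable M (?G i)" for i using g1 by (cases "i = j \<or> i = k") auto
    moreover have "(\<Prod>i<n. \<integral>x. ?G i x \<partial>M) = 0"
      using that g0 by (intro prod_zero) (auto intro!: bexI [of _ j])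
    ultimately show ?thesis
      using PS.product_integral_prod [of "{..<n}" ?G] PS.product_integrable_prod [of "{..<n}" ?G] False
      by simp
  qed
  define F where "F \<omega> = (\<Sum>j<n. g (\<omega> j))" for \<omega> :: "nat \<Rightarrow> 'a"
  have [measurable]: "F \<in> borel_measurable ?P" unfolding F_def [abs_def] by measurable
  have F2: "(F \<omega>)\<^sup>2 = (\<Sum>j<n. \<Sum>k<n. g (\<omega> j) * g (\<omega> k))" for \<omega>
    by (simp add: F_def power2_eq_square sum_product)
  have iF2: "integrable ?P (\<lambda>\<omega>. (F \<omega>)\<^sup>2)"
    unfolding F2 using pair by (intro Bochner_Integration.integrable_sum) auto
  have "(\<integral>\<omega>. (F \<omega>)\<^sup>2 \<partial>?P) = (\<Sum>j<n. \<Sum>k<n. \<integral>\<omega>. g (\<omega> j) * g (\<omega> k) \<partial>?P)"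
    unfolding F2 using pair
    by (subst Bochner_Integration.integral_sum, intro Bochner_Integration.integrable_sum, simp,
        intro sum.cong refl Bochner_Integration.integral_sum) simp
  also have "\<dots> = (\<Sum>j<n. \<Sum>k<n. if j = k then V else 0)"
    using pair by (intro sum.cong refl) auto
  also have "\<dots> = real n * V" by simp
  finally have VF: "(\<integral>\<omega>. (F \<omega>)\<^sup>2 \<partial>?P) = real n * V" .
  have "F \<omega> = (\<Sum>j<n. f (\<omega> j)) - real n * m" for \<omega>
    by (simp add: F_def g_def sum_subtractf)
  then show "integrable ?P (\<lambda>\<omega>. ((\<Sum>j<n. f (\<omega> j)) - real n * m)\<^sup>2)"
    and "(\<integral>\<omega>. ((\<Sum>j<n. f (\<omega> j)) - real n * m)\<^sup>2 \<partial>?P) = real n * (\<integral>x. (f x - m)\<^sup>2 \<partial>M)"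
    using iF2 VF by (simp_all add: V_def g_def)
qed

section \<open>A one-shot converse\<close>

text \<open>Each \<open>exp (- W m)\<close> is the likelihood ratio \<open>dQ/dP\<close> given the message \<open>m\<close>, where under \<open>Q\<close> the
  decoding event has probability at most \<open>1 / card X\<close>.  Fano's inequality in the variational form
  of Donsker and Varadhan.\<close>

lemma fano_converse:
  fixes W :: "'m \<Rightarrow> 'a \<Rightarrow> real"
  assumes N: "prob_space N" and X: "finite X" "X \<noteq> {}"
    and A [measurable]: "\<And>m. m \<in> X \<Longrightarrow> A m \<in> sets N"
    and W: "\<And>m. m \<in> X \<Longrightarrow> integrable N (W m)"
    and Q: "\<And>m. m \<in> X \<Longrightarrow> (\<integral>\<^sup>+\<omega>. ennreal (exp (- W m \<omega>)) \<partial>N) \<le> 1"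
    and QA: "(\<Sum>m\<in>X. \<integral>\<^sup>+\<omega>. ennreal (exp (- W m \<omega>)) * indicator (A m) \<omega> \<partial>N) \<le> 1"
  shows "(\<Sum>m\<in>X. measure N (A m)) / card X * ln (card X) \<le> (\<Sum>m\<in>X. \<integral>\<omega>. W m \<omega> \<partial>N) / card X + ln 2"
proof -
  interpret N: prob_space N by fact
  define M where "M = real (card X)"
  have M: "1 \<le> M" using X by (simp add: M_def Suc_le_eq card_gt_0_iff)
  define e where "e m \<omega> = exp (- W m \<omega>)" for m \<omega>
  define q where "q m = (\<integral>\<omega>. e m \<omega> * indicator (A m) \<omega> \<partial>N)" for m
  have Wm [measurable]: "W m \<in> borel_measurable N" if "m \<in> X" for m
    using W [OF that] by simp
  have em [measurable]: "e m \<in> borel_measurable N" if "m \<in> X" for m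
    using that by (simp add: e_def [abs_def])
  have ei: "integrable N (e m)" if "m \<in> X" for m
    using Q [OF that] that em
    by (intro integrableI_nonneg) (auto simp: e_def less_top [symmetric] top_unique)
  have eA: "integrable N (\<lambda>\<omega>. e m \<omega> * indicator (A m) \<omega>)" if "m \<in> X" for m
    using ei A that integrable_real_mult_indicator [of "A m" N "e m"] by (simp add: mult.commute)
  have e1: "(\<integral>\<omega>. e m \<omega> \<partial>N) \<le> 1" if "m \<in> X" for m
  proof -
    have "ennreal (\<integral>\<omega>. e m \<omega> \<partial>N) = (\<integral>\<^sup>+\<omega>. ennreal (e m \<omega>) \<partial>N)"
      by (rule nn_integral_eq_integral [symmetric, OF ei [OF that]]) (simp add: e_def)
    also have "\<dots> \<le> ennreal 1" using Q [OF that] by (simp add: e_def)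
    finally show ?thesis by (subst (asm) ennreal_le_iff) simp_all
  qed
  have qnn: "(\<integral>\<^sup>+\<omega>. ennreal (exp (- W m \<omega>)) * indicator (A m) \<omega> \<partial>N) = ennreal (q m)" if "m \<in> X" for m
  proof -
    have "ennreal (exp (- W m \<omega>)) * indicator (A m) \<omega> = ennreal (e m \<omega> * indicator (A m) \<omega>)" for \<omega>
      by (simp add: e_def indicator_def)
    then show ?thesis unfolding q_def
      by (simp only:) (rule nn_integral_eq_integral [OF eA [OF that]], simp add: e_def)
  qed
  have q0: "0 \<le> q m" for m unfolding q_def by (intro integral_nonneg_AE) (simp add: e_def)
  have "ennreal (\<Sum>m\<in>X. q m) \<le> ennreal 1"
    using QA by (simp add: qnn sum_ennreal q0)
  then have qsum: "(\<Sum>m\<in>X. q m) \<le> 1" by (subst (asm) ennreal_le_iff) simp_all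
  have step: "ln M * measure N (A m) - (\<integral>\<omega>. W m \<omega> \<partial>N) \<le> (1 + M * q m) / 2 - 1 + ln 2" if m: "m \<in> X" for m
  proof -
    let ?g = "\<lambda>\<omega>. ln M * indicator (A m) \<omega> - W m \<omega>"
    let ?u = "\<lambda>\<omega>. (e m \<omega> + M * (e m \<omega> * indicator (A m) \<omega>)) / 2 - 1 + ln 2"
    have iA: "integrable N (indicator (A m) :: 'a \<Rightarrow> real)"
      using A [OF m] by (simp add: less_top [symmetric])
    have "(\<integral>\<omega>. ?g \<omega> \<partial>N) \<le> (\<integral>\<omega>. ?u \<omega> \<partial>N)"
    proof (rule integral_mono)
      show "integrable N ?g" using iA W [OF m] by simp
      show "integrable N ?u" using ei [OF m] eA [OF m] by simp
      fix \<omega>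
      \<comment> \<open>The exponential is bounded below by its tangent at \<open>ln 2\<close>.
        Averaged over the messages, the expectation of \<open>exp (?g \<omega>)\<close> is at most
        2, one unit coming from \<open>Q\<close> and one from \<open>QA\<close>; this is the origin
        of the constant \<open>ln 2\<close> in the conclusion.\<close>
      have "?g \<omega> - ln 2 \<le> exp (?g \<omega> - ln 2) - 1"
        using exp_ge_add_one_self [of "?g \<omega> - ln 2"] by linarith
      also have "exp (?g \<omega> - ln 2) = exp (?g \<omega>) / 2" by (simp add: exp_diff)
      also have "exp (?g \<omega>) \<le> e m \<omega> + M * (e m \<omega> * indicator (A m) \<omega>)"
        using M by (cases "\<omega> \<in> A m") (simp_all add: e_def exp_diff exp_minus field_simps)
      finally show "?g \<omega> \<le> ?u \<omega>" by simp
    qed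
    also have "(\<integral>\<omega>. ?g \<omega> \<partial>N) = ln M * measure N (A m) - (\<integral>\<omega>. W m \<omega> \<partial>N)"
      using iA W [OF m] A [OF m] by (simp add: sets.Int_space_eq2)
    also have "(\<integral>\<omega>. ?u \<omega> \<partial>N) = ((\<integral>\<omega>. e m \<omega> \<partial>N) + M * q m) / 2 - 1 + ln 2"
      using ei [OF m] eA [OF m] by (simp add: q_def N.prob_space)
    also have "\<dots> \<le> (1 + M * q m) / 2 - 1 + ln 2" using e1 [OF m] by simp
    finally show ?thesis .
  qed
  have "(\<Sum>m\<in>X. ln M * measure N (A m) - (\<integral>\<omega>. W m \<omega> \<partial>N)) \<le> (\<Sum>m\<in>X. (1 + M * q m) / 2 - 1 + ln 2)"
    by (intro sum_mono step)
  also have "\<dots> = (\<Sum>m\<in>X. (ln 2 - 1 / 2) + M / 2 * q m)"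
    by (intro sum.cong refl) (simp add: field_simps)
  also have "\<dots> = M * (ln 2 - 1 / 2) + M / 2 * (\<Sum>m\<in>X. q m)"
    by (simp add: sum.distrib sum_distrib_left M_def)
  also have "\<dots> \<le> M * ln 2"
    using mult_left_mono [OF qsum, of M] M by (simp add: algebra_simps)
  finally have "ln M * (\<Sum>m\<in>X. measure N (A m)) \<le> (\<Sum>m\<in>X. \<integral>\<omega>. W m \<omega> \<partial>N) + M * ln 2"
    by (simp add: sum_subtractf sum_distrib_left)
  then show ?thesis
    using M unfolding M_def [symmetric] by (simp add: field_simps)
qed

section \<open>Blocks of Gaussian noise\<close>

lemma sets_noise [measurable_cong]: "sets (noise n) = sets (PiM {..<n} (\<lambda>_. borel))"
  unfolding noise_def by (rule sets_PiM_cong) simp_all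

lemma prob_space_noise: "prob_space (noise n)"
  unfolding noise_def by (rule prob_space_PiM) (rule prob_space_std_gaussian)

lemma noise_mixture:
  fixes B L :: "real^'n^'n"
  assumes "invertible B" "B ** transpose B + L ** transpose L = mat 1"
  shows "distr (noise n \<Otimes>\<^sub>M noise n) (noise n) (\<lambda>(z, w). \<lambda>j\<in>{..<n}. B *v z j + L *v w j) = noise n"
  using distr_PiM_pair [of "{..<n}" "\<lambda>_. std_gaussian" "\<lambda>_. std_gaussian" "\<lambda>_. std_gaussian"
      "\<lambda>_ (u, w). B *v u + L *v w"] std_gaussian_orthogonal_sum [OF assms]
  by (simp add: noise_def prob_space_std_gaussian)

text \<open>Logarithm of the reweighting density in \<open>std_gaussian_change_of_variables\<close>,
  with the normalizing constants cancelled. It is quadratic in \<open>z\<close>, so second moments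
  give its mean.\<close>

definition log_ratio :: "real^'n^'n \<Rightarrow> real^'n \<Rightarrow> real^'n \<Rightarrow> real" where
  "log_ratio T b z = ln \<bar>det T\<bar> - (norm (T *v z + b))\<^sup>2 / 2 + (norm z)\<^sup>2 / 2"

lemma borel_measurable_log_ratio [measurable]: "log_ratio T b \<in> borel_measurable borel"
  unfolding log_ratio_def [abs_def] by measurable

lemma exp_log_ratio:
  assumes "invertible T"
  shows "exp (log_ratio T b z) = \<bar>det T\<bar> * (gauss_density (T *v z + b) / gauss_density z)"
proof -
  have "0 < \<bar>det T\<bar>" using assms by (simp add: invertible_det_nz)
  then have "exp (log_ratio T b z) = \<bar>det T\<bar> * (exp (- (norm (T *v z + b))\<^sup>2 / 2) / exp (- (norm z)\<^sup>2 / 2))"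
    unfolding log_ratio_def exp_diff [symmetric]
    by (simp only: diff_conv_add_uminus exp_add exp_ln mult.assoc) simp
  also have "\<dots> = \<bar>det T\<bar> * (gauss_density (T *v z + b) / gauss_density z)"
    by (subst (1 2) gauss_density_exp) (simp add: less_imp_neq [OF gauss_density_pos, symmetric])
  finally show ?thesis .
qed

text \<open>The weight makes \<open>u j = T *v z j + b j\<close> fresh noise, and \<open>z j\<close>
  is recovered as \<open>S *v (u j - b j)\<close>. The shift varies with the channel use, as
  codewords do.\<close>

lemma noise_change_of_variables:
  fixes S T :: "real^'n^'n"
  assumes ST: "S ** T = mat 1" and f [measurable]: "f \<in> borel_measurable (PiM {..<n} (\<lambda>_. borel))"
  shows "(\<integral>\<^sup>+z. ennreal (exp (\<Sum>j<n. log_ratio T (b j) (z j))) * f z \<partial>noise n)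
       = (\<integral>\<^sup>+u. f (\<lambda>j\<in>{..<n}. S *v (u j - b j)) \<partial>noise n)"
proof -
  have T: "invertible T" using ST invertible_left_inverse by blast
  have inv: "matrix_inv T = S"
    by (metis ST T matrix_inv_cancel(2) matrix_mul_assoc matrix_mul_lid matrix_mul_rid)
  let ?\<rho> = "\<lambda>j z. ennreal (exp (log_ratio T (b j) z))"
  have f' [measurable]: "f \<in> borel_measurable (noise n)" by measurable
  have d: "density (noise n) (\<lambda>x. \<Prod>j\<in>{..<n}. ?\<rho> j (x j))
    = distr (noise n) (noise n) (\<lambda>x. \<lambda>j\<in>{..<n}. S *v (x j - b j))"
    unfolding noise_def
  proof (rule density_PiM)
    show "density std_gaussian (?\<rho> i) = distr std_gaussian std_gaussian (\<lambda>v. S *v (v - b i))" for i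
      using std_gaussian_change_of_variables [OF T, of "b i"] by (simp add: exp_log_ratio [OF T] inv)
  qed (simp_all add: prob_space_std_gaussian)
  have "(\<integral>\<^sup>+z. ennreal (exp (\<Sum>j<n. log_ratio T (b j) (z j))) * f z \<partial>noise n)
      = (\<integral>\<^sup>+z. f z \<partial>density (noise n) (\<lambda>x. \<Prod>j\<in>{..<n}. ?\<rho> j (x j)))"
    by (subst nn_integral_density) (simp_all add: exp_sum prod_ennreal)
  also have "\<dots> = (\<integral>\<^sup>+u. f (\<lambda>j\<in>{..<n}. S *v (u j - b j)) \<partial>noise n)"
    unfolding d by (subst nn_integral_distr) simp_all
  finally show ?thesis .
qed

lemma noise_norm_affine:
  fixes T :: "real^'n^'n"
  assumes "j < n"
  shows "integrable (noise n) (\<lambda>z. (norm (x + T *v z j))\<^sup>2)"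
    and "(\<integral>z. (norm (x + T *v z j))\<^sup>2 \<partial>noise n) = (norm x)\<^sup>2 + (norm T)\<^sup>2"
  using integral_PiM_component [of "\<lambda>_. std_gaussian" j "{..<n}" "\<lambda>z. (norm (x + T *v z))\<^sup>2"] assms
  by (simp_all add: noise_def prob_space_std_gaussian gauss_integrable_norm_affine gauss_integral_norm_affine)

lemma norm_mat_1_power2: "(norm (mat 1 :: real^'n^'n))\<^sup>2 = real CARD('n)"
proof -
  have "trace (mat 1 :: real^'n^'n) = real CARD('n)" by (simp add: trace_def mat_def)
  then show ?thesis using trace_gram [of "mat 1 :: real^'n^'n"] by simp
qed

lemma noise_log_ratio:
  fixes T :: "real^'n^'n"
  assumes "j < n"
  shows "integrable (noise n) (\<lambda>z. log_ratio T b (z j))"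
    and "(\<integral>z. log_ratio T b (z j) \<partial>noise n)
       = ln \<bar>det T\<bar> - ((norm b)\<^sup>2 + (norm T)\<^sup>2) / 2 + real CARD('n) / 2"
proof -
  interpret prob_space "noise n" by (rule prob_space_noise)
  note i1 = noise_norm_affine [OF assms, of b T]
  note i2 = noise_norm_affine [OF assms, of 0 "mat 1 :: real^'n^'n", simplified norm_mat_1_power2]
  show "integrable (noise n) (\<lambda>z. log_ratio T b (z j))"
    using i1 i2 by (simp add: log_ratio_def add.commute)
  show "(\<integral>z. log_ratio T b (z j) \<partial>noise n)
       = ln \<bar>det T\<bar> - ((norm b)\<^sup>2 + (norm T)\<^sup>2) / 2 + real CARD('n) / 2"
    using i1 i2 by (simp add: log_ratio_def add.commute prob_space)
qed

section \<open>Empirical covariance of a codebook\<close>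

definition outer :: "real^'n \<Rightarrow> real^'n^'n" where
  "outer v = (\<chi> a b. v $ a * v $ b)"

text \<open>The mean is over messages, separately for each channel use. It carries no message and so
  can be part of the reference law, and deviations from it sum to zero over the messages, which
  removes the cross terms between the two users.\<close>

definition code_mean :: "nat \<Rightarrow> (nat \<Rightarrow> nat \<Rightarrow> real^'n) \<Rightarrow> nat \<Rightarrow> real^'n" where
  "code_mean M x j = (1 / real M) *\<^sub>R (\<Sum>m<M. x m j)"

definition code_dev :: "nat \<Rightarrow> (nat \<Rightarrow> nat \<Rightarrow> real^'n) \<Rightarrow> nat \<Rightarrow> nat \<Rightarrow> real^'n" where
  "code_dev M x m j = x m j - code_mean M x j"

definition code_cov :: "nat \<Rightarrow> nat \<Rightarrow> (nat \<Rightarrow> nat \<Rightarrow> real^'n) \<Rightarrow> real^'n^'n" where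
  "code_cov n M x = (1 / (real n * real M)) *\<^sub>R (\<Sum>j<n. \<Sum>m<M. outer (code_dev M x m j))"

lemma outer_mult_vec: "outer v *v x = (v \<bullet> x) *\<^sub>R v"
  by (simp add: outer_def vec_eq_iff matrix_vector_mult_def inner_vec_def sum_distrib_left mult_ac)

lemma psd_outer: "psd (outer v)"
  by (simp add: psd_def outer_mult_vec inner_commute) (simp add: outer_def transpose_def vec_eq_iff mult.commute)

lemma psd_sum: "(\<And>i. i \<in> I \<Longrightarrow> psd (A i)) \<Longrightarrow> psd (\<Sum>i\<in>I. A i)"
  by (induction I rule: infinite_finite_induct) (auto intro: psd_add)

lemma psd_code_cov: "psd (code_cov n M x)"
  unfolding code_cov_def by (intro psd_scaleR psd_sum psd_outer) simp

lemma trace_scaleR: "trace (c *\<^sub>R A) = c * trace (A :: real^'n^'n)"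
  by (simp add: trace_def sum_distrib_left)

lemma trace_sum: "trace (\<Sum>i\<in>I. A i) = (\<Sum>i\<in>I. trace (A i :: real^'n^'n))"
  unfolding trace_def sum_component by (rule sum.swap)

lemma trace_congruence_outer:
  fixes A :: "real^'n^'n"
  shows "trace (A ** outer v ** transpose A) = (norm (A *v v))\<^sup>2"
proof -
  have "A ** outer v ** transpose A = outer (A *v v)"
    by (simp add: outer_def vec_eq_iff matrix_matrix_mult_def matrix_vector_mult_def transpose_def
        sum_distrib_left sum_distrib_right mult_ac)
  then show ?thesis
    unfolding power2_norm_eq_inner by (simp add: outer_def trace_def inner_vec_def)
qed

lemma matrix_add_rdistrib:
  fixes A B :: "real^'n^'m" and C :: "real^'k^'n"
  shows "(A + B) ** C = A ** C + B ** C"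
  by (simp add: matrix_matrix_mult_def vec_eq_iff sum.distrib distrib_right)

lemma matrix_mult_sum:
  fixes A :: "real^'n^'n"
  shows "A ** (\<Sum>i\<in>I. B i) ** transpose A = (\<Sum>i\<in>I. A ** B i ** transpose A)"
  by (induction I rule: infinite_finite_induct) (simp_all add: matrix_add_ldistrib matrix_add_rdistrib)

lemma matrix_congruence_scaleR:
  fixes A :: "real^'n^'n"
  shows "A ** (c *\<^sub>R B) ** transpose A = c *\<^sub>R (A ** B ** transpose A)"
  by (simp add: matrix_matrix_mult_def transpose_def vec_eq_iff sum_distrib_left mult_ac)

lemma trace_congruence_code_cov:
  fixes A :: "real^'n^'n"
  shows "trace (A ** code_cov n M x ** transpose A)
       = (\<Sum>j<n. \<Sum>m<M. (norm (A *v code_dev M x m j))\<^sup>2) / (real n * real M)"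
  by (simp add: code_cov_def matrix_congruence_scaleR matrix_mult_sum trace_scaleR trace_sum trace_congruence_outer)

lemma sum_code_dev: "0 < M \<Longrightarrow> (\<Sum>m<M. code_dev M x m j) = 0"
  unfolding code_dev_def code_mean_def sum_subtractf sum_constant_scaleR by simp

text \<open>Centring subtracts the power of the mean. Hence the covariances of a code satisfying the
  power constraints are feasible.\<close>

lemma trace_code_cov_le:
  assumes "0 < M"
  shows "trace (code_cov n M x) \<le> avg_power n M x"
proof -
  have le: "(\<Sum>m<M. (norm (code_dev M x m j))\<^sup>2) \<le> (\<Sum>m<M. (norm (x m j))\<^sup>2)" for j
  proof -
    have "(\<Sum>m<M. (norm (x m j))\<^sup>2) = (\<Sum>m<M. (norm (code_dev M x m j + code_mean M x j))\<^sup>2)"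
      by (simp add: code_dev_def)
    also have "\<dots> = (\<Sum>m<M. (norm (code_dev M x m j))\<^sup>2 + 2 * (code_dev M x m j \<bullet> code_mean M x j)
        + (norm (code_mean M x j))\<^sup>2)"
      by (simp add: power2_norm_eq_inner inner_add_left inner_add_right inner_commute algebra_simps)
    also have "\<dots> = (\<Sum>m<M. (norm (code_dev M x m j))\<^sup>2) + real M * (norm (code_mean M x j))\<^sup>2"
      by (simp add: sum.distrib sum_distrib_left [symmetric] inner_sum_left [symmetric] sum_code_dev [OF assms])
    finally show ?thesis by simp
  qed
  have "trace (code_cov n M x) = (\<Sum>j<n. \<Sum>m<M. (norm (code_dev M x m j))\<^sup>2) / (real n * real M)"
    using trace_congruence_code_cov [of "mat 1" n M x] by simp
  also have "\<dots> \<le> (\<Sum>j<n. \<Sum>m<M. (norm (x m j))\<^sup>2) / (real n * real M)"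
    by (intro divide_right_mono sum_mono le) simp
  also have "\<dots> = avg_power n M x"
    using assms by (simp add: avg_power_def integral_pmf_of_set lessThan_empty_iff sum_divide_distrib mult_ac)
  finally show ?thesis .
qed

text \<open>The sum is \<open>M1 * M2 * n\<close> times the trace of
  \<open>T ** (E ** transpose E) ** transpose T = mat 1\<close>. As \<open>E\<close> is a square
  root of the output covariance of the code, whitening by \<open>T\<close> reduces the average
  quadratic cost to that of pure noise, and only determinants survive in the mean of
  \<open>W\<close>.\<close>

lemma average_norm_affine:
  fixes T E A1 A2 :: "real^'n^'n"
  assumes M: "0 < M1" "0 < M2" and n: "0 < n"
    and T: "T ** E = mat 1"
    and E: "E ** transpose E = mat 1 + A1 ** code_cov n M1 x1 ** transpose A1 + A2 ** code_cov n M2 x2 ** transpose A2"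
  shows "(\<Sum>(m1, m2)\<in>{..<M1} \<times> {..<M2}. \<Sum>j<n.
            (norm (T *v (A1 *v code_dev M1 x1 m1 j + A2 *v code_dev M2 x2 m2 j)))\<^sup>2 + (norm T)\<^sup>2)
         = real M1 * real M2 * (real n * real CARD('n))"
proof -
  define u where "u m j = (T ** A1) *v code_dev M1 x1 m j" for m j
  define v where "v m j = (T ** A2) *v code_dev M2 x2 m j" for m j
  have u0: "(\<Sum>m<M1. u m j) = 0" for j
    using linear_sum [OF matrix_vector_mul_linear, of "T ** A1" "\<lambda>m. code_dev M1 x1 m j" "{..<M1}"]
    by (simp add: u_def sum_code_dev [OF M(1)])
  have cross: "(\<Sum>m1<M1. \<Sum>m2<M2. (norm (u m1 j + v m2 j))\<^sup>2)
     = real M2 * (\<Sum>m1<M1. (norm (u m1 j))\<^sup>2) + real M1 * (\<Sum>m2<M2. (norm (v m2 j))\<^sup>2)" for j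
  proof -
    have "(\<Sum>m1<M1. \<Sum>m2<M2. (norm (u m1 j + v m2 j))\<^sup>2)
      = (\<Sum>m1<M1. \<Sum>m2<M2. (norm (u m1 j))\<^sup>2 + (norm (v m2 j))\<^sup>2 + 2 * (u m1 j \<bullet> v m2 j))"
      by (simp add: power2_norm_eq_inner inner_add_left inner_add_right inner_commute algebra_simps)
    also have "\<dots> = real M2 * (\<Sum>m1<M1. (norm (u m1 j))\<^sup>2) + real M1 * (\<Sum>m2<M2. (norm (v m2 j))\<^sup>2)
      + 2 * ((\<Sum>m1<M1. u m1 j) \<bullet> (\<Sum>m2<M2. v m2 j))"
      by (simp add: sum.distrib sum_distrib_left [symmetric] inner_sum_left inner_sum_right) (rule sum.swap)
    finally show ?thesis by (simp add: u0)
  qed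
  have "T ** (A1 ** code_cov n M1 x1 ** transpose A1 + A2 ** code_cov n M2 x2 ** transpose A2 + mat 1) ** transpose T
    = (T ** E) ** (transpose E ** transpose T)"
    by (simp only: add.assoc [symmetric] add.commute [of _ "mat 1"]) (simp add: add.assoc [symmetric] E [symmetric] matrix_mul_assoc)
  also have "\<dots> = mat 1" by (simp add: T matrix_transpose_mul [symmetric])
  finally have "trace ((T ** A1) ** code_cov n M1 x1 ** transpose (T ** A1))
      + trace ((T ** A2) ** code_cov n M2 x2 ** transpose (T ** A2)) + trace (T ** transpose T) = trace (mat 1 :: real^'n^'n)"
    by (simp add: trace_add [symmetric] matrix_add_ldistrib matrix_add_rdistrib matrix_mul_assoc matrix_transpose_mul)
  then have tr: "(\<Sum>j<n. \<Sum>m<M1. (norm (u m j))\<^sup>2) / (real n * real M1)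
      + (\<Sum>j<n. \<Sum>m<M2. (norm (v m j))\<^sup>2) / (real n * real M2) + (norm T)\<^sup>2 = real CARD('n)"
    by (simp add: trace_congruence_code_cov trace_gram u_def v_def trace_I)
  have "(\<Sum>(m1, m2)\<in>{..<M1} \<times> {..<M2}. \<Sum>j<n.
            (norm (T *v (A1 *v code_dev M1 x1 m1 j + A2 *v code_dev M2 x2 m2 j)))\<^sup>2 + (norm T)\<^sup>2)
      = (\<Sum>m1<M1. \<Sum>m2<M2. \<Sum>j<n. (norm (u m1 j + v m2 j))\<^sup>2 + (norm T)\<^sup>2)"
    by (simp add: sum.cartesian_product [symmetric] u_def v_def matrix_vector_right_distrib matrix_vector_mul_assoc)
  also have "\<dots> = (\<Sum>j<n. \<Sum>m1<M1. \<Sum>m2<M2. (norm (u m1 j + v m2 j))\<^sup>2 + (norm T)\<^sup>2)"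
  proof -
    have "(\<Sum>m1<M1. \<Sum>m2<M2. \<Sum>j<n. (norm (u m1 j + v m2 j))\<^sup>2 + (norm T)\<^sup>2)
      = (\<Sum>m1<M1. \<Sum>j<n. \<Sum>m2<M2. (norm (u m1 j + v m2 j))\<^sup>2 + (norm T)\<^sup>2)"
      by (intro sum.cong refl sum.swap)
    also have "\<dots> = (\<Sum>j<n. \<Sum>m1<M1. \<Sum>m2<M2. (norm (u m1 j + v m2 j))\<^sup>2 + (norm T)\<^sup>2)"
      by (rule sum.swap)
    finally show ?thesis .
  qed
  also have "\<dots> = real M2 * (\<Sum>j<n. \<Sum>m1<M1. (norm (u m1 j))\<^sup>2) + real M1 * (\<Sum>j<n. \<Sum>m2<M2. (norm (v m2 j))\<^sup>2)
      + real n * real M1 * real M2 * (norm T)\<^sup>2"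
    by (simp add: sum.distrib cross sum_distrib_left [symmetric])
  also have "\<dots> = real M1 * real M2 * real n * ((\<Sum>j<n. \<Sum>m<M1. (norm (u m j))\<^sup>2) / (real n * real M1)
      + (\<Sum>j<n. \<Sum>m<M2. (norm (v m j))\<^sup>2) / (real n * real M2) + (norm T)\<^sup>2)"
    using M n by (simp add: field_simps)
  finally show ?thesis by (simp add: tr)
qed

section \<open>The converse\<close>

lemma measurable_received [measurable]:
  "received n A B x1 x2 \<in> PiM {..<n} (\<lambda>_. borel) \<rightarrow>\<^sub>M PiM {..<n} (\<lambda>_. borel)"
  unfolding received_def [abs_def] by measurable

definition mixed_noise :: "nat \<Rightarrow> real^'n^'n \<Rightarrow> real^'n^'n \<Rightarrow> (nat \<Rightarrow> real^'n) \<times> (nat \<Rightarrow> real^'n) \<Rightarrow> nat \<Rightarrow> real^'n" where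
  "mixed_noise n B L p = (\<lambda>j\<in>{..<n}. B *v fst p j + L *v snd p j)"

lemma measurable_mixed_noise [measurable]:
  "mixed_noise n B L \<in> PiM {..<n} (\<lambda>_. borel) \<Otimes>\<^sub>M PiM {..<n} (\<lambda>_. borel) \<rightarrow>\<^sub>M PiM {..<n} (\<lambda>_. borel)"
  unfolding mixed_noise_def [abs_def] by measurable

lemma distr_mixed_noise:
  fixes B L :: "real^'n^'n"
  assumes "invertible B" "B ** transpose B + L ** transpose L = mat 1"
  shows "distr (noise n \<Otimes>\<^sub>M noise n) (noise n) (mixed_noise n B L) = noise n"
  using noise_mixture [OF assms] by (simp add: mixed_noise_def [abs_def] case_prod_beta')

lemma prob_Int_ge:
  assumes "prob_space P" and A: "A \<in> sets P" "B \<in> sets P"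
  shows "1 - measure P (space P - A) - measure P (space P - B) \<le> measure P (A \<inter> B)"
proof -
  interpret prob_space P by fact
  have "space P - A \<inter> B = (space P - A) \<union> (space P - B)" by blast
  then have "1 - prob (A \<inter> B) \<le> prob (space P - A) + prob (space P - B)"
    using measure_Un_le [of "space P - A" P "space P - B"] prob_compl [of "A \<inter> B"] A by simp
  then show ?thesis by simp
qed

lemma distr_noise_prob:
  assumes d: "distr P (noise n) f = noise n" and f [measurable]: "f \<in> P \<rightarrow>\<^sub>M noise n"
    and Q [measurable]: "Measurable.pred (PiM {..<n} (\<lambda>_. borel)) Q"
  shows "measure P {p \<in> space P. Q (f p)} = measure (noise n) {z \<in> space (noise n). Q z}"
proof -
  have "measure (noise n) {z \<in> space (noise n). Q z} = measure (distr P (noise n) f) {z \<in> space (noise n). Q z}"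
    by (simp add: d)
  also have "\<dots> = measure P (f -` {z \<in> space (noise n). Q z} \<inter> space P)"
    by (rule measure_distr) measurable
  also have "f -` {z \<in> space (noise n). Q z} \<inter> space P = {p \<in> space P. Q (f p)}"
    using measurable_space [OF f] by auto
  finally show ?thesis ..
qed

lemma distr_noise_integral:
  fixes g :: "(nat \<Rightarrow> real^'n) \<Rightarrow> real"
  assumes d: "distr P (noise n) f = noise n" and f [measurable]: "f \<in> P \<rightarrow>\<^sub>M noise n"
    and g [measurable]: "g \<in> borel_measurable (PiM {..<n} (\<lambda>_. borel))"
  shows "(\<integral>p. g (f p) \<partial>P) = (\<integral>z. g z \<partial>noise n)"
    and "integrable P (\<lambda>p. g (f p)) \<longleftrightarrow> integrable (noise n) g"
proof -
  have [measurable]: "g \<in> borel_measurable (noise n)" by measurable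
  show "(\<integral>p. g (f p) \<partial>P) = (\<integral>z. g z \<partial>noise n)"
    using integral_distr [of f P "noise n" g] by (simp add: d)
  show "integrable P (\<lambda>p. g (f p)) \<longleftrightarrow> integrable (noise n) g"
    using integrable_distr_eq [of f P "noise n" g] by (simp add: d)
qed

text \<open>Dividing by \<open>M1 * M2\<close> gives the error probability of the receiver that
  wants \<open>pick m\<close>. Encoders and decoders are separate arguments, so that both halves of
  the proof can work without the code record.\<close>

definition error_sum :: "(real^'n^'n) \<Rightarrow> (real^'n^'n) \<Rightarrow> nat \<Rightarrow> nat \<Rightarrow> nat \<Rightarrow> (nat \<Rightarrow> nat \<Rightarrow> real^'n) \<Rightarrow> (nat \<Rightarrow> nat \<Rightarrow> real^'n)
    \<Rightarrow> ((nat \<Rightarrow> real^'n) \<Rightarrow> nat) \<Rightarrow> (nat \<times> nat \<Rightarrow> nat) \<Rightarrow> real" where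
  "error_sum A B n M1 M2 x1 x2 d pick = (\<Sum>m\<in>{..<M1} \<times> {..<M2}.
     measure (noise n) {z \<in> space (noise n). d (received n A B (x1 (fst m)) (x2 (snd m)) z) \<noteq> pick m})"

text \<open>Both receivers decode correctly when receiver 2 sees the noise \<open>z = fst p\<close> and receiver 1 the
  noise \<open>B z + L w\<close>; the error probabilities depend on the marginals only.\<close>

definition decoded :: "real^'n^'n \<Rightarrow> real^'n^'n \<Rightarrow> real^'n^'n \<Rightarrow> real^'n^'n \<Rightarrow> real^'n^'n \<Rightarrow> real^'n^'n \<Rightarrow> nat
    \<Rightarrow> (nat \<Rightarrow> nat \<Rightarrow> real^'n) \<Rightarrow> (nat \<Rightarrow> nat \<Rightarrow> real^'n) \<Rightarrow> ((nat \<Rightarrow> real^'n) \<Rightarrow> nat) \<Rightarrow> ((nat \<Rightarrow> real^'n) \<Rightarrow> nat)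
    \<Rightarrow> nat \<times> nat \<Rightarrow> (nat \<Rightarrow> real^'n) \<times> (nat \<Rightarrow> real^'n) \<Rightarrow> bool" where
  "decoded H1 H2 H3 H4 B L n x1 x2 d1 d2 m p \<longleftrightarrow>
     d1 (received n H1 H2 (x1 (fst m)) (x2 (snd m)) (mixed_noise n B L p)) = fst m \<and>
     d2 (received n H3 H4 (x1 (fst m)) (x2 (snd m)) (fst p)) = snd m"

text \<open>A union bound for each message pair: under the coupling both
  \<open>mixed_noise n B L p\<close> and \<open>fst p\<close> have the law \<open>noise n\<close>,
  so each error event keeps its probability.\<close>

lemma sum_prob_decoded:
  fixes B L :: "real^'n^'n"
  assumes B: "invertible B" "B ** transpose B + L ** transpose L = mat 1"
    and d1 [measurable]: "d1 \<in> PiM {..<n} (\<lambda>_. borel) \<rightarrow>\<^sub>M count_space UNIV"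
    and d2 [measurable]: "d2 \<in> PiM {..<n} (\<lambda>_. borel) \<rightarrow>\<^sub>M count_space UNIV"
  shows "real M1 * real M2 - error_sum H1 H2 n M1 M2 x1 x2 d1 fst - error_sum H3 H4 n M1 M2 x1 x2 d2 snd
    \<le> (\<Sum>m\<in>{..<M1} \<times> {..<M2}. measure (noise n \<Otimes>\<^sub>M noise n)
        {p \<in> space (noise n \<Otimes>\<^sub>M noise n). decoded H1 H2 H3 H4 B L n x1 x2 d1 d2 m p})"
proof -
  let ?P = "noise n \<Otimes>\<^sub>M noise n :: ((nat \<Rightarrow> real^'n) \<times> (nat \<Rightarrow> real^'n)) measure"
  interpret N: prob_space "noise n :: (nat \<Rightarrow> real^'n) measure" by (rule prob_space_noise)
  interpret P: prob_space ?P by (intro prob_space_pair prob_space_noise)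
  have "(\<Sum>m\<in>{..<M1} \<times> {..<M2}.
      1 - measure (noise n) {z \<in> space (noise n). d1 (received n H1 H2 (x1 (fst m)) (x2 (snd m)) z) \<noteq> fst m}
        - measure (noise n) {z \<in> space (noise n). d2 (received n H3 H4 (x1 (fst m)) (x2 (snd m)) z) \<noteq> snd m})
    \<le> (\<Sum>m\<in>{..<M1} \<times> {..<M2}. measure ?P {p \<in> space ?P. decoded H1 H2 H3 H4 B L n x1 x2 d1 d2 m p})"
  proof (rule sum_mono)
    fix m :: "nat \<times> nat"
    let ?Q1 = "\<lambda>z. d1 (received n H1 H2 (x1 (fst m)) (x2 (snd m)) z) \<noteq> fst m"
    let ?Q2 = "\<lambda>z. d2 (received n H3 H4 (x1 (fst m)) (x2 (snd m)) z) \<noteq> snd m"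
    have 1: "P.prob {p \<in> space ?P. ?Q1 (mixed_noise n B L p)} = measure (noise n) {z \<in> space (noise n). ?Q1 z}"
      by (rule distr_noise_prob [OF distr_mixed_noise [OF B]]) measurable
    have 2: "P.prob {p \<in> space ?P. ?Q2 (fst p)} = measure (noise n) {z \<in> space (noise n). ?Q2 z}"
      by (rule distr_noise_prob [OF N.distr_pair_fst]) measurable
    let ?A = "{p \<in> space ?P. \<not> ?Q1 (mixed_noise n B L p)}"
    let ?B = "{p \<in> space ?P. \<not> ?Q2 (fst p)}"
    have "1 - P.prob (space ?P - ?A) - P.prob (space ?P - ?B) \<le> P.prob (?A \<inter> ?B)"
      by (rule prob_Int_ge [OF P.prob_space_axioms]) measurable
    also have "space ?P - ?A = {p \<in> space ?P. ?Q1 (mixed_noise n B L p)}" by blast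
    also have "space ?P - ?B = {p \<in> space ?P. ?Q2 (fst p)}" by blast
    also have "?A \<inter> ?B = {p \<in> space ?P. decoded H1 H2 H3 H4 B L n x1 x2 d1 d2 m p}"
      by (auto simp: decoded_def)
    finally show "1 - measure (noise n) {z \<in> space (noise n). ?Q1 z} - measure (noise n) {z \<in> space (noise n). ?Q2 z}
      \<le> P.prob {p \<in> space ?P. decoded H1 H2 H3 H4 B L n x1 x2 d1 d2 m p}"
      by (simp only: 1 2)
  qed
  then show ?thesis by (simp add: error_sum_def sum_subtractf)
qed

lemma measurable_decoded [measurable]:
  assumes [measurable]: "d1 \<in> PiM {..<n} (\<lambda>_. borel) \<rightarrow>\<^sub>M count_space UNIV"
    "d2 \<in> PiM {..<n} (\<lambda>_. borel) \<rightarrow>\<^sub>M count_space UNIV"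
  shows "Measurable.pred (PiM {..<n} (\<lambda>_. borel) \<Otimes>\<^sub>M PiM {..<n} (\<lambda>_. borel)) (decoded H1 H2 H3 H4 B L n x1 x2 d1 d2 m)"
  unfolding decoded_def [abs_def] by measurable

text \<open>Fano's inequality for the event that both receivers are right. \<open>QA\<close> says
  that under the reference laws the decoders do no better than a blind guess of the pair, and
  \<open>D\<close> is the average divergence of the true law from the reference law.\<close>

lemma converse_from_likelihood:
  fixes B L :: "real^'n^'n" and W :: "nat \<times> nat \<Rightarrow> (nat \<Rightarrow> real^'n) \<times> (nat \<Rightarrow> real^'n) \<Rightarrow> real"
  assumes M: "0 < M1" "0 < M2"
    and B: "invertible B" "B ** transpose B + L ** transpose L = mat 1"
    and d1 [measurable]: "d1 \<in> PiM {..<n} (\<lambda>_. borel) \<rightarrow>\<^sub>M count_space UNIV"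
    and d2 [measurable]: "d2 \<in> PiM {..<n} (\<lambda>_. borel) \<rightarrow>\<^sub>M count_space UNIV"
    and W: "\<And>m. integrable (noise n \<Otimes>\<^sub>M noise n) (W m)"
    and Q: "\<And>m. (\<integral>\<^sup>+p. ennreal (exp (- W m p)) \<partial>(noise n \<Otimes>\<^sub>M noise n)) \<le> 1"
    and QA: "(\<Sum>m\<in>{..<M1} \<times> {..<M2}. \<integral>\<^sup>+p. ennreal (exp (- W m p)) *
        of_bool (decoded H1 H2 H3 H4 B L n x1 x2 d1 d2 m p) \<partial>(noise n \<Otimes>\<^sub>M noise n)) \<le> 1"
    and EW: "(\<Sum>m\<in>{..<M1} \<times> {..<M2}. \<integral>p. W m p \<partial>(noise n \<Otimes>\<^sub>M noise n)) = real M1 * real M2 * D"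
  shows "(1 - (error_sum H1 H2 n M1 M2 x1 x2 d1 fst + error_sum H3 H4 n M1 M2 x1 x2 d2 snd) / (real M1 * real M2))
      * ln (real M1 * real M2) \<le> D + ln 2"
proof -
  let ?P = "noise n \<Otimes>\<^sub>M noise n :: ((nat \<Rightarrow> real^'n) \<times> (nat \<Rightarrow> real^'n)) measure"
  let ?X = "{..<M1} \<times> {..<M2}"
  let ?A = "\<lambda>m. {p \<in> space ?P. decoded H1 H2 H3 H4 B L n x1 x2 d1 d2 m p}"
  interpret P: prob_space ?P by (intro prob_space_pair prob_space_noise)
  have X: "finite ?X" "?X \<noteq> {}" "real (card ?X) = real M1 * real M2"
    using M by (auto simp: lessThan_empty_iff)
  have "(\<Sum>m\<in>?X. \<integral>\<^sup>+p. ennreal (exp (- W m p)) * indicator (?A m) p \<partial>?P) \<le> 1"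
  proof -
    have "(\<integral>\<^sup>+p. ennreal (exp (- W m p)) * indicator (?A m) p \<partial>?P)
      = (\<integral>\<^sup>+p. ennreal (exp (- W m p)) * of_bool (decoded H1 H2 H3 H4 B L n x1 x2 d1 d2 m p) \<partial>?P)" for m
      by (intro nn_integral_cong) (simp add: indicator_def)
    then show ?thesis using QA by simp
  qed
  moreover have "?A m \<in> sets ?P" for m by measurable
  ultimately have "(\<Sum>m\<in>?X. P.prob (?A m)) / (real M1 * real M2) * ln (real M1 * real M2)
      \<le> (\<Sum>m\<in>?X. \<integral>p. W m p \<partial>?P) / (real M1 * real M2) + ln 2"
    using fano_converse [OF P.prob_space_axioms X(1,2), of ?A W] W Q unfolding X(3) by blast
  also have "\<dots> = D + ln 2" using M by (simp add: EW)
  finally have *: "(\<Sum>m\<in>?X. P.prob (?A m)) / (real M1 * real M2) * ln (real M1 * real M2) \<le> D + ln 2" .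
  have "1 - (error_sum H1 H2 n M1 M2 x1 x2 d1 fst + error_sum H3 H4 n M1 M2 x1 x2 d2 snd) / (real M1 * real M2)
     \<le> (\<Sum>m\<in>?X. P.prob (?A m)) / (real M1 * real M2)"
    using divide_right_mono [OF sum_prob_decoded [OF B d1 d2, of M1 M2 H1 H2 x1 x2 H3 H4], of "real M1 * real M2"] M
    by (simp add: diff_divide_distrib add_divide_distrib)
  then have "(1 - (error_sum H1 H2 n M1 M2 x1 x2 d1 fst + error_sum H3 H4 n M1 M2 x1 x2 d2 snd) / (real M1 * real M2))
      * ln (real M1 * real M2) \<le> (\<Sum>m\<in>?X. P.prob (?A m)) / (real M1 * real M2) * ln (real M1 * real M2)"
    using M by (intro mult_right_mono ln_ge_zero) (simp_all add: Suc_le_eq flip: of_nat_mult)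
  with * show ?thesis by linarith
qed

lemma sum_of_bool_eq_le_1: "finite X \<Longrightarrow> (\<Sum>m\<in>X. of_bool (a = m) :: ennreal) \<le> 1"
  by (simp add: of_bool_def sum.delta)

lemma nn_integral_noise_pair:
  fixes f :: "(nat \<Rightarrow> real^'n) \<times> (nat \<Rightarrow> real^'n) \<Rightarrow> ennreal"
  assumes [measurable]: "f \<in> borel_measurable (PiM {..<n} (\<lambda>_. borel) \<Otimes>\<^sub>M PiM {..<n} (\<lambda>_. borel))"
  shows "(\<integral>\<^sup>+p. f p \<partial>(noise n \<Otimes>\<^sub>M noise n)) = (\<integral>\<^sup>+w. \<integral>\<^sup>+z. f (z, w) \<partial>noise n \<partial>noise n)"
proof -
  interpret pair_prob_space "noise n :: (nat \<Rightarrow> real^'n) measure" "noise n :: (nat \<Rightarrow> real^'n) measure"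
    by (intro pair_prob_space.intro pair_sigma_finite.intro prob_space_imp_sigma_finite prob_space_noise)
  show ?thesis by (rule nn_integral_snd [symmetric]) measurable
qed

lemma noise_pair_change_of_variables:
  fixes S T :: "real^'n^'n" and f :: "(nat \<Rightarrow> real^'n) \<times> (nat \<Rightarrow> real^'n) \<Rightarrow> ennreal"
  assumes ST: "S ** T = mat 1"
    and f [measurable]: "f \<in> borel_measurable (PiM {..<n} (\<lambda>_. borel) \<Otimes>\<^sub>M PiM {..<n} (\<lambda>_. borel))"
  shows "(\<integral>\<^sup>+p. ennreal (exp (\<Sum>j<n. log_ratio T (b j) (fst p j))) * f p \<partial>(noise n \<Otimes>\<^sub>M noise n))
       = (\<integral>\<^sup>+p. f (\<lambda>j\<in>{..<n}. S *v (fst p j - b j), snd p) \<partial>(noise n \<Otimes>\<^sub>M noise n))"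
proof -
  have "(\<integral>\<^sup>+p. ennreal (exp (\<Sum>j<n. log_ratio T (b j) (fst p j))) * f p \<partial>(noise n \<Otimes>\<^sub>M noise n))
    = (\<integral>\<^sup>+w. \<integral>\<^sup>+z. ennreal (exp (\<Sum>j<n. log_ratio T (b j) (z j))) * f (z, w) \<partial>noise n \<partial>noise n)"
    by (subst nn_integral_noise_pair) simp_all
  also have "\<dots> = (\<integral>\<^sup>+w. \<integral>\<^sup>+u. f (\<lambda>j\<in>{..<n}. S *v (u j - b j), w) \<partial>noise n \<partial>noise n)"
  proof (rule nn_integral_cong)
    fix w :: "nat \<Rightarrow> real^'n" assume "w \<in> space (noise n)"
    then have [measurable]: "w \<in> space (PiM {..<n} (\<lambda>_. borel))"
      by (simp add: noise_def space_PiM)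
    show "(\<integral>\<^sup>+z. ennreal (exp (\<Sum>j<n. log_ratio T (b j) (z j))) * f (z, w) \<partial>noise n)
      = (\<integral>\<^sup>+u. f (\<lambda>j\<in>{..<n}. S *v (u j - b j), w) \<partial>noise n)"
      by (rule noise_change_of_variables [OF ST, of "\<lambda>z. f (z, w)"]) simp
  qed
  also have "\<dots> = (\<integral>\<^sup>+p. f (\<lambda>j\<in>{..<n}. S *v (fst p j - b j), snd p) \<partial>(noise n \<Otimes>\<^sub>M noise n))"
    by (subst nn_integral_noise_pair) simp_all
  finally show ?thesis .
qed

lemma sum_nn_integral_le_1:
  fixes f :: "'i \<Rightarrow> 'a \<Rightarrow> ennreal"
  assumes "prob_space M" "\<And>i. i \<in> I \<Longrightarrow> f i \<in> borel_measurable M"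
    and "\<And>x. x \<in> space M \<Longrightarrow> (\<Sum>i\<in>I. f i x) \<le> 1"
  shows "(\<Sum>i\<in>I. \<integral>\<^sup>+x. f i x \<partial>M) \<le> 1"
proof -
  interpret prob_space M by fact
  have "(\<Sum>i\<in>I. \<integral>\<^sup>+x. f i x \<partial>M) = (\<integral>\<^sup>+x. (\<Sum>i\<in>I. f i x) \<partial>M)"
    by (rule nn_integral_sum [symmetric]) (rule assms(2))
  also have "\<dots> \<le> (\<integral>\<^sup>+x. 1 \<partial>M)" by (intro nn_integral_mono assms(3))
  also have "\<dots> = 1" by (simp add: emeasure_space_1)
  finally show ?thesis .
qed

lemma received_cong:
  "(\<And>j. j < n \<Longrightarrow> A *v x j + B *v y j + z j = A' *v x' j + B' *v y' j + z' j)
    \<Longrightarrow> received n A B x y z = received n A' B' x' y' z'"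
  by (auto simp: received_def restrict_def)

text \<open>The conjunct \<open>c = snd m\<close> singles out one second message, and for it
  \<open>a\<close> fits one first message. The guess of \<open>m1\<close> may thus depend on the
  true \<open>m2\<close>, as when receiver 2 removes the signal of \<open>m2\<close> before looking
  for \<open>m1\<close>.\<close>

lemma sum_of_bool_pair_le_1:
  "(\<Sum>m\<in>{..<M1} \<times> {..<M2}. of_bool (a (snd m) = fst m \<and> c = snd m) :: ennreal) \<le> 1" for M1 M2 :: nat
proof -
  have "(\<Sum>m\<in>{..<M1} \<times> {..<M2}. of_bool (a (snd m) = fst m \<and> c = snd m) :: ennreal)
    = (\<Sum>m1<M1. \<Sum>m2<M2. of_bool (a m2 = m1) * of_bool (c = m2))"
    unfolding sum.cartesian_product by (intro sum.cong refl) (auto simp: of_bool_def)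
  also have "\<dots> = (\<Sum>m2<M2. \<Sum>m1<M1. of_bool (a m2 = m1) * of_bool (c = m2))"
    by (rule sum.swap)
  also have "\<dots> = (\<Sum>m2<M2. (\<Sum>m1<M1. of_bool (a m2 = m1)) * of_bool (c = m2))"
    by (simp add: sum_distrib_right)
  also have "\<dots> \<le> (\<Sum>m2<M2. 1 * of_bool (c = m2))"
    by (intro sum_mono mult_right_mono sum_of_bool_eq_le_1) simp_all
  also have "\<dots> \<le> 1"
    using sum_of_bool_eq_le_1 [of "{..<M2}" c] by simp
  finally show ?thesis .
qed

lemma ln_det_inverse:
  fixes T E :: "real^'n^'n"
  assumes "T ** E = mat 1"
  shows "ln \<bar>det T\<bar> = - ln \<bar>det E\<bar>"
proof -
  have "\<bar>det T\<bar> * \<bar>det E\<bar> = 1"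
    using arg_cong [OF assms, of det] by (simp add: det_mul flip: abs_mult)
  then have "\<bar>det T\<bar> = inverse \<bar>det E\<bar>" and "\<bar>det E\<bar> \<noteq> 0"
    by (auto simp: mult.commute intro: inverse_unique [symmetric])
  then show ?thesis by (simp add: ln_inverse)
qed

text \<open>Receiver 2 can decode both messages: having found \<open>m\<^sub>2\<close>, it subtracts \<open>H\<^sub>4 x\<^sub>2\<close> and simulates
  receiver 1.\<close>

lemma converse_joint:
  fixes H1 H2 H3 H4 B L E :: "real^'n^'n"
  assumes M: "0 < M1" "0 < M2" and n: "0 < n"
    and B: "invertible B" "B ** transpose B + L ** transpose L = mat 1" "B ** H3 = H1"
    and d1 [measurable]: "d1 \<in> PiM {..<n} (\<lambda>_. borel) \<rightarrow>\<^sub>M count_space UNIV"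
    and d2 [measurable]: "d2 \<in> PiM {..<n} (\<lambda>_. borel) \<rightarrow>\<^sub>M count_space UNIV"
    and E: "invertible E" "E ** transpose E = mat 1 + H3 ** code_cov n M1 x1 ** transpose H3
        + H4 ** code_cov n M2 x2 ** transpose H4"
  shows "(1 - (error_sum H1 H2 n M1 M2 x1 x2 d1 fst + error_sum H3 H4 n M1 M2 x1 x2 d2 snd) / (real M1 * real M2))
      * ln (real M1 * real M2) \<le> real n * ln \<bar>det E\<bar> + ln 2"
proof -
  let ?P = "noise n \<Otimes>\<^sub>M noise n :: ((nat \<Rightarrow> real^'n) \<times> (nat \<Rightarrow> real^'n)) measure"
  interpret N: prob_space "noise n :: (nat \<Rightarrow> real^'n) measure" by (rule prob_space_noise)
  interpret P: prob_space ?P by (intro prob_space_pair prob_space_noise)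
  define T where "T = matrix_inv E"
  have T: "T ** E = mat 1" "E ** T = mat 1" using matrix_inv_cancel [OF E(1)] by (simp_all add: T_def)
  have ET: "E *v (T *v x) = x" for x by (simp add: matrix_vector_mul_assoc T)
  have Bv: "B *v (H3 *v x) = H1 *v x" for x by (simp add: matrix_vector_mul_assoc B)
  define \<xi> where "\<xi> m j = H3 *v code_dev M1 x1 (fst m) j + H4 *v code_dev M2 x2 (snd m) j" for m j
  define b where "b m j = T *v \<xi> m j" for m j
  \<comment> \<open>The weight \<open>exp (- W m p)\<close> turns \<open>\<xi> m j + fst p j\<close>
    into \<open>E *v u j\<close> with fresh noise \<open>u\<close>, a law in which no message
    appears.\<close>
  define W :: "nat \<times> nat \<Rightarrow> (nat \<Rightarrow> real^'n) \<times> (nat \<Rightarrow> real^'n) \<Rightarrow> real"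
    where "W m p = - (\<Sum>j<n. log_ratio T (b m j) (fst p j))" for m p
  define sh where "sh m p = (\<lambda>j\<in>{..<n}. E *v (fst p j - b m j), snd p)"
    for m and p :: "(nat \<Rightarrow> real^'n) \<times> (nat \<Rightarrow> real^'n)"
  have [measurable]: "sh m \<in> PiM {..<n} (\<lambda>_. borel) \<Otimes>\<^sub>M PiM {..<n} (\<lambda>_. borel)
      \<rightarrow>\<^sub>M PiM {..<n} (\<lambda>_. borel) \<Otimes>\<^sub>M PiM {..<n} (\<lambda>_. borel)" for m
    unfolding sh_def [abs_def] by measurable
  have change: "(\<integral>\<^sup>+p. ennreal (exp (- W m p)) * f p \<partial>?P) = (\<integral>\<^sup>+p. f (sh m p) \<partial>?P)"
    if "f \<in> borel_measurable (PiM {..<n} (\<lambda>_. borel) \<Otimes>\<^sub>M PiM {..<n} (\<lambda>_. borel))" for m f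
    using noise_pair_change_of_variables [OF T(2) that, of "b m"] by (simp add: W_def sh_def)
  let ?D = "\<lambda>m p. decoded H1 H2 H3 H4 B L n x1 x2 d1 d2 m p"
  \<comment> \<open>Blocks after the change of measure: \<open>y\<close> at receiver 2 contains no
    message, while \<open>y'\<close>, the simulated block of receiver 1, contains \<open>m2\<close>
    but not \<open>m1\<close>, since \<open>B *v (H3 *v x) = H1 *v x\<close> cancels the deviation
    of the first codeword.\<close>
  define y where "y p = received n H3 H4 (code_mean M1 x1) (code_mean M2 x2) (\<lambda>j. E *v fst p j)"
    for p :: "(nat \<Rightarrow> real^'n) \<times> (nat \<Rightarrow> real^'n)"
  define y' where "y' m2 p = received n H1 H2 (code_mean M1 x1) (x2 m2)
      (\<lambda>j. B *v (E *v fst p j) - B *v (H4 *v code_dev M2 x2 m2 j) + L *v snd p j)"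
    for m2 and p :: "(nat \<Rightarrow> real^'n) \<times> (nat \<Rightarrow> real^'n)"
  have D: "?D m (sh m p) \<longleftrightarrow> d1 (y' (snd m) p) = fst m \<and> d2 (y p) = snd m" for m p
  proof -
    have "received n H3 H4 (x1 (fst m)) (x2 (snd m)) (fst (sh m p)) = y p"
      unfolding y_def
      by (rule received_cong)
         (simp add: sh_def b_def \<xi>_def ET matrix_vector_mult_diff_distrib code_dev_def algebra_simps)
    moreover have "received n H1 H2 (x1 (fst m)) (x2 (snd m)) (mixed_noise n B L (sh m p)) = y' (snd m) p"
      unfolding y'_def
      by (rule received_cong)
         (simp add: sh_def b_def \<xi>_def ET Bv mixed_noise_def matrix_vector_mult_diff_distrib
           matrix_vector_right_distrib code_dev_def algebra_simps)
    ultimately show ?thesis by (simp add: decoded_def)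
  qed
  have "(1 - (error_sum H1 H2 n M1 M2 x1 x2 d1 fst + error_sum H3 H4 n M1 M2 x1 x2 d2 snd) / (real M1 * real M2))
      * ln (real M1 * real M2) \<le> real n * ln \<bar>det E\<bar> + ln 2"
  proof (rule converse_from_likelihood [OF M B(1,2) d1 d2])
    have lr: "integrable ?P (\<lambda>p. log_ratio T (b m j) (fst p j))"
      "(\<integral>p. log_ratio T (b m j) (fst p j) \<partial>?P)
        = ln \<bar>det T\<bar> - ((norm (b m j))\<^sup>2 + (norm T)\<^sup>2) / 2 + real CARD('n) / 2" if "j < n" for m j
      using distr_noise_integral [OF N.distr_pair_fst, where g = "\<lambda>z. log_ratio T (b m j) (z j)"]
        noise_log_ratio [OF that, of T "b m j"] that
      by simp_all
    show "integrable ?P (W m)" for m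
      unfolding W_def by (intro integrable_minus Bochner_Integration.integrable_sum lr) simp
    show "(\<integral>\<^sup>+p. ennreal (exp (- W m p)) \<partial>?P) \<le> 1" for m
      using change [of "\<lambda>_. 1" m] by (simp add: P.emeasure_space_1)
    have "(\<Sum>m\<in>{..<M1} \<times> {..<M2}. \<integral>\<^sup>+p. of_bool (?D m (sh m p)) \<partial>?P) \<le> 1"
    proof (rule sum_nn_integral_le_1 [OF P.prob_space_axioms])
      show "(\<lambda>p. of_bool (?D m (sh m p))) \<in> borel_measurable ?P" for m
        by measurable
      show "(\<Sum>m\<in>{..<M1} \<times> {..<M2}. of_bool (?D m (sh m p)) :: ennreal) \<le> 1" for p
        unfolding D by (rule sum_of_bool_pair_le_1)
    qed
    then show "(\<Sum>m\<in>{..<M1} \<times> {..<M2}. \<integral>\<^sup>+p. ennreal (exp (- W m p)) * of_bool (?D m p) \<partial>?P) \<le> 1"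
      by (subst change) simp_all
    have EWm: "(\<integral>p. W m p \<partial>?P) = (\<Sum>j<n. ((norm (b m j))\<^sup>2 + (norm T)\<^sup>2) / 2 - ln \<bar>det T\<bar> - real CARD('n) / 2)" for m
      unfolding W_def
      by (simp add: lr Bochner_Integration.integral_sum sum_negf [symmetric])
    have "ln \<bar>det T\<bar> = - ln \<bar>det E\<bar>" by (rule ln_det_inverse [OF T(1)])
    have avg: "(\<Sum>m\<in>{..<M1} \<times> {..<M2}. \<Sum>j<n. (norm (b m j))\<^sup>2 + (norm T)\<^sup>2)
         = real M1 * real M2 * (real n * real CARD('n))"
      using average_norm_affine [OF M n T(1) E(2)] by (simp add: b_def \<xi>_def case_prod_beta')
    have "(\<Sum>m\<in>{..<M1} \<times> {..<M2}. \<integral>p. W m p \<partial>?P)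
       = (\<Sum>m\<in>{..<M1} \<times> {..<M2}. \<Sum>j<n. (norm (b m j))\<^sup>2 + (norm T)\<^sup>2) / 2
         + real M1 * real M2 * real n * (ln \<bar>det E\<bar> - real CARD('n) / 2)"
      unfolding EWm \<open>ln \<bar>det T\<bar> = - ln \<bar>det E\<bar>\<close>
      by (simp add: sum.distrib sum_subtractf sum_divide_distrib [symmetric] algebra_simps)
    also have "\<dots> = real M1 * real M2 * (real n * ln \<bar>det E\<bar>)"
      unfolding avg by (simp add: algebra_simps)
    finally show "(\<Sum>m\<in>{..<M1} \<times> {..<M2}. \<integral>p. W m p \<partial>?P) = real M1 * real M2 * (real n * ln \<bar>det E\<bar>)" .
  qed
  then show ?thesis .
qed

text \<open>Receiver 1 treats the interference as noise.  Under \<open>Q\<close> the block \<open>s = H\<^sub>4 x\<^sub>2 + z\<close> is Gaussian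
  and independent of \<open>m\<^sub>2\<close>, and then the law of \<open>t = B s + L w\<close> is replaced by that of a Gaussian
  \<open>y\<^sub>1 = H\<^sub>1 x\<^sub>1 + t\<close> independent of \<open>m\<^sub>1\<close>, keeping the conditional law of \<open>s\<close> given \<open>t\<close>.\<close>

lemma converse_treat_as_noise:
  fixes H1 H2 H3 H4 B L E1 E2 E4 :: "real^'n^'n"
  assumes M: "0 < M1" "0 < M2" and n: "0 < n"
    and B: "invertible B" "B ** transpose B + L ** transpose L = mat 1" "B ** H4 = H2"
    and d1 [measurable]: "d1 \<in> PiM {..<n} (\<lambda>_. borel) \<rightarrow>\<^sub>M count_space UNIV"
    and d2 [measurable]: "d2 \<in> PiM {..<n} (\<lambda>_. borel) \<rightarrow>\<^sub>M count_space UNIV"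
    and E1: "invertible E1" "E1 ** transpose E1 = mat 1 + H1 ** code_cov n M1 x1 ** transpose H1
        + H2 ** code_cov n M2 x2 ** transpose H2"
    and E2: "invertible E2" "E2 ** transpose E2 = mat 1 + H2 ** code_cov n M2 x2 ** transpose H2"
    and E4: "invertible E4" "E4 ** transpose E4 = mat 1 + H4 ** code_cov n M2 x2 ** transpose H4"
  shows "(1 - (error_sum H1 H2 n M1 M2 x1 x2 d1 fst + error_sum H3 H4 n M1 M2 x1 x2 d2 snd) / (real M1 * real M2))
      * ln (real M1 * real M2) \<le> real n * (ln \<bar>det E1\<bar> + ln \<bar>det E4\<bar> - ln \<bar>det E2\<bar>) + ln 2"
proof -
  let ?P = "noise n \<Otimes>\<^sub>M noise n :: ((nat \<Rightarrow> real^'n) \<times> (nat \<Rightarrow> real^'n)) measure"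
  let ?MP = "PiM {..<n} (\<lambda>_. borel) \<Otimes>\<^sub>M PiM {..<n} (\<lambda>_. borel) :: ((nat \<Rightarrow> real^'n) \<times> (nat \<Rightarrow> real^'n)) measure"
  interpret N: prob_space "noise n :: (nat \<Rightarrow> real^'n) measure" by (rule prob_space_noise)
  interpret P: prob_space ?P by (intro prob_space_pair prob_space_noise)
  define T1 T2 T4 where "T1 = matrix_inv E1" and "T2 = matrix_inv E2" and "T4 = matrix_inv E4"
  have T1: "T1 ** E1 = mat 1" "E1 ** T1 = mat 1" using matrix_inv_cancel [OF E1(1)] by (simp_all add: T1_def)
  have T2: "T2 ** E2 = mat 1" "E2 ** T2 = mat 1" using matrix_inv_cancel [OF E2(1)] by (simp_all add: T2_def)
  have T4: "T4 ** E4 = mat 1" "E4 ** T4 = mat 1" using matrix_inv_cancel [OF E4(1)] by (simp_all add: T4_def)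
  have E1T: "E1 *v (T1 *v x) = x" and T1E: "T1 *v (E1 *v x) = x"
    and E2T: "E2 *v (T2 *v x) = x" and T2E: "T2 *v (E2 *v x) = x" and E4T: "E4 *v (T4 *v x) = x" for x
    by (simp_all add: matrix_vector_mul_assoc T1 T2 T4)
  have Bv: "B *v (H4 *v x) = H2 *v x" for x by (simp add: matrix_vector_mul_assoc B)
  \<comment> \<open>Once \<open>s\<close> has been replaced by a Gaussian block with square root
    \<open>E4\<close> of its covariance, \<open>B'\<close> and \<open>L'\<close> express the
    whitened \<open>t\<close> as a mixture of two standard noises.\<close>
  define B' where "B' = T2 ** B ** E4"
  define L' where "L' = T2 ** L"
  have BH: "B ** (H4 ** S ** transpose H4) ** transpose B = H2 ** S ** transpose H2" for S
    by (simp add: B(3) [symmetric] matrix_mul_assoc matrix_transpose_mul)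
  have B': "invertible B'" "B' ** transpose B' + L' ** transpose L' = mat 1"
  proof -
    have "invertible T2" "invertible E4" using T2 E4(1) invertible_def by blast+
    then show "invertible B'" unfolding B'_def using B(1) by (intro invertible_mult)
    have "B' ** transpose B' = T2 ** (B ** (E4 ** transpose E4) ** transpose B) ** transpose T2"
      by (simp add: B'_def matrix_mul_assoc matrix_transpose_mul)
    also have "B ** (E4 ** transpose E4) ** transpose B = B ** transpose B + H2 ** code_cov n M2 x2 ** transpose H2"
      by (simp add: E4(2) matrix_add_ldistrib matrix_add_rdistrib BH)
    finally have "B' ** transpose B' + L' ** transpose L'
      = T2 ** (B ** transpose B + L ** transpose L + H2 ** code_cov n M2 x2 ** transpose H2) ** transpose T2"
      by (simp add: L'_def matrix_add_ldistrib matrix_add_rdistrib matrix_mul_assoc matrix_transpose_mul)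
    also have "\<dots> = (T2 ** E2) ** transpose (T2 ** E2)"
      by (simp add: B(2) E2(2) [symmetric] matrix_mul_assoc matrix_transpose_mul)
    finally show "B' ** transpose B' + L' ** transpose L' = mat 1" by (simp add: T2)
  qed
  let ?mix = "mixed_noise n B L :: (nat \<Rightarrow> real^'n) \<times> (nat \<Rightarrow> real^'n) \<Rightarrow> _"
  let ?mix' = "mixed_noise n B' L' :: (nat \<Rightarrow> real^'n) \<times> (nat \<Rightarrow> real^'n) \<Rightarrow> _"
  define \<xi>1 where "\<xi>1 m1 j = H1 *v code_dev M1 x1 m1 j" for m1 j
  define \<xi>2 where "\<xi>2 m2 j = H2 *v code_dev M2 x2 m2 j" for m2 j
  define \<xi>4 where "\<xi>4 m2 j = H4 *v code_dev M2 x2 m2 j" for m2 j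
  define TT where "TT = T1 ** E2"
  define b1 where "b1 m1 j = T1 *v \<xi>1 m1 j" for m1 j
  define v where "v m2 p = (\<lambda>j\<in>{..<n}. T2 *v (\<xi>2 m2 j + ?mix p j))" for m2 p
  have [measurable]: "v m2 \<in> ?MP \<rightarrow>\<^sub>M PiM {..<n} (\<lambda>_. borel)" for m2
    unfolding v_def [abs_def] by measurable
  \<comment> \<open>The second sum depends on \<open>p\<close> only through \<open>v\<close>, the
    whitened \<open>t\<close>. After the shift \<open>sh\<close>, which realizes the first change of
    measure, \<open>v\<close> becomes \<open>?mix' p\<close>, again standard noise, so the second
    change of measure can be made on that block alone.\<close>
  define W :: "nat \<times> nat \<Rightarrow> (nat \<Rightarrow> real^'n) \<times> (nat \<Rightarrow> real^'n) \<Rightarrow> real"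
    where "W m p = - (\<Sum>j<n. log_ratio T4 (T4 *v \<xi>4 (snd m) j) (fst p j))
      - (\<Sum>j<n. log_ratio TT (b1 (fst m) j) (v (snd m) p j))" for m p
  define sh where "sh m2 p = (\<lambda>j\<in>{..<n}. E4 *v (fst p j - T4 *v \<xi>4 m2 j), snd p)"
    for m2 and p :: "(nat \<Rightarrow> real^'n) \<times> (nat \<Rightarrow> real^'n)"
  have [measurable]: "sh m2 \<in> ?MP \<rightarrow>\<^sub>M ?MP" for m2
    unfolding sh_def [abs_def] by measurable
  have v_sh: "v m2 (sh m2 p) = ?mix' p" for m2 p
    by (rule ext)
       (simp add: v_def sh_def mixed_noise_def matrix_vector_mult_diff_distrib E4T \<xi>4_def \<xi>2_def Bv
         matrix_vector_right_distrib B'_def L'_def matrix_vector_mul_assoc [symmetric] restrict_def)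
  define G where "G m1 u = exp (\<Sum>j<n. log_ratio TT (b1 m1 j) (u j))" for m1 and u :: "nat \<Rightarrow> real^'n"
  have [measurable]: "G m1 \<in> borel_measurable (PiM {..<n} (\<lambda>_. borel))" for m1
    unfolding G_def [abs_def] by measurable
  have change: "(\<integral>\<^sup>+p. ennreal (exp (- W m p)) * f p \<partial>?P) = (\<integral>\<^sup>+p. ennreal (G (fst m) (?mix' p)) * f (sh (snd m) p) \<partial>?P)"
    if [measurable]: "f \<in> borel_measurable ?MP" for m f
  proof -
    have "(\<integral>\<^sup>+p. ennreal (exp (- W m p)) * f p \<partial>?P)
      = (\<integral>\<^sup>+p. ennreal (exp (\<Sum>j<n. log_ratio T4 (T4 *v \<xi>4 (snd m) j) (fst p j)))
          * (ennreal (G (fst m) (v (snd m) p)) * f p) \<partial>?P)"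
      by (simp add: W_def G_def exp_add ennreal_mult mult_ac)
    also have "\<dots> = (\<integral>\<^sup>+p. ennreal (G (fst m) (v (snd m) (sh (snd m) p))) * f (sh (snd m) p) \<partial>?P)"
      unfolding sh_def by (rule noise_pair_change_of_variables [OF T4(2)]) measurable
    finally show ?thesis by (simp add: v_sh)
  qed
  have ST: "(T2 ** E1) ** TT = mat 1"
    by (metis T1(2) T2(1) TT_def matrix_mul_assoc matrix_mul_rid)
  have G_change: "(\<integral>\<^sup>+p. ennreal (G m1 (?mix' p)) * f (?mix' p) \<partial>?P)
      = (\<integral>\<^sup>+u. f (\<lambda>j\<in>{..<n}. (T2 ** E1) *v (u j - b1 m1 j)) \<partial>noise n)"
    if [measurable]: "f \<in> borel_measurable (PiM {..<n} (\<lambda>_. borel))" for m1 and f :: "(nat \<Rightarrow> real^'n) \<Rightarrow> ennreal"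
  proof -
    have "(\<integral>\<^sup>+p. ennreal (G m1 (?mix' p)) * f (?mix' p) \<partial>?P)
      = (\<integral>\<^sup>+u. ennreal (G m1 u) * f u \<partial>distr ?P (noise n) ?mix')"
      by (subst nn_integral_distr) simp_all
    also have "\<dots> = (\<integral>\<^sup>+u. ennreal (G m1 u) * f u \<partial>noise n)"
      by (simp add: distr_mixed_noise [OF B'])
    also have "\<dots> = (\<integral>\<^sup>+u. f (\<lambda>j\<in>{..<n}. (T2 ** E1) *v (u j - b1 m1 j)) \<partial>noise n)"
      unfolding G_def by (rule noise_change_of_variables [OF ST that])
    finally show ?thesis .
  qed
  let ?D = "\<lambda>m p. decoded H1 H2 H3 H4 B L n x1 x2 d1 d2 m p"
  \<comment> \<open>After the shift neither block contains \<open>m2\<close>, but that of receiver 2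
    still contains \<open>m1\<close>; therefore \<open>m2\<close> is summed out first.\<close>
  define y1 where "y1 m1 u = received n H1 H2 (x1 m1) (code_mean M2 x2) (\<lambda>j. E2 *v u j)" for m1 u
  have [measurable]: "y1 m1 \<in> PiM {..<n} (\<lambda>_. borel) \<rightarrow>\<^sub>M PiM {..<n} (\<lambda>_. borel)" for m1
    unfolding y1_def [abs_def] received_def by measurable
  define y2 where "y2 m1 p = received n H3 H4 (x1 m1) (code_mean M2 x2) (\<lambda>j. E4 *v fst p j)"
    for m1 and p :: "(nat \<Rightarrow> real^'n) \<times> (nat \<Rightarrow> real^'n)"
  have [measurable]: "y2 m1 \<in> ?MP \<rightarrow>\<^sub>M PiM {..<n} (\<lambda>_. borel)" for m1
    unfolding y2_def [abs_def] received_def by measurable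
  have D: "?D m (sh (snd m) p) \<longleftrightarrow> d1 (y1 (fst m) (?mix' p)) = fst m \<and> d2 (y2 (fst m) p) = snd m" for m p
  proof -
    have "received n H3 H4 (x1 (fst m)) (x2 (snd m)) (fst (sh (snd m) p)) = y2 (fst m) p"
      unfolding y2_def
      by (rule received_cong)
         (simp add: sh_def \<xi>4_def E4T matrix_vector_mult_diff_distrib code_dev_def algebra_simps)
    moreover have "received n H1 H2 (x1 (fst m)) (x2 (snd m)) (?mix (sh (snd m) p)) = y1 (fst m) (?mix' p)"
      unfolding y1_def
      by (rule received_cong)
         (simp add: sh_def \<xi>4_def E4T E2T Bv mixed_noise_def matrix_vector_mult_diff_distrib
           matrix_vector_right_distrib code_dev_def B'_def L'_def matrix_vector_mul_assoc [symmetric] algebra_simps)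
    ultimately show ?thesis by (simp add: decoded_def)
  qed
  define y where "y u = received n H1 H2 (code_mean M1 x1) (code_mean M2 x2) (\<lambda>j. E1 *v u j)" for u
  have [measurable]: "y \<in> PiM {..<n} (\<lambda>_. borel) \<rightarrow>\<^sub>M PiM {..<n} (\<lambda>_. borel)"
    unfolding y_def [abs_def] received_def by measurable
  have y1_y: "y1 m1 (\<lambda>j\<in>{..<n}. (T2 ** E1) *v (u j - b1 m1 j)) = y u" for m1 u
    unfolding y1_def y_def
    by (rule received_cong)
       (simp add: E2T E1T b1_def \<xi>1_def matrix_vector_mult_diff_distrib code_dev_def
         matrix_vector_mul_assoc [symmetric] algebra_simps)
  have lr4: "integrable ?P (\<lambda>p. log_ratio T4 b (fst p j))"
    "(\<integral>p. log_ratio T4 b (fst p j) \<partial>?P) = ln \<bar>det T4\<bar> - ((norm b)\<^sup>2 + (norm T4)\<^sup>2) / 2 + real CARD('n) / 2"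
    if "j < n" for b j
    using distr_noise_integral [OF N.distr_pair_fst, where g = "\<lambda>z. log_ratio T4 b (z j)"]
      noise_log_ratio [OF that, of T4 b] that
    by simp_all
  define a1 where "a1 m j = T1 *v (\<xi>1 (fst m) j + \<xi>2 (snd m) j)" for m j
  define a2 where "a2 m j = T2 *v \<xi>2 (snd m) j" for m :: "nat \<times> nat" and j
  have lr1: "integrable ?P (\<lambda>p. log_ratio TT (b1 (fst m) j) (v (snd m) p j))"
    "(\<integral>p. log_ratio TT (b1 (fst m) j) (v (snd m) p j) \<partial>?P)
      = ln \<bar>det TT\<bar> - ((norm (a1 m j))\<^sup>2 + (norm T1)\<^sup>2) / 2 + ((norm (a2 m j))\<^sup>2 + (norm T2)\<^sup>2) / 2" if "j < n" for m j
  proof -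
    have TT: "log_ratio TT (b1 (fst m) j) (v (snd m) p j)
      = ln \<bar>det TT\<bar> - (norm (a1 m j + T1 *v ?mix p j))\<^sup>2 / 2 + (norm (a2 m j + T2 *v ?mix p j))\<^sup>2 / 2" for p
      using that
      by (simp add: log_ratio_def v_def TT_def a1_def a2_def b1_def E2T matrix_vector_right_distrib
          matrix_vector_mul_assoc [symmetric] add_ac)
    have 1: "integrable ?P (\<lambda>p. (norm (a + T *v ?mix p j))\<^sup>2)"
      "(\<integral>p. (norm (a + T *v ?mix p j))\<^sup>2 \<partial>?P) = (norm a)\<^sup>2 + (norm T)\<^sup>2" for a and T :: "real^'n^'n"
      using distr_noise_integral [OF distr_mixed_noise [OF B(1,2)], where g = "\<lambda>z. (norm (a + T *v z j))\<^sup>2"]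
        noise_norm_affine [OF that, of a T] that
      by simp_all
    show "integrable ?P (\<lambda>p. log_ratio TT (b1 (fst m) j) (v (snd m) p j))"
      unfolding TT using 1 by simp
    show "(\<integral>p. log_ratio TT (b1 (fst m) j) (v (snd m) p j) \<partial>?P)
      = ln \<bar>det TT\<bar> - ((norm (a1 m j))\<^sup>2 + (norm T1)\<^sup>2) / 2 + ((norm (a2 m j))\<^sup>2 + (norm T2)\<^sup>2) / 2"
      unfolding TT using 1 by (simp add: P.prob_space)
  qed
  show ?thesis
  proof (rule converse_from_likelihood [OF M B(1,2) d1 d2])
    show "integrable ?P (W m)" for m
      unfolding W_def
      by (intro Bochner_Integration.integrable_diff integrable_minus Bochner_Integration.integrable_sum lr4 lr1) simp_all
    show "(\<integral>\<^sup>+p. ennreal (exp (- W m p)) \<partial>?P) \<le> 1" for m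
      using change [of "\<lambda>_. 1" m] G_change [of "\<lambda>_. 1" "fst m"] by (simp add: N.emeasure_space_1)
    \<comment> \<open>For fixed \<open>m1\<close> the decision of receiver 2 equals at most one
      \<open>m2\<close>, so the sum over \<open>m2\<close> absorbs its event. What remains is a
      function of \<open>?mix' p\<close>, and the change of measure by \<open>G m1\<close> removes
      \<open>m1\<close> from it.\<close>
    have "(\<integral>\<^sup>+p. (\<Sum>m2<M2. ennreal (exp (- W (m1, m2) p)) * of_bool (?D (m1, m2) p)) \<partial>?P)
        \<le> (\<integral>\<^sup>+u. of_bool (d1 (y u) = m1) \<partial>noise n)" for m1
    proof -
      have "(\<integral>\<^sup>+p. (\<Sum>m2<M2. ennreal (exp (- W (m1, m2) p)) * of_bool (?D (m1, m2) p)) \<partial>?P)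
        = (\<Sum>m2<M2. \<integral>\<^sup>+p. ennreal (exp (- W (m1, m2) p)) * of_bool (?D (m1, m2) p) \<partial>?P)"
      proof (rule nn_integral_sum)
        fix m2
        have [measurable]: "W (m1, m2) \<in> borel_measurable ?MP" unfolding W_def by measurable
        show "(\<lambda>p. ennreal (exp (- W (m1, m2) p)) * of_bool (?D (m1, m2) p)) \<in> borel_measurable ?P" by measurable
      qed
      also have "\<dots> = (\<Sum>m2<M2. \<integral>\<^sup>+p. ennreal (G m1 (?mix' p)) * of_bool (d1 (y1 m1 (?mix' p)) = m1 \<and> d2 (y2 m1 p) = m2) \<partial>?P)"
        using D [of "(m1, _)"] by (subst change) simp_all
      also have "\<dots> = (\<integral>\<^sup>+p. (\<Sum>m2<M2. ennreal (G m1 (?mix' p)) * of_bool (d1 (y1 m1 (?mix' p)) = m1 \<and> d2 (y2 m1 p) = m2)) \<partial>?P)"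
        by (rule nn_integral_sum [symmetric]) measurable
      also have "\<dots> \<le> (\<integral>\<^sup>+p. ennreal (G m1 (?mix' p)) * of_bool (d1 (y1 m1 (?mix' p)) = m1) \<partial>?P)"
      proof (rule nn_integral_mono)
        fix p
        have "(\<Sum>m2<M2. ennreal (G m1 (?mix' p)) * of_bool (d1 (y1 m1 (?mix' p)) = m1 \<and> d2 (y2 m1 p) = m2))
          = ennreal (G m1 (?mix' p)) * of_bool (d1 (y1 m1 (?mix' p)) = m1) * (\<Sum>m2<M2. of_bool (d2 (y2 m1 p) = m2))"
          by (simp add: of_bool_conj sum_distrib_left mult.assoc mult.commute)
        also have "\<dots> \<le> ennreal (G m1 (?mix' p)) * of_bool (d1 (y1 m1 (?mix' p)) = m1) * 1"
          by (intro mult_left_mono sum_of_bool_eq_le_1) simp_all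
        finally show "(\<Sum>m2<M2. ennreal (G m1 (?mix' p)) * of_bool (d1 (y1 m1 (?mix' p)) = m1 \<and> d2 (y2 m1 p) = m2))
          \<le> ennreal (G m1 (?mix' p)) * of_bool (d1 (y1 m1 (?mix' p)) = m1)" by simp
      qed
      also have "\<dots> = (\<integral>\<^sup>+u. of_bool (d1 (y u) = m1) \<partial>noise n)"
        by (subst G_change [of "\<lambda>u. of_bool (d1 (y1 m1 u) = m1)"]) (simp_all add: y1_y)
      finally show ?thesis .
    qed
    note bound = this
    have "(\<Sum>m\<in>{..<M1} \<times> {..<M2}. \<integral>\<^sup>+p. ennreal (exp (- W m p)) * of_bool (?D m p) \<partial>?P)
        = (\<Sum>m1<M1. \<integral>\<^sup>+p. (\<Sum>m2<M2. ennreal (exp (- W (m1, m2) p)) * of_bool (?D (m1, m2) p)) \<partial>?P)"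
    proof -
      have "(\<lambda>p. ennreal (exp (- W m p)) * of_bool (?D m p)) \<in> borel_measurable ?P" for m
      proof -
        have [measurable]: "W m \<in> borel_measurable ?MP" unfolding W_def by measurable
        show ?thesis by measurable
      qed
      then show ?thesis
        unfolding sum.cartesian_product'
        by (intro sum.cong refl nn_integral_sum [symmetric]) simp
    qed
    also have "\<dots> \<le> (\<Sum>m1<M1. \<integral>\<^sup>+u. of_bool (d1 (y u) = m1) \<partial>noise n)"
      by (intro sum_mono bound)
    also have "\<dots> \<le> 1"
      by (rule sum_nn_integral_le_1 [OF N.prob_space_axioms]) (measurable, rule sum_of_bool_eq_le_1, simp)
    finally show "(\<Sum>m\<in>{..<M1} \<times> {..<M2}. \<integral>\<^sup>+p. ennreal (exp (- W m p)) * of_bool (?D m p) \<partial>?P) \<le> 1" .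
    let ?c = "ln \<bar>det E1\<bar> + ln \<bar>det E4\<bar> - ln \<bar>det E2\<bar>"
    have lnTT: "ln \<bar>det TT\<bar> = ln \<bar>det E2\<bar> - ln \<bar>det E1\<bar>"
    proof -
      have "ln \<bar>det TT\<bar> = ln (\<bar>det T1\<bar> * \<bar>det E2\<bar>)" by (simp add: TT_def det_mul abs_mult)
      also have "\<dots> = ln \<bar>det T1\<bar> + ln \<bar>det E2\<bar>"
      proof (rule ln_mult_pos)
        have "invertible T1" using T1 invertible_def by blast
        then show "0 < \<bar>det T1\<bar>" "0 < \<bar>det E2\<bar>" using E2(1) by (simp_all add: invertible_det_nz)
      qed
      finally show ?thesis by (simp add: ln_det_inverse [OF T1(1)])
    qed
    have EWm: "(\<integral>p. W m p \<partial>?P) = ((\<Sum>j<n. (norm (T4 *v \<xi>4 (snd m) j))\<^sup>2 + (norm T4)\<^sup>2)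
        + (\<Sum>j<n. (norm (a1 m j))\<^sup>2 + (norm T1)\<^sup>2) - (\<Sum>j<n. (norm (a2 m j))\<^sup>2 + (norm T2)\<^sup>2)) / 2
        + real n * (?c - real CARD('n) / 2)" for m
    proof -
      have "(\<integral>p. W m p \<partial>?P) = - (\<Sum>j<n. \<integral>p. log_ratio T4 (T4 *v \<xi>4 (snd m) j) (fst p j) \<partial>?P)
         - (\<Sum>j<n. \<integral>p. log_ratio TT (b1 (fst m) j) (v (snd m) p j) \<partial>?P)"
        unfolding W_def
        by (subst Bochner_Integration.integral_diff, (intro integrable_minus Bochner_Integration.integrable_sum lr4 lr1, simp)+)
           (simp add: lr4 lr1)
      also have "\<dots> = - (\<Sum>j<n. ln \<bar>det T4\<bar> - ((norm (T4 *v \<xi>4 (snd m) j))\<^sup>2 + (norm T4)\<^sup>2) / 2 + real CARD('n) / 2)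
         - (\<Sum>j<n. ln \<bar>det TT\<bar> - ((norm (a1 m j))\<^sup>2 + (norm T1)\<^sup>2) / 2 + ((norm (a2 m j))\<^sup>2 + (norm T2)\<^sup>2) / 2)"
        by (simp add: lr4 lr1)
      finally show ?thesis
        by (simp add: add_divide_distrib diff_divide_distrib sum.distrib sum_subtractf sum_divide_distrib [symmetric]
            lnTT ln_det_inverse [OF T4(1)] algebra_simps)
    qed
    \<comment> \<open>Taking \<open>A1 = 0\<close> reduces the two-user average to the second
      codebook alone.\<close>
    have S4: "(\<Sum>m\<in>{..<M1} \<times> {..<M2}. \<Sum>j<n. (norm (T4 *v \<xi>4 (snd m) j))\<^sup>2 + (norm T4)\<^sup>2)
         = real M1 * real M2 * (real n * real CARD('n))"
      using average_norm_affine [OF M n T4(1), where ?A1.0 = 0 and ?A2.0 = H4 and ?x1.0 = x1 and ?x2.0 = x2] E4(2)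
      by (simp add: \<xi>4_def case_prod_beta')
    have S1: "(\<Sum>m\<in>{..<M1} \<times> {..<M2}. \<Sum>j<n. (norm (a1 m j))\<^sup>2 + (norm T1)\<^sup>2)
         = real M1 * real M2 * (real n * real CARD('n))"
      using average_norm_affine [OF M n T1(1) E1(2)] by (simp add: a1_def \<xi>1_def \<xi>2_def case_prod_beta')
    have S2: "(\<Sum>m\<in>{..<M1} \<times> {..<M2}. \<Sum>j<n. (norm (a2 m j))\<^sup>2 + (norm T2)\<^sup>2)
         = real M1 * real M2 * (real n * real CARD('n))"
      using average_norm_affine [OF M n T2(1), where ?A1.0 = 0 and ?A2.0 = H2 and ?x1.0 = x1 and ?x2.0 = x2] E2(2)
      by (simp add: a2_def \<xi>2_def case_prod_beta')
    have "(\<Sum>m\<in>{..<M1} \<times> {..<M2}. \<integral>p. W m p \<partial>?P)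
      = ((\<Sum>m\<in>{..<M1} \<times> {..<M2}. \<Sum>j<n. (norm (T4 *v \<xi>4 (snd m) j))\<^sup>2 + (norm T4)\<^sup>2)
        + (\<Sum>m\<in>{..<M1} \<times> {..<M2}. \<Sum>j<n. (norm (a1 m j))\<^sup>2 + (norm T1)\<^sup>2)
        - (\<Sum>m\<in>{..<M1} \<times> {..<M2}. \<Sum>j<n. (norm (a2 m j))\<^sup>2 + (norm T2)\<^sup>2)) / 2
        + real M1 * real M2 * (real n * (?c - real CARD('n) / 2))"
      unfolding EWm by (simp only: sum.distrib sum_subtractf sum_divide_distrib [symmetric]) simp
    also have "\<dots> = real M1 * real M2 * (real n * ?c)"
      unfolding S1 S2 S4 by (simp add: algebra_simps)
    finally show "(\<Sum>m\<in>{..<M1} \<times> {..<M2}. \<integral>p. W m p \<partial>?P) = real M1 * real M2 * (real n * ?c)" .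
  qed
qed

section \<open>Random coding\<close>

lemma nn_integral_PiM_component:
  assumes "\<And>i. prob_space (M i)" "i \<in> I" and [measurable]: "f \<in> borel_measurable (M i)"
  shows "(\<integral>\<^sup>+x. f (x i) \<partial>PiM I M) = (\<integral>\<^sup>+x. f x \<partial>M i)"
proof -
  have d: "distr (PiM I M) (M i) (\<lambda>x. x i) = M i"
    using assms by (intro distr_PiM_component) auto
  have [measurable]: "(\<lambda>x. x i) \<in> PiM I M \<rightarrow>\<^sub>M M i" using assms(2) by simp
  show ?thesis
    using nn_integral_distr [of "\<lambda>x. x i" "PiM I M" "M i" f] by (simp add: d)
qed

text \<open>A true and a wrong codeword are distinct coordinates of the random codebook, hence
  independent; coordinate \<open>j\<close> is split off and integrated innermost.\<close>

lemma nn_integral_PiM_two_components: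
  fixes N :: "'b measure" and f :: "'b \<times> 'b \<Rightarrow> ennreal" and n :: nat
  assumes N: "prob_space N" and ij: "i < n" "j < n" "i \<noteq> j"
    and f [measurable]: "f \<in> borel_measurable (N \<Otimes>\<^sub>M N)"
  shows "(\<integral>\<^sup>+x. f (x i, x j) \<partial>PiM {..<n} (\<lambda>_. N)) = (\<integral>\<^sup>+a. \<integral>\<^sup>+b. f (a, b) \<partial>N \<partial>N)"
proof -
  interpret N: prob_space N by fact
  interpret P: product_sigma_finite "\<lambda>_::nat. N" by (rule product_sigma_finite_prob) (rule N)
  interpret Pj: prob_space "PiM ({..<n} - {j}) (\<lambda>_. N)" by (rule prob_space_PiM) (rule N)
  have I: "insert j ({..<n} - {j}) = {..<n}" using ij by blast
  have [measurable]: "(\<lambda>x. x i) \<in> PiM {..<n} (\<lambda>_. N) \<rightarrow>\<^sub>M N" "(\<lambda>x. x j) \<in> PiM {..<n} (\<lambda>_. N) \<rightarrow>\<^sub>M N"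
    using ij by simp_all
  have "(\<lambda>x. f (x i, x j)) \<in> borel_measurable (PiM {..<n} (\<lambda>_. N))"
    by measurable
  then have "(\<integral>\<^sup>+x. f (x i, x j) \<partial>PiM {..<n} (\<lambda>_. N))
      = (\<integral>\<^sup>+x. \<integral>\<^sup>+b. f ((x(j := b)) i, (x(j := b)) j) \<partial>N \<partial>PiM ({..<n} - {j}) (\<lambda>_. N))"
    using P.product_nn_integral_insert [of "{..<n} - {j}" j "\<lambda>x. f (x i, x j)", unfolded I] by simp
  also have "\<dots> = (\<integral>\<^sup>+x. (\<lambda>a. \<integral>\<^sup>+b. f (a, b) \<partial>N) (x i) \<partial>PiM ({..<n} - {j}) (\<lambda>_. N))"
    using ij by simp
  also have "\<dots> = (\<integral>\<^sup>+a. \<integral>\<^sup>+b. f (a, b) \<partial>N \<partial>N)"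
    using ij by (intro nn_integral_PiM_component N) auto
  finally show ?thesis .
qed

text \<open>The four functions bound the error probability caused by the true pair of codewords
  \<open>(a, b)\<close>, by a wrong codeword \<open>a'\<close>, by a wrong codeword \<open>b'\<close>, and by a wrong pair \<open>(a', b')\<close>.\<close>

lemma random_coding:
  fixes N :: "'b measure" and M1 M2 :: nat
    and f0 :: "'b \<times> 'b \<Rightarrow> ennreal" and f1 f2 :: "('b \<times> 'b) \<times> 'b \<Rightarrow> ennreal" and f12 :: "('b \<times> 'b) \<times> ('b \<times> 'b) \<Rightarrow> ennreal"
  assumes N: "prob_space N" and M: "0 < M1" "0 < M2"
    and [measurable]: "f0 \<in> borel_measurable (N \<Otimes>\<^sub>M N)"
      "f1 \<in> borel_measurable ((N \<Otimes>\<^sub>M N) \<Otimes>\<^sub>M N)" "f2 \<in> borel_measurable ((N \<Otimes>\<^sub>M N) \<Otimes>\<^sub>M N)"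
      "f12 \<in> borel_measurable ((N \<Otimes>\<^sub>M N) \<Otimes>\<^sub>M (N \<Otimes>\<^sub>M N))"
    and f0: "(\<integral>\<^sup>+a. \<integral>\<^sup>+b. f0 (a, b) \<partial>N \<partial>N) \<le> \<alpha>"
    and f1: "(\<integral>\<^sup>+a'. \<integral>\<^sup>+a. \<integral>\<^sup>+b. f1 ((a', a), b) \<partial>N \<partial>N \<partial>N) \<le> \<beta>1"
    and f2: "(\<integral>\<^sup>+a. \<integral>\<^sup>+b'. \<integral>\<^sup>+b. f2 ((b', b), a) \<partial>N \<partial>N \<partial>N) \<le> \<beta>2"
    and f12: "(\<integral>\<^sup>+a'. \<integral>\<^sup>+a. \<integral>\<^sup>+b'. \<integral>\<^sup>+b. f12 ((a', a), (b', b)) \<partial>N \<partial>N \<partial>N \<partial>N) \<le> \<beta>12"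
    and less: "\<alpha> + of_nat (M1 - 1) * \<beta>1 + of_nat (M2 - 1) * \<beta>2 + of_nat (M1 - 1) * of_nat (M2 - 1) * \<beta>12 < \<delta>"
  shows "\<exists>g1 \<in> space (PiM {..<M1} (\<lambda>_. N)). \<exists>g2 \<in> space (PiM {..<M2} (\<lambda>_. N)).
    (\<Sum>m1<M1. \<Sum>m2<M2. f0 (g1 m1, g2 m2) + (\<Sum>m'\<in>{..<M1} - {m1}. f1 ((g1 m', g1 m1), g2 m2))
        + (\<Sum>m'\<in>{..<M2} - {m2}. f2 ((g2 m', g2 m2), g1 m1))
        + (\<Sum>m1'\<in>{..<M1} - {m1}. \<Sum>m2'\<in>{..<M2} - {m2}. f12 ((g1 m1', g1 m1), (g2 m2', g2 m2))))
      < of_nat M1 * of_nat M2 * \<delta>"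
\<comment> \<open>If every pair of codebooks violated the bound, so would the average over random
  codebooks.\<close>
proof (rule ccontr)
  assume neg: "\<not> ?thesis"
  let ?G1 = "PiM {..<M1} (\<lambda>_. N)" and ?G2 = "PiM {..<M2} (\<lambda>_. N)"
  interpret N: prob_space N by fact
  interpret G1: prob_space ?G1 by (rule prob_space_PiM) (rule N)
  interpret G2: prob_space ?G2 by (rule prob_space_PiM) (rule N)
  define h where "h m1 m2 g1 g2 = f0 (g1 m1, g2 m2) + (\<Sum>m'\<in>{..<M1} - {m1}. f1 ((g1 m', g1 m1), g2 m2))
        + (\<Sum>m'\<in>{..<M2} - {m2}. f2 ((g2 m', g2 m2), g1 m1))
        + (\<Sum>m1'\<in>{..<M1} - {m1}. \<Sum>m2'\<in>{..<M2} - {m2}. f12 ((g1 m1', g1 m1), (g2 m2', g2 m2)))"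
    for m1 m2 and g1 g2 :: "nat \<Rightarrow> 'b"
  have comp [measurable]: "(\<lambda>g. g m) \<in> ?G1 \<rightarrow>\<^sub>M N" if "m < M1" for m using that by simp
  have comp2 [measurable]: "(\<lambda>g. g m) \<in> ?G2 \<rightarrow>\<^sub>M N" if "m < M2" for m using that by simp
  let ?s = "\<alpha> + of_nat (M1 - 1) * \<beta>1 + of_nat (M2 - 1) * \<beta>2 + of_nat (M1 - 1) * of_nat (M2 - 1) * \<beta>12"
  have ge: "of_nat M1 * of_nat M2 * \<delta> \<le> (\<Sum>m1<M1. \<Sum>m2<M2. h m1 m2 g1 g2)"
    if "g1 \<in> space ?G1" "g2 \<in> space ?G2" for g1 g2
    using that neg unfolding h_def by (meson not_le)
  let ?GG = "?G1 \<Otimes>\<^sub>M ?G2"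
  have c1: "(\<lambda>p. fst p m) \<in> ?GG \<rightarrow>\<^sub>M N" if "m < M1" for m
    by (rule measurable_compose [OF measurable_fst comp [OF that]])
  have c2: "(\<lambda>p. snd p m) \<in> ?GG \<rightarrow>\<^sub>M N" if "m < M2" for m
    by (rule measurable_compose [OF measurable_snd comp2 [OF that]])
  have m0: "(\<lambda>p. f0 (fst p m1, snd p m2)) \<in> borel_measurable ?GG" if m: "m1 < M1" "m2 < M2" for m1 m2
  proof -
    note [measurable] = c1 [OF m(1)] c2 [OF m(2)]
    show ?thesis by measurable
  qed
  have m1: "(\<lambda>p. f1 ((fst p m', fst p m1), snd p m2)) \<in> borel_measurable ?GG"
    if m: "m1 < M1" "m2 < M2" "m' < M1" for m1 m2 m'
  proof -
    note [measurable] = c1 [OF m(1)] c2 [OF m(2)] c1 [OF m(3)]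
    show ?thesis by measurable
  qed
  have m2: "(\<lambda>p. f2 ((snd p m', snd p m2), fst p m1)) \<in> borel_measurable ?GG"
    if m: "m1 < M1" "m2 < M2" "m' < M2" for m1 m2 m'
  proof -
    note [measurable] = c1 [OF m(1)] c2 [OF m(2)] c2 [OF m(3)]
    show ?thesis by measurable
  qed
  have m12: "(\<lambda>p. f12 ((fst p m1', fst p m1), (snd p m2', snd p m2))) \<in> borel_measurable ?GG"
    if m: "m1 < M1" "m2 < M2" "m1' < M1" "m2' < M2" for m1 m2 m1' m2'
  proof -
    note [measurable] = c1 [OF m(1)] c2 [OF m(2)] c1 [OF m(3)] c2 [OF m(4)]
    show ?thesis by measurable
  qed
  have meas: "(\<lambda>p. h m1 m2 (fst p) (snd p)) \<in> borel_measurable ?GG" if m: "m1 < M1" "m2 < M2" for m1 m2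
    unfolding h_def using m
    by (intro borel_measurable_add borel_measurable_sum m0 m1 m2 m12) simp_all
  \<comment> \<open>By independence of the codewords each expectation is one of the four integrals
    of the hypotheses, whichever messages are sent.\<close>
  have Eh: "(\<integral>\<^sup>+g1. \<integral>\<^sup>+g2. h m1 m2 g1 g2 \<partial>?G2 \<partial>?G1) \<le> ?s" if m: "m1 < M1" "m2 < M2" for m1 m2
  proof -
    have 0: "(\<integral>\<^sup>+g1. \<integral>\<^sup>+g2. f0 (g1 m1, g2 m2) \<partial>?G2 \<partial>?G1) = (\<integral>\<^sup>+a. \<integral>\<^sup>+b. f0 (a, b) \<partial>N \<partial>N)"
    proof -
      have "(\<integral>\<^sup>+g1. \<integral>\<^sup>+g2. f0 (g1 m1, g2 m2) \<partial>?G2 \<partial>?G1) = (\<integral>\<^sup>+g1. (\<lambda>a. \<integral>\<^sup>+b. f0 (a, b) \<partial>N) (g1 m1) \<partial>?G1)"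
        using m measurable_space [OF comp [OF m(1)]]
        by (intro nn_integral_cong) (simp add: nn_integral_PiM_component [OF N, where f = "\<lambda>b. f0 (_, b)"])
      also have "\<dots> = (\<integral>\<^sup>+a. \<integral>\<^sup>+b. f0 (a, b) \<partial>N \<partial>N)"
        using m by (intro nn_integral_PiM_component N) auto
      finally show ?thesis .
    qed
    have 1: "(\<integral>\<^sup>+g1. \<integral>\<^sup>+g2. f1 ((g1 m', g1 m1), g2 m2) \<partial>?G2 \<partial>?G1) = (\<integral>\<^sup>+a'. \<integral>\<^sup>+a. \<integral>\<^sup>+b. f1 ((a', a), b) \<partial>N \<partial>N \<partial>N)"
      if m': "m' < M1" "m' \<noteq> m1" for m'
    proof -
      have "(\<integral>\<^sup>+g1. \<integral>\<^sup>+g2. f1 ((g1 m', g1 m1), g2 m2) \<partial>?G2 \<partial>?G1)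
        = (\<integral>\<^sup>+g1. (\<lambda>p. \<integral>\<^sup>+b. f1 (p, b) \<partial>N) (g1 m', g1 m1) \<partial>?G1)"
        using m measurable_space [OF comp [OF m(1)]] measurable_space [OF comp [OF m'(1)]]
        by (intro nn_integral_cong) (simp add: nn_integral_PiM_component [OF N, where f = "\<lambda>b. f1 (_, b)"])
      also have "\<dots> = (\<integral>\<^sup>+a'. \<integral>\<^sup>+a. \<integral>\<^sup>+b. f1 ((a', a), b) \<partial>N \<partial>N \<partial>N)"
        using m m' by (intro nn_integral_PiM_two_components N) auto
      finally show ?thesis .
    qed
    have 2: "(\<integral>\<^sup>+g1. \<integral>\<^sup>+g2. f2 ((g2 m', g2 m2), g1 m1) \<partial>?G2 \<partial>?G1) = (\<integral>\<^sup>+a. \<integral>\<^sup>+b'. \<integral>\<^sup>+b. f2 ((b', b), a) \<partial>N \<partial>N \<partial>N)"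
      if m': "m' < M2" "m' \<noteq> m2" for m'
    proof -
      have "(\<integral>\<^sup>+g1. \<integral>\<^sup>+g2. f2 ((g2 m', g2 m2), g1 m1) \<partial>?G2 \<partial>?G1)
        = (\<integral>\<^sup>+g1. (\<lambda>a. \<integral>\<^sup>+b'. \<integral>\<^sup>+b. f2 ((b', b), a) \<partial>N \<partial>N) (g1 m1) \<partial>?G1)"
        using m m' measurable_space [OF comp [OF m(1)]]
        by (intro nn_integral_cong) (simp add: nn_integral_PiM_two_components [OF N, where f = "\<lambda>p. f2 (p, _)"])
      also have "\<dots> = (\<integral>\<^sup>+a. \<integral>\<^sup>+b'. \<integral>\<^sup>+b. f2 ((b', b), a) \<partial>N \<partial>N \<partial>N)"
        using m by (intro nn_integral_PiM_component N) auto
      finally show ?thesis .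
    qed
    have 12: "(\<integral>\<^sup>+g1. \<integral>\<^sup>+g2. f12 ((g1 m1', g1 m1), (g2 m2', g2 m2)) \<partial>?G2 \<partial>?G1)
        = (\<integral>\<^sup>+a'. \<integral>\<^sup>+a. \<integral>\<^sup>+b'. \<integral>\<^sup>+b. f12 ((a', a), (b', b)) \<partial>N \<partial>N \<partial>N \<partial>N)"
      if m': "m1' < M1" "m1' \<noteq> m1" "m2' < M2" "m2' \<noteq> m2" for m1' m2'
    proof -
      have "(\<integral>\<^sup>+g1. \<integral>\<^sup>+g2. f12 ((g1 m1', g1 m1), (g2 m2', g2 m2)) \<partial>?G2 \<partial>?G1)
        = (\<integral>\<^sup>+g1. (\<lambda>p. \<integral>\<^sup>+b'. \<integral>\<^sup>+b. f12 (p, (b', b)) \<partial>N \<partial>N) (g1 m1', g1 m1) \<partial>?G1)"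
        using m m' measurable_space [OF comp [OF m(1)]] measurable_space [OF comp [OF m'(1)]]
        by (intro nn_integral_cong)
           (simp add: nn_integral_PiM_two_components [OF N, where f = "\<lambda>p. f12 (_, p)"] space_pair_measure)
      also have "\<dots> = (\<integral>\<^sup>+a'. \<integral>\<^sup>+a. \<integral>\<^sup>+b'. \<integral>\<^sup>+b. f12 ((a', a), (b', b)) \<partial>N \<partial>N \<partial>N \<partial>N)"
        using m m' by (intro nn_integral_PiM_two_components N) auto
      finally show ?thesis .
    qed
    have "(\<integral>\<^sup>+g1. \<integral>\<^sup>+g2. h m1 m2 g1 g2 \<partial>?G2 \<partial>?G1)
      = (\<integral>\<^sup>+g1. \<integral>\<^sup>+g2. f0 (g1 m1, g2 m2) \<partial>?G2 \<partial>?G1)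
        + (\<Sum>m'\<in>{..<M1} - {m1}. \<integral>\<^sup>+g1. \<integral>\<^sup>+g2. f1 ((g1 m', g1 m1), g2 m2) \<partial>?G2 \<partial>?G1)
        + (\<Sum>m'\<in>{..<M2} - {m2}. \<integral>\<^sup>+g1. \<integral>\<^sup>+g2. f2 ((g2 m', g2 m2), g1 m1) \<partial>?G2 \<partial>?G1)
        + (\<Sum>m1'\<in>{..<M1} - {m1}. \<Sum>m2'\<in>{..<M2} - {m2}. \<integral>\<^sup>+g1. \<integral>\<^sup>+g2. f12 ((g1 m1', g1 m1), (g2 m2', g2 m2)) \<partial>?G2 \<partial>?G1)"
    proof -
      have it: "(\<integral>\<^sup>+g1. \<integral>\<^sup>+g2. k g1 g2 \<partial>?G2 \<partial>?G1) = (\<integral>\<^sup>+p. k (fst p) (snd p) \<partial>?GG)"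
        if "(\<lambda>p. k (fst p) (snd p)) \<in> borel_measurable ?GG" for k :: "(nat \<Rightarrow> 'b) \<Rightarrow> (nat \<Rightarrow> 'b) \<Rightarrow> ennreal"
        using G2.nn_integral_fst [OF that] by simp
      show ?thesis
      proof -
        note meas' = m0 [OF m] m1 [OF m] m2 [OF m] m12 [OF m]
        have "(\<integral>\<^sup>+p. h m1 m2 (fst p) (snd p) \<partial>?GG)
          = (\<integral>\<^sup>+p. f0 (fst p m1, snd p m2) \<partial>?GG)
            + (\<integral>\<^sup>+p. (\<Sum>m'\<in>{..<M1} - {m1}. f1 ((fst p m', fst p m1), snd p m2)) \<partial>?GG)
            + (\<integral>\<^sup>+p. (\<Sum>m'\<in>{..<M2} - {m2}. f2 ((snd p m', snd p m2), fst p m1)) \<partial>?GG)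
            + (\<integral>\<^sup>+p. (\<Sum>m1'\<in>{..<M1} - {m1}. \<Sum>m2'\<in>{..<M2} - {m2}. f12 ((fst p m1', fst p m1), (snd p m2', snd p m2))) \<partial>?GG)"
        proof -
          have s1: "(\<lambda>p. \<Sum>m'\<in>{..<M1} - {m1}. f1 ((fst p m', fst p m1), snd p m2)) \<in> borel_measurable ?GG"
            by (intro borel_measurable_sum meas') simp
          have s2: "(\<lambda>p. \<Sum>m'\<in>{..<M2} - {m2}. f2 ((snd p m', snd p m2), fst p m1)) \<in> borel_measurable ?GG"
            by (intro borel_measurable_sum meas') simp
          have s3: "(\<lambda>p. \<Sum>m1'\<in>{..<M1} - {m1}. \<Sum>m2'\<in>{..<M2} - {m2}. f12 ((fst p m1', fst p m1), (snd p m2', snd p m2))) \<in> borel_measurable ?GG"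
            by (intro borel_measurable_sum meas') simp_all
          show ?thesis
            unfolding h_def
            by (simp only: nn_integral_add [OF borel_measurable_add [OF borel_measurable_add [OF meas'(1) s1] s2] s3]
                nn_integral_add [OF borel_measurable_add [OF meas'(1) s1] s2] nn_integral_add [OF meas'(1) s1])
        qed
        also have "(\<integral>\<^sup>+p. (\<Sum>m'\<in>{..<M1} - {m1}. f1 ((fst p m', fst p m1), snd p m2)) \<partial>?GG)
          = (\<Sum>m'\<in>{..<M1} - {m1}. \<integral>\<^sup>+p. f1 ((fst p m', fst p m1), snd p m2) \<partial>?GG)"
          by (intro nn_integral_sum meas') simp
        also have "(\<integral>\<^sup>+p. (\<Sum>m'\<in>{..<M2} - {m2}. f2 ((snd p m', snd p m2), fst p m1)) \<partial>?GG)
          = (\<Sum>m'\<in>{..<M2} - {m2}. \<integral>\<^sup>+p. f2 ((snd p m', snd p m2), fst p m1) \<partial>?GG)"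
          by (intro nn_integral_sum meas') simp
        also have "(\<integral>\<^sup>+p. (\<Sum>m1'\<in>{..<M1} - {m1}. \<Sum>m2'\<in>{..<M2} - {m2}. f12 ((fst p m1', fst p m1), (snd p m2', snd p m2))) \<partial>?GG)
          = (\<Sum>m1'\<in>{..<M1} - {m1}. \<Sum>m2'\<in>{..<M2} - {m2}. \<integral>\<^sup>+p. f12 ((fst p m1', fst p m1), (snd p m2', snd p m2)) \<partial>?GG)"
          by (subst nn_integral_sum, (intro borel_measurable_sum meas'; simp),
              intro sum.cong refl nn_integral_sum meas') simp_all
        finally show ?thesis
          using m by (simp add: it meas m0 m1 m2 m12)
      qed
    qed
    also have "\<dots> \<le> \<alpha> + (\<Sum>m'\<in>{..<M1} - {m1}. \<beta>1) + (\<Sum>m'\<in>{..<M2} - {m2}. \<beta>2)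
        + (\<Sum>m1'\<in>{..<M1} - {m1}. \<Sum>m2'\<in>{..<M2} - {m2}. \<beta>12)"
      using f0 f1 f2 f12 by (intro add_mono sum_mono) (simp_all add: 0 1 2 12)
    also have "\<dots> = ?s" using m by (simp add: mult.assoc)
    finally show ?thesis .
  qed
  have "of_nat M1 * of_nat M2 * \<delta> = (\<integral>\<^sup>+g1. \<integral>\<^sup>+g2. of_nat M1 * of_nat M2 * \<delta> \<partial>?G2 \<partial>?G1)"
    by (simp add: G1.emeasure_space_1 G2.emeasure_space_1)
  also have "\<dots> \<le> (\<integral>\<^sup>+g1. \<integral>\<^sup>+g2. (\<Sum>m1<M1. \<Sum>m2<M2. h m1 m2 g1 g2) \<partial>?G2 \<partial>?G1)"
    by (intro nn_integral_mono ge)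
  also have "\<dots> = (\<Sum>m1<M1. \<Sum>m2<M2. \<integral>\<^sup>+g1. \<integral>\<^sup>+g2. h m1 m2 g1 g2 \<partial>?G2 \<partial>?G1)"
  proof -
    have it: "(\<integral>\<^sup>+g1. \<integral>\<^sup>+g2. h m1 m2 g1 g2 \<partial>?G2 \<partial>?G1) = (\<integral>\<^sup>+p. h m1 m2 (fst p) (snd p) \<partial>?GG)"
      if "m1 < M1" "m2 < M2" for m1 m2
      using G2.nn_integral_fst [OF meas [OF that]] by simp
    have ms: "(\<lambda>p. \<Sum>m2<M2. h m1 m2 (fst p) (snd p)) \<in> borel_measurable ?GG" if "m1 < M1" for m1
      using that by (intro borel_measurable_sum meas) simp_all
    have "(\<lambda>p. \<Sum>m1<M1. \<Sum>m2<M2. h m1 m2 (fst p) (snd p)) \<in> borel_measurable ?GG"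
      by (intro borel_measurable_sum ms) simp
    from G2.nn_integral_fst [OF this]
    have "(\<integral>\<^sup>+g1. \<integral>\<^sup>+g2. (\<Sum>m1<M1. \<Sum>m2<M2. h m1 m2 g1 g2) \<partial>?G2 \<partial>?G1)
      = (\<integral>\<^sup>+p. (\<Sum>m1<M1. \<Sum>m2<M2. h m1 m2 (fst p) (snd p)) \<partial>?GG)" by simp
    also have "\<dots> = (\<Sum>m1<M1. \<integral>\<^sup>+p. (\<Sum>m2<M2. h m1 m2 (fst p) (snd p)) \<partial>?GG)"
      by (intro nn_integral_sum ms) simp
    also have "\<dots> = (\<Sum>m1<M1. \<Sum>m2<M2. \<integral>\<^sup>+p. h m1 m2 (fst p) (snd p) \<partial>?GG)"
      by (intro sum.cong refl nn_integral_sum meas) simp_all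
    also have "\<dots> = (\<Sum>m1<M1. \<Sum>m2<M2. \<integral>\<^sup>+g1. \<integral>\<^sup>+g2. h m1 m2 g1 g2 \<partial>?G2 \<partial>?G1)"
      by (intro sum.cong refl it [symmetric]) simp_all
    finally show ?thesis .
  qed
  also have "\<dots> \<le> (\<Sum>m1<M1. \<Sum>m2<M2. ?s)"
    by (intro sum_mono Eh) simp_all
  also have "\<dots> = of_nat M1 * of_nat M2 * ?s" by (simp add: mult.assoc)
  also have "\<dots> < of_nat M1 * of_nat M2 * \<delta>"
    using less M by (intro ennreal_mult_strict_left_mono) (simp_all add: ennreal_zero_less_mult_iff ennreal_mult_less_top of_nat_less_top)
  finally show False by simp
qed

section \<open>Threshold decoders\<close>

text \<open>\<open>LEAST\<close> makes the choice among the passing messages definite and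
  measurable; the default 0 is a legal message whenever \<open>0 < M\<close>.\<close>

definition threshold_decoder :: "nat \<Rightarrow> (nat \<Rightarrow> 'y \<Rightarrow> bool) \<Rightarrow> 'y \<Rightarrow> nat" where
  "threshold_decoder M T y = (if \<exists>m<M. T m y then LEAST m. m < M \<and> T m y else 0)"

lemma threshold_decoder_wrong:
  assumes "m < M" "threshold_decoder M T y \<noteq> m"
  shows "\<not> T m y \<or> (\<exists>m'\<in>{..<M} - {m}. T m' y)"
proof (cases "T m y")
  case True
  then have ex: "m < M \<and> T m y" using assms by simp
  then have "threshold_decoder M T y = (LEAST m. m < M \<and> T m y)"
    by (auto simp: threshold_decoder_def)
  then have "threshold_decoder M T y < M \<and> T (threshold_decoder M T y) y"
    using LeastI [of "\<lambda>m. m < M \<and> T m y", OF ex] by simp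
  then show ?thesis using assms by blast
qed simp

lemma measurable_threshold_decoder:
  assumes [measurable]: "\<And>m. m < M \<Longrightarrow> Measurable.pred Y (T m)" and M: "0 < M"
  shows "threshold_decoder M T \<in> Y \<rightarrow>\<^sub>M count_space {..<M}"
proof -
  have lt: "threshold_decoder M T y < M" for y
    using M by (auto simp: threshold_decoder_def intro: LeastI2)
  have *: "Measurable.pred Y (\<lambda>y. m < M \<and> T m y)" for m
    by (cases "m < M") simp_all
  have "(\<lambda>y. LEAST m. m < M \<and> T m y) \<in> Y \<rightarrow>\<^sub>M count_space UNIV"
    by (rule measurable_Least) (rule *)
  moreover have "Measurable.pred Y (\<lambda>y. \<exists>m<M. T m y)"
    using * by (simp add: Bex_def [symmetric])
  ultimately have "threshold_decoder M T \<in> Y \<rightarrow>\<^sub>M count_space UNIV"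
    unfolding threshold_decoder_def [abs_def] by measurable
  then have "threshold_decoder M T -` {m} \<inter> space Y \<in> sets Y" for m
    by (rule measurable_sets) simp
  then show ?thesis
    using lt by (subst measurable_count_space_eq2) auto
qed

section \<open>Gaussian codebooks\<close>

lemma norm_matrix_vector_mult_le:
  fixes A :: "real^'n^'m"
  shows "norm (A *v x) \<le> norm A * norm x"
proof (rule power2_le_imp_le)
  have "(norm (A *v x))\<^sup>2 = (\<Sum>i\<in>UNIV. (A $ i \<bullet> x)\<^sup>2)"
    using norm_affine_power2 [of 0 A x] by simp
  also have "\<dots> \<le> (\<Sum>i\<in>UNIV. (norm (A $ i))\<^sup>2 * (norm x)\<^sup>2)"
    by (intro sum_mono) (metis Cauchy_Schwarz_ineq power2_norm_eq_inner)
  also have "\<dots> = (norm A * norm x)\<^sup>2"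
    by (simp add: norm_vec_def L2_set_def sum_nonneg sum_distrib_right power_mult_distrib)
  finally show "(norm (A *v x))\<^sup>2 \<le> (norm A * norm x)\<^sup>2" .
qed simp

lemma noise_power_variance:
  fixes L :: "real^'n^'n"
  shows "(\<integral>\<^sup>+z. ennreal (((\<Sum>j<n. (norm (L *v z j))\<^sup>2) - real n * (norm L)\<^sup>2)\<^sup>2) \<partial>noise n)
    = ennreal (real n * (\<integral>z. ((norm (L *v z))\<^sup>2 - (norm L)\<^sup>2)\<^sup>2 \<partial>std_gaussian))"
proof -
  have int: "integrable std_gaussian (\<lambda>z. ((norm (L *v z))\<^sup>2)\<^sup>2)"
  proof (rule Bochner_Integration.integrable_bound)
    show "integrable std_gaussian (\<lambda>z::real^'n. norm L ^ 4 * norm z ^ 4)"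
      by (intro integrable_mult_right gauss_integrable_norm_power4)
    show "AE z in std_gaussian. norm (((norm (L *v z))\<^sup>2)\<^sup>2) \<le> norm (norm L ^ 4 * norm z ^ 4)"
    proof (rule AE_I2)
      fix z
      have "norm (L *v z) ^ 4 \<le> (norm L * norm z) ^ 4"
        by (intro power_mono norm_matrix_vector_mult_le) simp
      then show "norm (((norm (L *v z))\<^sup>2)\<^sup>2) \<le> norm (norm L ^ 4 * norm z ^ 4)"
        by (simp add: power_mult_distrib flip: power_mult)
    qed
  qed simp
  have m: "(\<integral>z. (norm (L *v z))\<^sup>2 \<partial>std_gaussian) = (norm L)\<^sup>2"
    using gauss_integral_norm_affine [of 0 L] by simp
  show ?thesis
    using variance_sum_PiM [OF prob_space_std_gaussian _ int, of n] unfolding m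
    by (subst nn_integral_eq_integral) (simp_all add: noise_def)
qed

text \<open>For \<open>u\<close> distributed as \<open>noise n\<close>, this is the squared
  deviation from its mean of a chi-square variable with \<open>n * CARD('n)\<close> degrees of
  freedom.\<close>

definition chi2_dev :: "nat \<Rightarrow> (nat \<Rightarrow> real^'n) \<Rightarrow> ennreal" where
  "chi2_dev n u = ennreal (((\<Sum>j<n. (norm (u j))\<^sup>2) - real n * real CARD('n))\<^sup>2)"

text \<open>The chi-square variance for one channel use, left as an integral because it enters only
  the constant \<open>K\<close>, which is divided by \<open>n\<close>.\<close>

definition chi2_var :: "'n::finite itself \<Rightarrow> real" where
  "chi2_var _ = (\<integral>z. ((norm (z :: real^'n))\<^sup>2 - real CARD('n))\<^sup>2 \<partial>std_gaussian)"

lemma borel_measurable_chi2_dev [measurable]: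
  "chi2_dev n \<in> borel_measurable (PiM {..<n} (\<lambda>_. borel))"
  unfolding chi2_dev_def [abs_def] by measurable

lemma nn_integral_chi2_dev:
  "(\<integral>\<^sup>+u. chi2_dev n u \<partial>(noise n :: (nat \<Rightarrow> real^'n) measure)) = ennreal (real n * chi2_var TYPE('n))"
  using noise_power_variance [of n "mat 1 :: real^'n^'n"]
  by (simp add: chi2_dev_def chi2_var_def norm_mat_1_power2)

text \<open>\<open>T\<close> whitens \<open>A *v b j + z j\<close>, whose covariance is
  \<open>E ** transpose E\<close>, so the block inside \<open>h\<close> is again standard
  noise.\<close>

lemma nn_integral_Gaussian_sum2:
  fixes T E A :: "real^'n^'n" and h :: "(nat \<Rightarrow> real^'n) \<Rightarrow> ennreal"
  assumes TE: "T ** E = mat 1" and E: "E ** transpose E = mat 1 + A ** transpose A"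
    and h [measurable]: "h \<in> borel_measurable (PiM {..<n} (\<lambda>_. borel))"
  shows "(\<integral>\<^sup>+b. \<integral>\<^sup>+z. h (\<lambda>j\<in>{..<n}. T *v (A *v b j + z j)) \<partial>noise n \<partial>noise n) = (\<integral>\<^sup>+u. h u \<partial>noise n)"
proof -
  have inv: "invertible T" using TE invertible_right_inverse by blast
  have "T ** transpose T + (T ** A) ** transpose (T ** A) = (T ** E) ** transpose (T ** E)"
    by (simp add: matrix_transpose_mul E matrix_add_ldistrib matrix_add_rdistrib matrix_mul_assoc [symmetric])
       (simp add: matrix_mul_assoc E matrix_add_ldistrib matrix_add_rdistrib)
  then have BL: "T ** transpose T + (T ** A) ** transpose (T ** A) = mat 1" by (simp add: TE)
  have mix: "mixed_noise n T (T ** A) (z, b) = (\<lambda>j\<in>{..<n}. T *v (A *v b j + z j))" for z b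
    by (auto simp: mixed_noise_def matrix_vector_right_distrib matrix_vector_mul_assoc [symmetric] add.commute)
  have "(\<integral>\<^sup>+u. h u \<partial>noise n) = (\<integral>\<^sup>+u. h u \<partial>distr (noise n \<Otimes>\<^sub>M noise n) (noise n) (mixed_noise n T (T ** A)))"
    by (simp add: distr_mixed_noise [OF inv BL])
  also have "\<dots> = (\<integral>\<^sup>+p. h (mixed_noise n T (T ** A) p) \<partial>(noise n \<Otimes>\<^sub>M noise n))"
    by (rule nn_integral_distr) measurable
  also have "\<dots> = (\<integral>\<^sup>+b. \<integral>\<^sup>+z. h (mixed_noise n T (T ** A) (z, b)) \<partial>noise n \<partial>noise n)"
    by (rule nn_integral_noise_pair) measurable
  finally show ?thesis by (simp add: mix)
qed

text \<open>The last two terms are merged first: \<open>A2 *v b j + z j\<close> has the law of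
  \<open>F *v v j\<close> with fresh noise \<open>v\<close>, which leaves a mixture of two
  noises.\<close>

lemma nn_integral_Gaussian_sum3:
  fixes T E A1 A2 :: "real^'n^'n" and h :: "(nat \<Rightarrow> real^'n) \<Rightarrow> ennreal"
  assumes TE: "T ** E = mat 1" and E: "E ** transpose E = mat 1 + A1 ** transpose A1 + A2 ** transpose A2"
    and h [measurable]: "h \<in> borel_measurable (PiM {..<n} (\<lambda>_. borel))"
  shows "(\<integral>\<^sup>+a. \<integral>\<^sup>+b. \<integral>\<^sup>+z. h (\<lambda>j\<in>{..<n}. T *v (A1 *v a j + A2 *v b j + z j)) \<partial>noise n \<partial>noise n \<partial>noise n)
    = (\<integral>\<^sup>+u. h u \<partial>noise n)"
proof -
  obtain F :: "real^'n^'n" where F: "invertible F" "mat 1 + A2 ** transpose A2 = F ** transpose F"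
    by (rule posdef_factorization [OF posdef_add_psd [OF posdef_mat_1 psd_gram [of A2]]]) blast
  define R where "R = matrix_inv F"
  have R: "R ** F = mat 1" "F ** R = mat 1" using matrix_inv_cancel [OF F(1)] by (simp_all add: R_def)
  have FR: "F *v (R *v x) = x" for x by (simp add: matrix_vector_mul_assoc R)
  have 1: "(\<integral>\<^sup>+b. \<integral>\<^sup>+z. h (\<lambda>j\<in>{..<n}. T *v (A1 *v a j + A2 *v b j + z j)) \<partial>noise n \<partial>noise n)
     = (\<integral>\<^sup>+v. h (\<lambda>j\<in>{..<n}. T *v (A1 *v a j + F *v v j)) \<partial>noise n)" for a
  proof -
    have eq: "(\<lambda>j\<in>{..<n}. T *v (A1 *v a j + F *v (\<lambda>j\<in>{..<n}. R *v (A2 *v b j + z j)) j))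
      = (\<lambda>j\<in>{..<n}. T *v (A1 *v a j + A2 *v b j + z j))" for b z
      by (auto simp: FR add.assoc)
    have "(\<integral>\<^sup>+v. h (\<lambda>j\<in>{..<n}. T *v (A1 *v a j + F *v v j)) \<partial>noise n)
      = (\<integral>\<^sup>+b. \<integral>\<^sup>+z. h (\<lambda>j\<in>{..<n}. T *v (A1 *v a j + F *v (\<lambda>j\<in>{..<n}. R *v (A2 *v b j + z j)) j)) \<partial>noise n \<partial>noise n)"
      by (rule nn_integral_Gaussian_sum2 [OF R(1) F(2) [symmetric], symmetric]) measurable
    then show ?thesis by (simp only: eq)
  qed
  have "invertible (T ** F)"
    using TE F(1) invertible_right_inverse by (intro invertible_mult) blast+
  have "(T ** F) ** transpose (T ** F) + (T ** A1) ** transpose (T ** A1) = T ** (E ** transpose E) ** transpose T"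
    unfolding E
    by (simp add: matrix_transpose_mul matrix_add_ldistrib matrix_add_rdistrib matrix_mul_assoc)
       (simp add: matrix_mul_assoc [symmetric] F(2) [symmetric] matrix_add_ldistrib matrix_add_rdistrib)
  also have "\<dots> = (T ** E) ** transpose (T ** E)"
    by (simp add: matrix_transpose_mul matrix_mul_assoc)
  finally have BL: "(T ** F) ** transpose (T ** F) + (T ** A1) ** transpose (T ** A1) = mat 1"
    by (simp add: TE)
  have mix: "mixed_noise n (T ** F) (T ** A1) (v, a) = (\<lambda>j\<in>{..<n}. T *v (A1 *v a j + F *v v j))" for v a
    by (auto simp: mixed_noise_def matrix_vector_right_distrib matrix_vector_mul_assoc [symmetric] add.commute)
  have "(\<integral>\<^sup>+u. h u \<partial>noise n) = (\<integral>\<^sup>+u. h u \<partial>distr (noise n \<Otimes>\<^sub>M noise n) (noise n) (mixed_noise n (T ** F) (T ** A1)))"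
    by (simp add: distr_mixed_noise [OF \<open>invertible (T ** F)\<close> BL])
  also have "\<dots> = (\<integral>\<^sup>+p. h (mixed_noise n (T ** F) (T ** A1) p) \<partial>(noise n \<Otimes>\<^sub>M noise n))"
    by (rule nn_integral_distr) measurable
  also have "\<dots> = (\<integral>\<^sup>+a. \<integral>\<^sup>+v. h (mixed_noise n (T ** F) (T ** A1) (v, a)) \<partial>noise n \<partial>noise n)"
    by (rule nn_integral_noise_pair) measurable
  finally show ?thesis by (simp add: 1 mix)
qed

text \<open>The information density \<open>ln (p(y | codewords) / p(y | x'))\<close> of a block, where the output has
  noise \<open>S\<^sup>-\<^sup>1 u\<close> around \<open>x\<close> given the codewords, and \<open>T\<^sup>-\<^sup>1 u\<close> around \<open>x'\<close> otherwise; \<open>c\<close> is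
  \<open>ln |det S / det T|\<close>.\<close>

definition block_info :: "nat \<Rightarrow> real \<Rightarrow> real^'n^'n \<Rightarrow> real^'n^'n \<Rightarrow> (nat \<Rightarrow> real^'n) \<Rightarrow> (nat \<Rightarrow> real^'n) \<Rightarrow> (nat \<Rightarrow> real^'n) \<Rightarrow> real" where
  "block_info n c S T x x' y = real n * c - (\<Sum>j<n. (norm (S *v (y j - x j)))\<^sup>2) / 2 + (\<Sum>j<n. (norm (T *v (y j - x' j)))\<^sup>2) / 2"

text \<open>For the true codewords the two quadratic sums are chi-square variables with the same
  mean, which cancels, so the information density has mean \<open>n * c\<close>. A shortfall of
  \<open>n * \<delta>\<close> forces one of them to deviate by \<open>n * \<delta>\<close>:
  Chebyshev's inequality before expectations are taken.\<close>

lemma atypical_le_chi2_dev: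
  fixes S T :: "real^'n^'n"
  assumes "0 < \<delta>" "0 < n"
  shows "of_bool (block_info n c S T x x' y \<le> real n * (c - \<delta>)) \<le> ennreal (1 / (real n * \<delta>)\<^sup>2) *
    (chi2_dev n (\<lambda>j\<in>{..<n}. S *v (y j - x j)) + chi2_dev n (\<lambda>j\<in>{..<n}. T *v (y j - x' j)))"
proof (cases "block_info n c S T x x' y \<le> real n * (c - \<delta>)")
  case True
  define s where "s = (\<Sum>j<n. (norm (S *v (y j - x j)))\<^sup>2) - real n * real CARD('n)"
  define t where "t = (\<Sum>j<n. (norm (T *v (y j - x' j)))\<^sup>2) - real n * real CARD('n)"
  have nd: "0 < real n * \<delta>" using assms by simp
  from True have "2 * (real n * \<delta>) \<le> s - t"
    by (simp add: block_info_def s_def t_def algebra_simps)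
  then have "real n * \<delta> \<le> s \<or> real n * \<delta> \<le> - t" by linarith
  then have "(real n * \<delta>)\<^sup>2 \<le> s\<^sup>2 \<or> (real n * \<delta>)\<^sup>2 \<le> (- t)\<^sup>2"
    using nd by (meson less_imp_le power_mono)
  then have "(real n * \<delta>)\<^sup>2 \<le> s\<^sup>2 + t\<^sup>2" by (smt (verit) power2_minus zero_le_power2)
  then have "1 \<le> 1 / (real n * \<delta>)\<^sup>2 * (s\<^sup>2 + t\<^sup>2)"
    using zero_less_power [OF nd, of 2] by (simp add: pos_le_divide_eq)
  then have "ennreal 1 \<le> ennreal (1 / (real n * \<delta>)\<^sup>2 * (s\<^sup>2 + t\<^sup>2))" by (rule ennreal_leI)
  also have "\<dots> = ennreal (1 / (real n * \<delta>)\<^sup>2) * (ennreal (s\<^sup>2) + ennreal (t\<^sup>2))"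
    by (simp add: ennreal_mult'' [symmetric] ennreal_plus [symmetric] del: ennreal_plus)
  finally show ?thesis using True by (simp add: chi2_dev_def s_def t_def)
qed simp

text \<open>Reads the information density as a likelihood ratio in \<open>T *v (y j - x' j)\<close>,
  which is standard noise when the tested codewords are independent of the output. Its exponential
  then has mean 1 for a wrong codeword, and Markov's inequality bounds the chance of passing the
  threshold.\<close>

lemma exp_block_info:
  fixes S T E :: "real^'n^'n"
  assumes "E ** T = mat 1" "c = ln \<bar>det (S ** E)\<bar>"
  shows "exp (block_info n c S T x x' y) = exp (\<Sum>j<n. log_ratio (S ** E) (S *v (x' j - x j)) (T *v (y j - x' j)))"
proof -
  have ET: "E *v (T *v v) = v" for v by (simp add: matrix_vector_mul_assoc assms)
  have "(S ** E) *v (T *v (y j - x' j)) + S *v (x' j - x j) = S *v (y j - x j)" for j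
    by (simp add: matrix_vector_mul_assoc [symmetric] ET matrix_vector_right_distrib [symmetric])
  then show ?thesis
    by (simp add: block_info_def log_ratio_def sum.distrib sum_subtractf sum_divide_distrib assms(2))
qed

lemma nn_integral_likelihood:
  fixes K :: "real^'n^'n"
  assumes "invertible K"
  shows "(\<integral>\<^sup>+u. ennreal (exp (\<Sum>j<n. log_ratio K (b j) (u j))) \<partial>noise n) = 1"
proof -
  interpret prob_space "noise n :: (nat \<Rightarrow> real^'n) measure" by (rule prob_space_noise)
  show ?thesis
    using noise_change_of_variables [OF matrix_inv_cancel(1) [OF assms], of "\<lambda>_. 1" n b]
    by (simp add: emeasure_space_1)
qed

lemma borel_measurable_block_info [measurable (raw)]:
  fixes S T :: "real^'n^'n"
  assumes [measurable]: "\<And>j. j < n \<Longrightarrow> (\<lambda>p. x p j) \<in> borel_measurable M"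
    "\<And>j. j < n \<Longrightarrow> (\<lambda>p. x' p j) \<in> borel_measurable M" "\<And>j. j < n \<Longrightarrow> (\<lambda>p. y p j) \<in> borel_measurable M"
  shows "(\<lambda>p. block_info n c S T (x p) (x' p) (y p)) \<in> borel_measurable M"
proof -
  have "(\<lambda>p. \<Sum>j<n. (norm (S *v (y p j - x p j)))\<^sup>2) \<in> borel_measurable M"
    by (intro borel_measurable_sum) (simp add: borel_measurable_matrix_vector_mult')
  moreover have "(\<lambda>p. \<Sum>j<n. (norm (T *v (y p j - x' p j)))\<^sup>2) \<in> borel_measurable M"
    by (intro borel_measurable_sum) (simp add: borel_measurable_matrix_vector_mult')
  ultimately show ?thesis unfolding block_info_def by measurable
qed

lemma nn_integral_noise3:
  fixes F :: "((nat \<Rightarrow> real^'n) \<times> (nat \<Rightarrow> real^'n)) \<times> (nat \<Rightarrow> real^'n) \<Rightarrow> ennreal"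
  assumes [measurable]: "F \<in> borel_measurable ((noise n \<Otimes>\<^sub>M noise n) \<Otimes>\<^sub>M noise n)"
  shows "(\<integral>\<^sup>+a. \<integral>\<^sup>+b. \<integral>\<^sup>+z. F ((a, b), z) \<partial>noise n \<partial>noise n \<partial>noise n) = (\<integral>\<^sup>+p. F p \<partial>((noise n \<Otimes>\<^sub>M noise n) \<Otimes>\<^sub>M noise n))"
proof -
  interpret N: prob_space "noise n :: (nat \<Rightarrow> real^'n) measure" by (rule prob_space_noise)
  have "(\<integral>\<^sup>+a. \<integral>\<^sup>+b. \<integral>\<^sup>+z. F ((a, b), z) \<partial>noise n \<partial>noise n \<partial>noise n)
    = (\<integral>\<^sup>+q. \<integral>\<^sup>+z. F (q, z) \<partial>noise n \<partial>(noise n \<Otimes>\<^sub>M noise n))"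
    by (rule N.nn_integral_fst [where f = "\<lambda>q. \<integral>\<^sup>+z. F (q, z) \<partial>noise n"]) measurable
  also have "\<dots> = (\<integral>\<^sup>+p. F p \<partial>((noise n \<Otimes>\<^sub>M noise n) \<Otimes>\<^sub>M noise n))"
    by (rule N.nn_integral_fst) measurable
  finally show ?thesis .
qed

text \<open>Markov's inequality for \<open>power_penalty\<close> controls the power of the random codebook; if \<open>L = 0\<close>
  and \<open>P = 0\<close>, it vanishes by division by zero.\<close>

definition power_penalty :: "nat \<Rightarrow> real^'n^'n \<Rightarrow> real \<Rightarrow> (nat \<Rightarrow> real^'n) \<Rightarrow> real" where
  "power_penalty n L P a = (((\<Sum>j<n. (norm (L *v a j))\<^sup>2) - real n * (norm L)\<^sup>2) / (real n * (P - (norm L)\<^sup>2)))\<^sup>2"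

definition power_var :: "real^'n^'n \<Rightarrow> real \<Rightarrow> real" where
  "power_var L P = (\<integral>z. ((norm (L *v z))\<^sup>2 - (norm L)\<^sup>2)\<^sup>2 \<partial>std_gaussian) / (P - (norm L)\<^sup>2)\<^sup>2"

lemma borel_measurable_power_penalty [measurable]:
  "power_penalty n L P \<in> borel_measurable (PiM {..<n} (\<lambda>_. borel))" for L :: "real^'n^'n"
  unfolding power_penalty_def [abs_def] by measurable

lemma nn_integral_power_penalty:
  fixes L :: "real^'n^'n"
  assumes "0 < n"
  shows "(\<integral>\<^sup>+a. ennreal (power_penalty n L P a) \<partial>noise n) = ennreal (power_var L P / real n)"
proof -
  define k where "k = 1 / (real n * (P - (norm L)\<^sup>2))\<^sup>2"
  have pk: "power_penalty n L P a = k * ((\<Sum>j<n. (norm (L *v a j))\<^sup>2) - real n * (norm L)\<^sup>2)\<^sup>2" for a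
    by (simp add: power_penalty_def k_def power_divide)
  have k: "0 \<le> k" by (simp add: k_def)
  have "(\<integral>\<^sup>+a. ennreal (power_penalty n L P a) \<partial>noise n)
    = (\<integral>\<^sup>+a. ennreal k * ennreal (((\<Sum>j<n. (norm (L *v a j))\<^sup>2) - real n * (norm L)\<^sup>2)\<^sup>2) \<partial>noise n)"
    by (simp only: pk ennreal_mult' [OF k])
  also have "\<dots> = ennreal k * ennreal (real n * (\<integral>z. ((norm (L *v z))\<^sup>2 - (norm L)\<^sup>2)\<^sup>2 \<partial>std_gaussian))"
    by (subst nn_integral_cmult) (measurable, simp add: noise_power_variance)
  also have "\<dots> = ennreal (power_var L P / real n)"
    using assms by (simp add: ennreal_mult' [symmetric] k_def power_var_def power_mult_distrib power2_eq_square mult_ac)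
  finally show ?thesis .
qed

text \<open>The penalty of a codeword is the square of its normalized excess \<open>d m\<close>, and
  the squared sum of the \<open>d m\<close> is at most \<open>M\<close> times the sum of squares. So
  the mean excess is at most 1, which is the slack \<open>P - (norm L)\<^sup>2\<close>. The case
  \<open>L = 0\<close> stands apart because \<open>P\<close> may then be 0.\<close>

lemma avg_power_codebook:
  fixes L :: "real^'n^'n"
  assumes n: "0 < n" and M: "0 < M" and P: "(norm L)\<^sup>2 < P \<or> L = 0 \<and> 0 \<le> P"
    and pen: "(\<Sum>m<M. power_penalty n L P (g m)) < real M"
  shows "avg_power n M (\<lambda>m j. L *v g m j) \<le> P"
proof -
  define s where "s m = (\<Sum>j<n. (norm (L *v g m j))\<^sup>2)" for m
  have ap: "avg_power n M (\<lambda>m j. L *v g m j) = (\<Sum>m<M. s m) / (real n * real M)"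
  proof -
    have "avg_power n M (\<lambda>m j. L *v g m j) = (\<Sum>j<n. \<Sum>m<M. (norm (L *v g m j))\<^sup>2) / (real n * real M)"
      using M by (simp add: avg_power_def integral_pmf_of_set lessThan_empty_iff sum_divide_distrib mult_ac)
    then show ?thesis by (simp add: s_def sum.swap [of _ "{..<n}"])
  qed
  show ?thesis
  proof (cases "L = 0")
    case True
    then have "s m = 0" for m by (simp add: s_def)
    then show ?thesis unfolding ap using P True by auto
  next
    case False
    then have lt: "(norm L)\<^sup>2 < P" using P by blast
    define D where "D = real n * (P - (norm L)\<^sup>2)"
    have D: "0 < D" using n lt by (simp add: D_def)
    define d where "d m = (s m - real n * (norm L)\<^sup>2) / D" for m
    have "(\<Sum>m<M. d m)\<^sup>2 \<le> (\<Sum>m<M. (d m)\<^sup>2) * real M"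
      using sum_squared_le_sum_of_squares [of d "{..<M}"] by simp
    also have "(\<Sum>m<M. (d m)\<^sup>2) = (\<Sum>m<M. power_penalty n L P (g m))"
      by (simp add: d_def s_def D_def power_penalty_def)
    also have "\<dots> * real M \<le> (real M)\<^sup>2"
      using pen M by (simp add: power2_eq_square)
    finally have "(\<Sum>m<M. d m) \<le> real M"
      by (rule power2_le_imp_le) simp
    then have "(\<Sum>m<M. s m) - real M * (real n * (norm L)\<^sup>2) \<le> real M * D"
      using D by (simp add: d_def sum_divide_distrib [symmetric] sum_subtractf pos_divide_le_eq)
    then have "(\<Sum>m<M. s m) \<le> P * (real n * real M)"
      by (simp add: D_def algebra_simps)
    then show ?thesis using n M by (simp add: ap pos_divide_le_eq)
  qed
qed

text \<open>Union bound over the wrong messages, with \<open>e m'\<close> standing for an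
  exponential that dominates the indicator of passing the threshold.\<close>

lemma of_bool_decoder_error_le:
  assumes m: "m < M" and T: "\<And>m' y. T m' y \<Longrightarrow> 1 \<le> (e m' y :: ennreal)"
  shows "of_bool (threshold_decoder M T y \<noteq> m) \<le> of_bool (\<not> T m y) + (\<Sum>m'\<in>{..<M} - {m}. e m' y)"
proof (cases "threshold_decoder M T y = m")
  case False
  from threshold_decoder_wrong [OF m False]
  show ?thesis
  proof
    assume "\<not> T m y"
    then show ?thesis using False by simp
  next
    assume "\<exists>m'\<in>{..<M} - {m}. T m' y"
    then obtain m' where m': "m' \<in> {..<M} - {m}" "T m' y" by blast
    have "1 \<le> e m' y" by (rule T) (rule m')
    also have "\<dots> \<le> (\<Sum>m'\<in>{..<M} - {m}. e m' y)" using m' by (intro member_le_sum) auto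
    finally show ?thesis using False by (simp add: add_increasing)
  qed
qed simp

text \<open>The errors of both receivers and the power penalties are averaged together: the total
  stays below \<open>\<epsilon> \<le> 1\<close>, so one pair of codebooks has few errors and also
  meets both power constraints. In \<open>K\<close>, the 6 counts two chi-square deviations for each
  of three information densities; the exponentials account for wrong codewords.\<close>

lemma random_code_exists:
  fixes H1 H2 H3 H4 L1 L2 E1 E2 E3 E4 :: "real^'n^'n"
  assumes n: "0 < n" and M: "0 < M1" "0 < M2" and \<delta>: "0 < \<delta>"
    and E1: "invertible E1" "E1 ** transpose E1 = mat 1 + (H1 ** L1) ** transpose (H1 ** L1) + (H2 ** L2) ** transpose (H2 ** L2)"
    and E2: "invertible E2" "E2 ** transpose E2 = mat 1 + (H2 ** L2) ** transpose (H2 ** L2)"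
    and E3: "invertible E3" "E3 ** transpose E3 = mat 1 + (H3 ** L1) ** transpose (H3 ** L1) + (H4 ** L2) ** transpose (H4 ** L2)"
    and E4: "invertible E4" "E4 ** transpose E4 = mat 1 + (H4 ** L2) ** transpose (H4 ** L2)"
    and P1: "(norm L1)\<^sup>2 < P1 \<or> L1 = 0 \<and> 0 \<le> P1" and P2: "(norm L2)\<^sup>2 < P2 \<or> L2 = 0 \<and> 0 \<le> P2"
    and c1: "c1 = ln \<bar>det E1\<bar> - ln \<bar>det E2\<bar>" and c2: "c2 = ln \<bar>det E4\<bar>" and c3: "c3 = ln \<bar>det E3\<bar>"
    and K: "K = 6 * chi2_var TYPE('n) / \<delta>\<^sup>2 + power_var L1 P1 + power_var L2 P2"
    and \<epsilon>: "K / real n + real (M1 - 1) * exp (- real n * (c1 - \<delta>)) + real (M2 - 1) * exp (- real n * (c2 - \<delta>))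
        + real (M1 - 1) * real (M2 - 1) * exp (- real n * (c3 - \<delta>)) < \<epsilon>" "\<epsilon> \<le> 1"
  shows "\<exists>x1 x2 d1 d2. d1 \<in> PiM {..<n} (\<lambda>_. borel) \<rightarrow>\<^sub>M count_space {..<M1} \<and> d2 \<in> PiM {..<n} (\<lambda>_. borel) \<rightarrow>\<^sub>M count_space {..<M2} \<and>
    avg_power n M1 x1 \<le> P1 \<and> avg_power n M2 x2 \<le> P2 \<and>
    error_sum H1 H2 n M1 M2 x1 x2 d1 fst + error_sum H3 H4 n M1 M2 x1 x2 d2 snd < real M1 * real M2 * \<epsilon>"
proof -
  let ?N = "noise n :: (nat \<Rightarrow> real^'n) measure"
  interpret N: prob_space ?N by (rule prob_space_noise)
  interpret NN: pair_prob_space ?N ?N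
    by (intro pair_prob_space.intro pair_sigma_finite.intro prob_space_imp_sigma_finite prob_space_noise)
  define A1 A2 A3 A4 where "A1 = H1 ** L1" and "A2 = H2 ** L2" and "A3 = H3 ** L1" and "A4 = H4 ** L2"
  define T1 T2 T3 T4 where "T1 = matrix_inv E1" and "T2 = matrix_inv E2" and "T3 = matrix_inv E3" and "T4 = matrix_inv E4"
  have T1: "T1 ** E1 = mat 1" "E1 ** T1 = mat 1" using matrix_inv_cancel [OF E1(1)] by (simp_all add: T1_def)
  have T2: "T2 ** E2 = mat 1" "E2 ** T2 = mat 1" using matrix_inv_cancel [OF E2(1)] by (simp_all add: T2_def)
  have T3: "T3 ** E3 = mat 1" "E3 ** T3 = mat 1" using matrix_inv_cancel [OF E3(1)] by (simp_all add: T3_def)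
  have T4: "T4 ** E4 = mat 1" "E4 ** T4 = mat 1" using matrix_inv_cancel [OF E4(1)] by (simp_all add: T4_def)
  note EE = E1(2) [folded A1_def A2_def] E2(2) [folded A2_def] E3(2) [folded A3_def A4_def] E4(2) [folded A4_def]
  define y1 y2 where "y1 a b z j = A1 *v a j + A2 *v b j + z j" and "y2 a b z j = A3 *v a j + A4 *v b j + z j"
    for a b z :: "nat \<Rightarrow> real^'n" and j
  \<comment> \<open>\<open>i1\<close> tests the first codeword against interference plus noise,
    whitened by \<open>T2\<close>; \<open>i2\<close> tests the second codeword with the first one
    known; \<open>i3\<close> tests the pair at receiver 2.\<close>
  define i1 where "i1 a' y = block_info n c1 T2 T1 (\<lambda>j. A1 *v a' j) (\<lambda>_. 0) y" for a' y
  define i2 where "i2 a b' y = block_info n c2 (mat 1) T4 (\<lambda>j. A3 *v a j + A4 *v b' j) (\<lambda>j. A3 *v a j) y" for a b' y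
  define i3 where "i3 a' b' y = block_info n c3 (mat 1) T3 (\<lambda>j. A3 *v a' j + A4 *v b' j) (\<lambda>_. 0) y" for a' b' y
  define t1 t2 t3 where "t1 = real n * (c1 - \<delta>)" and "t2 = real n * (c2 - \<delta>)" and "t3 = real n * (c3 - \<delta>)"
  define bad where "bad p = (of_bool (i1 (fst (fst p)) (y1 (fst (fst p)) (snd (fst p)) (snd p)) \<le> t1)
      + of_bool (i2 (fst (fst p)) (snd (fst p)) (y2 (fst (fst p)) (snd (fst p)) (snd p)) \<le> t2)
      + of_bool (i3 (fst (fst p)) (snd (fst p)) (y2 (fst (fst p)) (snd (fst p)) (snd p)) \<le> t3) :: ennreal)" for p
  define f0 where "f0 p = (\<integral>\<^sup>+z. bad (p, z) \<partial>?N) + (ennreal (power_penalty n L1 P1 (fst p)) + ennreal (power_penalty n L2 P2 (snd p)))" for p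
  define f1 where "f1 p = (\<integral>\<^sup>+z. ennreal (exp (i1 (fst (fst p)) (y1 (snd (fst p)) (snd p) z) - t1)) \<partial>?N)" for p
  define f2 where "f2 p = (\<integral>\<^sup>+z. ennreal (exp (i2 (snd p) (fst (fst p)) (y2 (snd p) (snd (fst p)) z) - t2)) \<partial>?N)" for p
  define f12 where "f12 p = (\<integral>\<^sup>+z. ennreal (exp (i3 (fst (fst p)) (fst (snd p)) (y2 (snd (fst p)) (snd (snd p)) z) - t3)) \<partial>?N)" for p
  have mi1: "(\<lambda>p. i1 (a p) (y p)) \<in> borel_measurable Q"
    if [measurable]: "\<And>j. j < n \<Longrightarrow> (\<lambda>p. a p j) \<in> borel_measurable Q" "\<And>j. j < n \<Longrightarrow> (\<lambda>p. y p j) \<in> borel_measurable Q"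
    for Q :: "'q measure" and a y
    unfolding i1_def
    by (rule borel_measurable_block_info; simp add: that borel_measurable_matrix_vector_mult')
  have mi: "(\<lambda>p. i2 (a p) (b p) (y p)) \<in> borel_measurable Q" "(\<lambda>p. i3 (a p) (b p) (y p)) \<in> borel_measurable Q"
    if [measurable]: "\<And>j. j < n \<Longrightarrow> (\<lambda>p. a p j) \<in> borel_measurable Q" "\<And>j. j < n \<Longrightarrow> (\<lambda>p. b p j) \<in> borel_measurable Q"
      "\<And>j. j < n \<Longrightarrow> (\<lambda>p. y p j) \<in> borel_measurable Q"
    for Q :: "'q measure" and a b y
    unfolding i2_def i3_def
    by (rule borel_measurable_block_info; simp add: that borel_measurable_matrix_vector_mult' borel_measurable_add)+
  let ?N3 = "(?N \<Otimes>\<^sub>M ?N) \<Otimes>\<^sub>M ?N"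
  have my: "(\<lambda>p. y1 (a p) (b p) (z p) j) \<in> borel_measurable Q" "(\<lambda>p. y2 (a p) (b p) (z p) j) \<in> borel_measurable Q"
    if [measurable]: "(\<lambda>p. a p j) \<in> borel_measurable Q" "(\<lambda>p. b p j) \<in> borel_measurable Q" "(\<lambda>p. z p j) \<in> borel_measurable Q"
    for Q :: "'q measure" and a b z j
    unfolding y1_def y2_def by measurable
  have comp [measurable]: "(\<lambda>a. a j) \<in> ?N \<rightarrow>\<^sub>M borel" if "j < n" for j
    using that by (simp add: noise_def)
  have cN: "(\<lambda>p. f p j) \<in> Q \<rightarrow>\<^sub>M borel" if "f \<in> Q \<rightarrow>\<^sub>M ?N" "j < n" for f j and Q :: "'q measure"
    by (rule measurable_compose [OF that(1) comp [OF that(2)]])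
  have mY1: "(\<lambda>p. i1 (a' p) (y1 (a p) (b p) (z p))) \<in> borel_measurable Q"
    if "a' \<in> Q \<rightarrow>\<^sub>M ?N" "a \<in> Q \<rightarrow>\<^sub>M ?N" "b \<in> Q \<rightarrow>\<^sub>M ?N" "z \<in> Q \<rightarrow>\<^sub>M ?N" for Q :: "'q measure" and a' a b z
    by (intro mi1 my cN that)
  have mY2: "(\<lambda>p. i2 (a p) (b' p) (y2 (a p) (b p) (z p))) \<in> borel_measurable Q"
    if "a \<in> Q \<rightarrow>\<^sub>M ?N" "b' \<in> Q \<rightarrow>\<^sub>M ?N" "b \<in> Q \<rightarrow>\<^sub>M ?N" "z \<in> Q \<rightarrow>\<^sub>M ?N" for Q :: "'q measure" and b' a b z
    by (intro mi my cN that)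
  have mY3: "(\<lambda>p. i3 (a' p) (b' p) (y2 (a p) (b p) (z p))) \<in> borel_measurable Q"
    if "a' \<in> Q \<rightarrow>\<^sub>M ?N" "b' \<in> Q \<rightarrow>\<^sub>M ?N" "a \<in> Q \<rightarrow>\<^sub>M ?N" "b \<in> Q \<rightarrow>\<^sub>M ?N" "z \<in> Q \<rightarrow>\<^sub>M ?N" for Q :: "'q measure" and a' b' a b z
    by (intro mi my cN that)
  have mbad [measurable]: "bad \<in> borel_measurable ?N3"
  proof -
    have [measurable]: "(\<lambda>p. i1 (fst (fst p)) (y1 (fst (fst p)) (snd (fst p)) (snd p))) \<in> borel_measurable ?N3"
      by (rule mY1; measurable)
    have [measurable]: "(\<lambda>p. i2 (fst (fst p)) (snd (fst p)) (y2 (fst (fst p)) (snd (fst p)) (snd p))) \<in> borel_measurable ?N3"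
      by (rule mY2; measurable)
    have [measurable]: "(\<lambda>p. i3 (fst (fst p)) (snd (fst p)) (y2 (fst (fst p)) (snd (fst p)) (snd p))) \<in> borel_measurable ?N3"
      by (rule mY3; measurable)
    show ?thesis unfolding bad_def [abs_def] by measurable
  qed
  have mexp: "(\<lambda>p. ennreal (exp (f p - t))) \<in> borel_measurable Q" if [measurable]: "f \<in> borel_measurable Q"
    for Q :: "'q measure" and f t by measurable
  note mf = mexp [OF mY1] mexp [OF mY2] mexp [OF mY3]
  have [measurable]: "f0 \<in> borel_measurable (?N \<Otimes>\<^sub>M ?N)"
    unfolding f0_def [abs_def] by measurable
  have [measurable]: "f1 \<in> borel_measurable ((?N \<Otimes>\<^sub>M ?N) \<Otimes>\<^sub>M ?N)"
    unfolding f1_def [abs_def]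
    by (rule N.borel_measurable_nn_integral, unfold split_beta') (rule mf; measurable)
  have [measurable]: "f2 \<in> borel_measurable ((?N \<Otimes>\<^sub>M ?N) \<Otimes>\<^sub>M ?N)"
    unfolding f2_def [abs_def]
    by (rule N.borel_measurable_nn_integral, unfold split_beta') (rule mf; measurable)
  have [measurable]: "f12 \<in> borel_measurable ((?N \<Otimes>\<^sub>M ?N) \<Otimes>\<^sub>M (?N \<Otimes>\<^sub>M ?N))"
    unfolding f12_def [abs_def]
    by (rule N.borel_measurable_nn_integral, unfold split_beta') (rule mf; measurable)
  have b0: "(\<integral>\<^sup>+a. \<integral>\<^sup>+b. f0 (a, b) \<partial>?N \<partial>?N) \<le> ennreal (K / real n)"
  proof -
    define V where "V = ennreal (real n * chi2_var TYPE('n))"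
    define \<kappa> where "\<kappa> = ennreal (1 / (real n * \<delta>)\<^sup>2)"
    have Vnn: "0 \<le> chi2_var TYPE('n)" unfolding chi2_var_def by (rule integral_nonneg_AE) simp
    define u1 u2 u3 u4 u6
      where "u1 p = (\<lambda>j\<in>{..<n}. T2 *v (A2 *v snd (fst p) j + snd p j))"
        and "u2 p = (\<lambda>j\<in>{..<n}. T1 *v (A1 *v fst (fst p) j + A2 *v snd (fst p) j + snd p j))"
        and "u3 p = (\<lambda>j\<in>{..<n}. snd p j)"
        and "u4 p = (\<lambda>j\<in>{..<n}. T4 *v (A4 *v snd (fst p) j + snd p j))"
        and "u6 p = (\<lambda>j\<in>{..<n}. T3 *v (A3 *v fst (fst p) j + A4 *v snd (fst p) j + snd p j))"
      for p :: "((nat \<Rightarrow> real^'n) \<times> (nat \<Rightarrow> real^'n)) \<times> (nat \<Rightarrow> real^'n)"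
    have [measurable]: "u1 \<in> ?N3 \<rightarrow>\<^sub>M PiM {..<n} (\<lambda>_. borel)" "u2 \<in> ?N3 \<rightarrow>\<^sub>M PiM {..<n} (\<lambda>_. borel)"
      "u3 \<in> ?N3 \<rightarrow>\<^sub>M PiM {..<n} (\<lambda>_. borel)" "u4 \<in> ?N3 \<rightarrow>\<^sub>M PiM {..<n} (\<lambda>_. borel)" "u6 \<in> ?N3 \<rightarrow>\<^sub>M PiM {..<n} (\<lambda>_. borel)"
      unfolding u1_def [abs_def] u2_def [abs_def] u3_def [abs_def] u4_def [abs_def] u6_def [abs_def] by measurable
    have V1: "(\<integral>\<^sup>+p. chi2_dev n (u1 p) \<partial>?N3) = V"
      by (subst nn_integral_noise3 [symmetric], measurable)
         (simp add: u1_def nn_integral_Gaussian_sum2 [OF T2(1) EE(2)] nn_integral_chi2_dev V_def N.emeasure_space_1)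
    have V2: "(\<integral>\<^sup>+p. chi2_dev n (u2 p) \<partial>?N3) = V"
      by (subst nn_integral_noise3 [symmetric], measurable)
         (simp add: u2_def nn_integral_Gaussian_sum3 [OF T1(1) EE(1)] nn_integral_chi2_dev V_def)
    have V3: "(\<integral>\<^sup>+p. chi2_dev n (u3 p) \<partial>?N3) = V"
    proof (subst nn_integral_noise3 [symmetric])
      have "chi2_dev n (\<lambda>j\<in>{..<n}. z j) = chi2_dev n z" for z :: "nat \<Rightarrow> real^'n"
        by (simp add: chi2_dev_def)
      then show "(\<integral>\<^sup>+a. \<integral>\<^sup>+b. \<integral>\<^sup>+z. chi2_dev n (u3 ((a, b), z)) \<partial>?N \<partial>?N \<partial>?N) = V"
        by (simp add: u3_def nn_integral_chi2_dev V_def N.emeasure_space_1)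
    qed measurable
    have V4: "(\<integral>\<^sup>+p. chi2_dev n (u4 p) \<partial>?N3) = V"
      by (subst nn_integral_noise3 [symmetric], measurable)
         (simp add: u4_def nn_integral_Gaussian_sum2 [OF T4(1) EE(4)] nn_integral_chi2_dev V_def N.emeasure_space_1)
    have V6: "(\<integral>\<^sup>+p. chi2_dev n (u6 p) \<partial>?N3) = V"
      by (subst nn_integral_noise3 [symmetric], measurable)
         (simp add: u6_def nn_integral_Gaussian_sum3 [OF T3(1) EE(3)] nn_integral_chi2_dev V_def)
    have bad_le: "bad p \<le> \<kappa> * (chi2_dev n (u1 p) + chi2_dev n (u2 p)) + \<kappa> * (chi2_dev n (u3 p) + chi2_dev n (u4 p))
        + \<kappa> * (chi2_dev n (u3 p) + chi2_dev n (u6 p))" for p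
    proof -
      have "of_bool (i1 (fst (fst p)) (y1 (fst (fst p)) (snd (fst p)) (snd p)) \<le> t1) \<le> \<kappa> * (chi2_dev n (u1 p) + chi2_dev n (u2 p))"
        using atypical_le_chi2_dev [OF \<delta> n, of c1 T2 T1 "\<lambda>j. A1 *v fst (fst p) j" "\<lambda>_. 0"
            "y1 (fst (fst p)) (snd (fst p)) (snd p)"]
        by (simp add: i1_def t1_def \<kappa>_def u1_def u2_def y1_def add.assoc)
      moreover have "of_bool (i2 (fst (fst p)) (snd (fst p)) (y2 (fst (fst p)) (snd (fst p)) (snd p)) \<le> t2)
          \<le> \<kappa> * (chi2_dev n (u3 p) + chi2_dev n (u4 p))"
        using atypical_le_chi2_dev [OF \<delta> n, of c2 "mat 1" T4 "\<lambda>j. A3 *v fst (fst p) j + A4 *v snd (fst p) j" "\<lambda>j. A3 *v fst (fst p) j"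
            "y2 (fst (fst p)) (snd (fst p)) (snd p)"]
        by (simp add: i2_def t2_def \<kappa>_def u3_def u4_def y2_def add.assoc)
      moreover have "of_bool (i3 (fst (fst p)) (snd (fst p)) (y2 (fst (fst p)) (snd (fst p)) (snd p)) \<le> t3)
          \<le> \<kappa> * (chi2_dev n (u3 p) + chi2_dev n (u6 p))"
        using atypical_le_chi2_dev [OF \<delta> n, of c3 "mat 1" T3 "\<lambda>j. A3 *v fst (fst p) j + A4 *v snd (fst p) j" "\<lambda>_. 0"
            "y2 (fst (fst p)) (snd (fst p)) (snd p)"]
        by (simp add: i3_def t3_def \<kappa>_def u3_def u6_def y2_def)
      ultimately show ?thesis unfolding bad_def by (intro add_mono)
    qed
    have "(\<integral>\<^sup>+a. \<integral>\<^sup>+b. \<integral>\<^sup>+z. bad ((a, b), z) \<partial>?N \<partial>?N \<partial>?N) = (\<integral>\<^sup>+p. bad p \<partial>?N3)"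
      by (rule nn_integral_noise3) measurable
    also have "\<dots> \<le> (\<integral>\<^sup>+p. \<kappa> * (chi2_dev n (u1 p) + chi2_dev n (u2 p)) + \<kappa> * (chi2_dev n (u3 p) + chi2_dev n (u4 p))
        + \<kappa> * (chi2_dev n (u3 p) + chi2_dev n (u6 p)) \<partial>?N3)"
      by (intro nn_integral_mono bad_le)
    also have "\<dots> = \<kappa> * (V + V) + \<kappa> * (V + V) + \<kappa> * (V + V)"
      by (simp add: nn_integral_add nn_integral_cmult V1 V2 V3 V4 V6)
    also have "\<dots> = ennreal (6 * chi2_var TYPE('n) / (real n * \<delta>\<^sup>2))"
      using n \<delta> Vnn
      by (simp add: V_def \<kappa>_def ennreal_mult' [symmetric] ennreal_plus [symmetric] power_mult_distrib power2_eq_square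
          del: ennreal_plus)
    finally have bad: "(\<integral>\<^sup>+a. \<integral>\<^sup>+b. \<integral>\<^sup>+z. bad ((a, b), z) \<partial>?N \<partial>?N \<partial>?N) \<le> ennreal (6 * chi2_var TYPE('n) / (real n * \<delta>\<^sup>2))" .
    have pv: "0 \<le> power_var L P" for L :: "real^'n^'n" and P
      unfolding power_var_def by (intro divide_nonneg_nonneg integral_nonneg_AE) simp_all
    have "(\<integral>\<^sup>+a. \<integral>\<^sup>+b. f0 (a, b) \<partial>?N \<partial>?N)
      = (\<integral>\<^sup>+a. (\<integral>\<^sup>+b. \<integral>\<^sup>+z. bad ((a, b), z) \<partial>?N \<partial>?N) + (ennreal (power_penalty n L1 P1 a) + ennreal (power_var L2 P2 / real n)) \<partial>?N)"
      by (intro nn_integral_cong, unfold f0_def)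
         (subst nn_integral_add; simp add: nn_integral_add N.emeasure_space_1 nn_integral_power_penalty [OF n])
    also have "\<dots> = (\<integral>\<^sup>+a. \<integral>\<^sup>+b. \<integral>\<^sup>+z. bad ((a, b), z) \<partial>?N \<partial>?N \<partial>?N) + (ennreal (power_var L1 P1 / real n) + ennreal (power_var L2 P2 / real n))"
      by (subst nn_integral_add; simp add: nn_integral_add N.emeasure_space_1 nn_integral_power_penalty [OF n])
    also have "\<dots> \<le> ennreal (6 * chi2_var TYPE('n) / (real n * \<delta>\<^sup>2)) + (ennreal (power_var L1 P1 / real n) + ennreal (power_var L2 P2 / real n))"
      by (intro add_mono bad order_refl)
    also have "\<dots> = ennreal (K / real n)"
      using n Vnn pv by (simp add: K ennreal_plus [symmetric] add_divide_distrib mult.commute del: ennreal_plus)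
    finally show ?thesis .
  qed
  have b1: "(\<integral>\<^sup>+a'. \<integral>\<^sup>+a. \<integral>\<^sup>+b. f1 ((a', a), b) \<partial>?N \<partial>?N \<partial>?N) \<le> ennreal (exp (- t1))"
  proof -
    have "invertible (T2 ** E1)"
      using T2 E1(1) invertible_right_inverse by (intro invertible_mult) blast+
    have d: "c1 = ln \<bar>det (T2 ** E1)\<bar>"
    proof -
      have "0 < \<bar>det T2\<bar>" "0 < \<bar>det E1\<bar>" using \<open>invertible (T2 ** E1)\<close> by (auto simp: invertible_det_nz det_mul)
      then show ?thesis using ln_det_inverse [OF T2(1)] by (simp add: c1 det_mul abs_mult ln_mult_pos)
    qed
    have "(\<integral>\<^sup>+a. \<integral>\<^sup>+b. f1 ((a', a), b) \<partial>?N \<partial>?N) = ennreal (exp (- t1))" for a'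
    proof -
      let ?h = "\<lambda>u. ennreal (exp (- t1)) * ennreal (exp (\<Sum>j<n. log_ratio (T2 ** E1) (T2 *v (0 - A1 *v a' j)) (u j)))"
      have "(\<integral>\<^sup>+a. \<integral>\<^sup>+b. f1 ((a', a), b) \<partial>?N \<partial>?N)
        = (\<integral>\<^sup>+a. \<integral>\<^sup>+b. \<integral>\<^sup>+z. ?h (\<lambda>j\<in>{..<n}. T1 *v (A1 *v a j + A2 *v b j + z j)) \<partial>?N \<partial>?N \<partial>?N)"
        unfolding f1_def i1_def exp_diff
        by (simp add: exp_block_info [OF T1(2) d] y1_def exp_minus divide_inverse ennreal_mult mult.commute)
      also have "\<dots> = (\<integral>\<^sup>+u. ?h u \<partial>?N)"
        by (rule nn_integral_Gaussian_sum3 [OF T1(1) EE(1)]) measurable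
      also have "\<dots> = ennreal (exp (- t1))"
        by (subst nn_integral_cmult) (measurable, simp add: nn_integral_likelihood [OF \<open>invertible (T2 ** E1)\<close>])
      finally show ?thesis .
    qed
    then show ?thesis by (simp add: N.emeasure_space_1)
  qed
  have b2: "(\<integral>\<^sup>+a. \<integral>\<^sup>+b'. \<integral>\<^sup>+b. f2 ((b', b), a) \<partial>?N \<partial>?N \<partial>?N) \<le> ennreal (exp (- t2))"
  proof -
    have d: "c2 = ln \<bar>det (mat 1 ** E4)\<bar>" by (simp add: c2)
    have inv: "invertible (mat 1 ** E4)" using E4(1) by simp
    have "(\<integral>\<^sup>+b. f2 ((b', b), a) \<partial>?N) = ennreal (exp (- t2))" for a b'
    proof -
      let ?h = "\<lambda>u. ennreal (exp (- t2)) * ennreal (exp (\<Sum>j<n. log_ratio (mat 1 ** E4) (mat 1 *v (A3 *v a j - (A3 *v a j + A4 *v b' j))) (u j)))"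
      have "(\<integral>\<^sup>+b. f2 ((b', b), a) \<partial>?N)
        = (\<integral>\<^sup>+b. \<integral>\<^sup>+z. ?h (\<lambda>j\<in>{..<n}. T4 *v (A4 *v b j + z j)) \<partial>?N \<partial>?N)"
        unfolding f2_def i2_def exp_diff exp_block_info [OF T4(2) d]
        by (simp add: y2_def exp_minus divide_inverse ennreal_mult mult.commute add.assoc)
      also have "\<dots> = (\<integral>\<^sup>+u. ?h u \<partial>?N)"
        by (rule nn_integral_Gaussian_sum2 [OF T4(1) EE(4)]) measurable
      also have "\<dots> = ennreal (exp (- t2))"
        by (subst nn_integral_cmult) (measurable, simp only: nn_integral_likelihood [OF inv] mult_1_right)
      finally show ?thesis .
    qed
    then show ?thesis by (simp add: N.emeasure_space_1)
  qed
  have b12: "(\<integral>\<^sup>+a'. \<integral>\<^sup>+a. \<integral>\<^sup>+b'. \<integral>\<^sup>+b. f12 ((a', a), (b', b)) \<partial>?N \<partial>?N \<partial>?N \<partial>?N) \<le> ennreal (exp (- t3))"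
  proof -
    have d: "c3 = ln \<bar>det (mat 1 ** E3)\<bar>" by (simp add: c3)
    have inv: "invertible (mat 1 ** E3)" using E3(1) by simp
    have "(\<integral>\<^sup>+a. \<integral>\<^sup>+b. f12 ((a', a), (b', b)) \<partial>?N \<partial>?N) = ennreal (exp (- t3))" for a' b'
    proof -
      let ?h = "\<lambda>u. ennreal (exp (- t3)) * ennreal (exp (\<Sum>j<n. log_ratio (mat 1 ** E3) (mat 1 *v (0 - (A3 *v a' j + A4 *v b' j))) (u j)))"
      have "(\<integral>\<^sup>+a. \<integral>\<^sup>+b. f12 ((a', a), (b', b)) \<partial>?N \<partial>?N)
        = (\<integral>\<^sup>+a. \<integral>\<^sup>+b. \<integral>\<^sup>+z. ?h (\<lambda>j\<in>{..<n}. T3 *v (A3 *v a j + A4 *v b j + z j)) \<partial>?N \<partial>?N \<partial>?N)"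
        unfolding f12_def i3_def exp_diff exp_block_info [OF T3(2) d]
        by (simp add: y2_def exp_minus divide_inverse ennreal_mult mult.commute)
      also have "\<dots> = (\<integral>\<^sup>+u. ?h u \<partial>?N)"
        by (rule nn_integral_Gaussian_sum3 [OF T3(1) EE(3)]) measurable
      also have "\<dots> = ennreal (exp (- t3))"
        by (subst nn_integral_cmult) (measurable, simp only: nn_integral_likelihood [OF inv] mult_1_right)
      finally show ?thesis .
    qed
    \<comment> \<open>The wrong pair has to stay fixed while the true pair is averaged out, but the
      order of integration in \<open>random_coding\<close> interleaves them.\<close>
    moreover have "(\<integral>\<^sup>+a. \<integral>\<^sup>+b'. \<integral>\<^sup>+b. f12 ((a', a), (b', b)) \<partial>?N \<partial>?N \<partial>?N)
      = (\<integral>\<^sup>+b'. \<integral>\<^sup>+a. \<integral>\<^sup>+b. f12 ((a', a), (b', b)) \<partial>?N \<partial>?N \<partial>?N)" if [measurable]: "a' \<in> space ?N" for a'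
      by (rule NN.Fubini' [symmetric]) measurable
    ultimately show ?thesis by (simp add: N.emeasure_space_1 cong: nn_integral_cong)
  qed
  have "exp (- t1) = exp (- real n * (c1 - \<delta>))" "exp (- t2) = exp (- real n * (c2 - \<delta>))" "exp (- t3) = exp (- real n * (c3 - \<delta>))"
    by (simp_all add: t1_def t2_def t3_def)
  with \<epsilon>(1) have \<epsilon>': "K / real n + real (M1 - 1) * exp (- t1) + real (M2 - 1) * exp (- t2)
        + real (M1 - 1) * real (M2 - 1) * exp (- t3) < \<epsilon>" by simp
  have Knn: "0 \<le> K"
    unfolding K chi2_var_def power_var_def
    by (intro add_nonneg_nonneg divide_nonneg_nonneg mult_nonneg_nonneg integral_nonneg_AE) simp_all
  have pos: "0 \<le> K / real n + real (M1 - 1) * exp (- t1) + real (M2 - 1) * exp (- t2)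
        + real (M1 - 1) * real (M2 - 1) * exp (- t3)"
    using Knn by (intro add_nonneg_nonneg mult_nonneg_nonneg divide_nonneg_nonneg) simp_all
  have less: "ennreal (K / real n) + of_nat (M1 - 1) * ennreal (exp (- t1)) + of_nat (M2 - 1) * ennreal (exp (- t2))
      + of_nat (M1 - 1) * of_nat (M2 - 1) * ennreal (exp (- t3)) < ennreal \<epsilon>"
  proof -
    have "ennreal (K / real n) + of_nat (M1 - 1) * ennreal (exp (- t1)) + of_nat (M2 - 1) * ennreal (exp (- t2))
      + of_nat (M1 - 1) * of_nat (M2 - 1) * ennreal (exp (- t3))
      = ennreal (K / real n + real (M1 - 1) * exp (- t1) + real (M2 - 1) * exp (- t2)
        + real (M1 - 1) * real (M2 - 1) * exp (- t3))"
      using Knn by (simp add: ennreal_plus ennreal_mult ennreal_of_nat_eq_real_of_nat del: of_nat_diff)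
    then show ?thesis using \<epsilon>' pos by (simp add: ennreal_less_iff del: of_nat_diff)
  qed
  from random_coding [OF prob_space_noise M _ _ _ _ b0 b1 b2 b12 less]
  obtain g1 g2 where g1: "g1 \<in> space (PiM {..<M1} (\<lambda>_. ?N))" and g2: "g2 \<in> space (PiM {..<M2} (\<lambda>_. ?N))"
    and U: "(\<Sum>m1<M1. \<Sum>m2<M2. f0 (g1 m1, g2 m2) + (\<Sum>m'\<in>{..<M1} - {m1}. f1 ((g1 m', g1 m1), g2 m2))
        + (\<Sum>m'\<in>{..<M2} - {m2}. f2 ((g2 m', g2 m2), g1 m1))
        + (\<Sum>m1'\<in>{..<M1} - {m1}. \<Sum>m2'\<in>{..<M2} - {m2}. f12 ((g1 m1', g1 m1), (g2 m2', g2 m2))))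
      < of_nat M1 * of_nat M2 * ennreal \<epsilon>"
    by (auto simp: \<open>f0 \<in> _\<close> \<open>f1 \<in> _\<close> \<open>f2 \<in> _\<close> \<open>f12 \<in> _\<close>)
  have gN: "g1 m1 \<in> space ?N" if "m1 < M1" for m1 using g1 that by (auto simp: space_PiM)
  have gN2: "g2 m2 \<in> space ?N" if "m2 < M2" for m2 using g2 that by (auto simp: space_PiM)
  have \<epsilon>0: "0 < \<epsilon>" using \<epsilon>' pos by linarith
  have MM: "of_nat M1 * of_nat M2 * ennreal \<epsilon> = ennreal (real M1 * real M2 * \<epsilon>)"
    using \<epsilon>0 by (simp add: ennreal_mult ennreal_of_nat_eq_real_of_nat)
  define x1 x2 where "x1 m j = L1 *v g1 m j" and "x2 m j = L2 *v g2 m j" for m j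
  \<comment> \<open>A wrong \<open>m2'\<close> passes together with some first message
    \<open>k\<close>. If \<open>k = m1\<close>, only the second codeword is wrong and
    \<open>i2\<close> is charged; otherwise both are wrong and \<open>i3\<close> is charged.\<close>
  define e where "e m1 m2' y = (ennreal (exp (i2 (g1 m1) (g2 m2') y - t2))
      + (\<Sum>m1'\<in>{..<M1} - {m1}. ennreal (exp (i3 (g1 m1') (g2 m2') y - t3))))" for m1 m2' y
  define d1 where "d1 = threshold_decoder M1 (\<lambda>m y. i1 (g1 m) y > t1)"
  \<comment> \<open>The first message is quantified away: a wrong \<open>m1\<close> beside the right
    \<open>m2\<close> is no error at receiver 2, so it costs no rate condition.\<close>
  define d2 where "d2 = threshold_decoder M2 (\<lambda>m2 y. \<exists>m1\<in>{..<M1}. i2 (g1 m1) (g2 m2) y > t2 \<and> i3 (g1 m1) (g2 m2) y > t3)"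
  have md1: "d1 \<in> PiM {..<n} (\<lambda>_. borel) \<rightarrow>\<^sub>M count_space {..<M1}"
    unfolding d1_def
  proof (rule measurable_threshold_decoder [OF _ M(1)])
    fix m
    have [measurable]: "(\<lambda>y. i1 (g1 m) y) \<in> borel_measurable (PiM {..<n} (\<lambda>_. borel))"
      by (rule mi1) simp_all
    show "Measurable.pred (PiM {..<n} (\<lambda>_. borel)) (\<lambda>y. t1 < i1 (g1 m) y)" by measurable
  qed
  have md2: "d2 \<in> PiM {..<n} (\<lambda>_. borel) \<rightarrow>\<^sub>M count_space {..<M2}"
    unfolding d2_def
  proof (rule measurable_threshold_decoder [OF _ M(2)])
    fix m2
    have [measurable]: "(\<lambda>y. i2 (g1 m) (g2 m2) y) \<in> borel_measurable (PiM {..<n} (\<lambda>_. borel))"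
      "(\<lambda>y. i3 (g1 m) (g2 m2) y) \<in> borel_measurable (PiM {..<n} (\<lambda>_. borel))" for m
      by (rule mi; simp)+
    show "Measurable.pred (PiM {..<n} (\<lambda>_. borel)) (\<lambda>y. \<exists>m1\<in>{..<M1}. t2 < i2 (g1 m1) (g2 m2) y \<and> t3 < i3 (g1 m1) (g2 m2) y)"
      by measurable
  qed
  have rec: "i1 a (received n H1 H2 (x1 m1) (x2 m2) z) = i1 a (y1 (g1 m1) (g2 m2) z)"
    "i2 a b (received n H3 H4 (x1 m1) (x2 m2) z) = i2 a b (y2 (g1 m1) (g2 m2) z)"
    "i3 a b (received n H3 H4 (x1 m1) (x2 m2) z) = i3 a b (y2 (g1 m1) (g2 m2) z)" for a b m1 m2 z
    by (simp_all add: i1_def i2_def i3_def block_info_def received_def y1_def y2_def x1_def x2_def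
        A1_def A2_def A3_def A4_def matrix_vector_mul_assoc)
  have err: "ennreal (measure ?N {z \<in> space ?N. d1 (received n H1 H2 (x1 m1) (x2 m2) z) \<noteq> m1}
      + measure ?N {z \<in> space ?N. d2 (received n H3 H4 (x1 m1) (x2 m2) z) \<noteq> m2})
    \<le> (\<integral>\<^sup>+z. bad ((g1 m1, g2 m2), z) \<partial>?N) + (\<Sum>m'\<in>{..<M1} - {m1}. f1 ((g1 m', g1 m1), g2 m2))
        + (\<Sum>m'\<in>{..<M2} - {m2}. f2 ((g2 m', g2 m2), g1 m1))
        + (\<Sum>m1'\<in>{..<M1} - {m1}. \<Sum>m2'\<in>{..<M2} - {m2}. f12 ((g1 m1', g1 m1), (g2 m2', g2 m2)))"
    if m: "m1 < M1" "m2 < M2" for m1 m2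
  proof -
    let ?r1 = "received n H1 H2 (x1 m1) (x2 m2)" and ?r2 = "received n H3 H4 (x1 m1) (x2 m2)"
    have md1' [measurable]: "d1 \<in> PiM {..<n} (\<lambda>_. borel) \<rightarrow>\<^sub>M count_space UNIV"
      using md1 by (rule measurable_compose) simp
    have md2' [measurable]: "d2 \<in> PiM {..<n} (\<lambda>_. borel) \<rightarrow>\<^sub>M count_space UNIV"
      using md2 by (rule measurable_compose) simp
    have em: "ennreal (measure ?N {z \<in> space ?N. Q z}) = (\<integral>\<^sup>+z. of_bool (Q z) \<partial>?N)"
      if [measurable]: "Measurable.pred ?N Q" for Q
    proof -
      have "ennreal (measure ?N {z \<in> space ?N. Q z}) = (\<integral>\<^sup>+z. indicator {z \<in> space ?N. Q z} z \<partial>?N)"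
        by (simp add: N.emeasure_eq_measure)
      also have "\<dots> = (\<integral>\<^sup>+z. of_bool (Q z) \<partial>?N)"
        by (intro nn_integral_cong) (simp add: indicator_def)
      finally show ?thesis .
    qed
    have "of_bool (d1 (?r1 z) \<noteq> m1) + of_bool (d2 (?r2 z) \<noteq> m2)
        \<le> bad ((g1 m1, g2 m2), z) + (\<Sum>m'\<in>{..<M1} - {m1}. ennreal (exp (i1 (g1 m') (y1 (g1 m1) (g2 m2) z) - t1)))
          + (\<Sum>m2'\<in>{..<M2} - {m2}. e m1 m2' (y2 (g1 m1) (g2 m2) z))" for z
    proof -
      have "of_bool (d1 (?r1 z) \<noteq> m1) \<le> of_bool (\<not> i1 (g1 m1) (?r1 z) > t1)
        + (\<Sum>m'\<in>{..<M1} - {m1}. ennreal (exp (i1 (g1 m') (?r1 z) - t1)))"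
        unfolding d1_def
        by (rule of_bool_decoder_error_le [OF m(1), where e = "\<lambda>m' y. ennreal (exp (i1 (g1 m') y - t1))"]) simp
      then have 1: "of_bool (d1 (?r1 z) \<noteq> m1) \<le> of_bool (i1 (g1 m1) (y1 (g1 m1) (g2 m2) z) \<le> t1)
        + (\<Sum>m'\<in>{..<M1} - {m1}. ennreal (exp (i1 (g1 m') (y1 (g1 m1) (g2 m2) z) - t1)))"
        by (simp add: rec not_less)
      have "of_bool (d2 (?r2 z) \<noteq> m2) \<le> of_bool (\<not> (\<exists>m1\<in>{..<M1}. i2 (g1 m1) (g2 m2) (?r2 z) > t2 \<and> i3 (g1 m1) (g2 m2) (?r2 z) > t3))
        + (\<Sum>m2'\<in>{..<M2} - {m2}. e m1 m2' (?r2 z))"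
        unfolding d2_def
      proof (rule of_bool_decoder_error_le [OF m(2), where e = "e m1"])
        fix m2' y assume "\<exists>m1\<in>{..<M1}. i2 (g1 m1) (g2 m2') y > t2 \<and> i3 (g1 m1) (g2 m2') y > t3"
        then obtain k where k: "k < M1" "i2 (g1 k) (g2 m2') y > t2" "i3 (g1 k) (g2 m2') y > t3" by auto
        show "1 \<le> e m1 m2' y"
        proof (cases "k = m1")
          case True
          then have "1 \<le> ennreal (exp (i2 (g1 m1) (g2 m2') y - t2))" using k by simp
          then show ?thesis unfolding e_def by (rule order_trans) simp
        next
          case False
          have "1 \<le> ennreal (exp (i3 (g1 k) (g2 m2') y - t3))" using k by simp
          also have "\<dots> \<le> (\<Sum>m1'\<in>{..<M1} - {m1}. ennreal (exp (i3 (g1 m1') (g2 m2') y - t3)))"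
            using k False by (intro member_le_sum [of k _ "\<lambda>m1'. ennreal (exp (i3 (g1 m1') (g2 m2') y - t3))"]) auto
          finally show ?thesis unfolding e_def by (rule order_trans) simp
        qed
      qed
      also have "of_bool (\<not> (\<exists>m1\<in>{..<M1}. i2 (g1 m1) (g2 m2) (?r2 z) > t2 \<and> i3 (g1 m1) (g2 m2) (?r2 z) > t3))
        \<le> (of_bool (i2 (g1 m1) (g2 m2) (?r2 z) \<le> t2) + of_bool (i3 (g1 m1) (g2 m2) (?r2 z) \<le> t3) :: ennreal)"
        using m(1) by (auto simp: of_bool_def not_less)
      finally have 2: "of_bool (d2 (?r2 z) \<noteq> m2) \<le> (of_bool (i2 (g1 m1) (g2 m2) (y2 (g1 m1) (g2 m2) z) \<le> t2)
          + of_bool (i3 (g1 m1) (g2 m2) (y2 (g1 m1) (g2 m2) z) \<le> t3)) + (\<Sum>m2'\<in>{..<M2} - {m2}. e m1 m2' (y2 (g1 m1) (g2 m2) z))"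
        by (simp add: e_def rec)
      show ?thesis
        using add_mono [OF 1 2] by (simp add: bad_def add_ac)
    qed
    note pointwise = this
    note [measurable] = gN [OF m(1)] gN2 [OF m(2)]
    have bm: "(\<lambda>z. bad ((g1 m1, g2 m2), z)) \<in> borel_measurable ?N" by measurable
    have em1: "(\<lambda>z. ennreal (exp (i1 (g1 m') (y1 (g1 m1) (g2 m2) z) - t1))) \<in> borel_measurable ?N" if "m' \<in> {..<M1} - {m1}" for m'
      using that m by (intro mf measurable_const gN gN2) simp_all
    have em2: "(\<lambda>z. ennreal (exp (i2 (g1 m1) (g2 m') (y2 (g1 m1) (g2 m2) z) - t2))) \<in> borel_measurable ?N" if "m' \<in> {..<M2} - {m2}" for m'
      using that m by (intro mf measurable_const gN gN2) simp_all
    have em3: "(\<lambda>z. ennreal (exp (i3 (g1 m1') (g2 m2') (y2 (g1 m1) (g2 m2) z) - t3))) \<in> borel_measurable ?N"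
      if "m1' \<in> {..<M1} - {m1}" "m2' \<in> {..<M2} - {m2}" for m1' m2'
      using that m by (intro mf measurable_const gN gN2) simp_all
    have "ennreal (measure ?N {z \<in> space ?N. d1 (?r1 z) \<noteq> m1} + measure ?N {z \<in> space ?N. d2 (?r2 z) \<noteq> m2})
      = (\<integral>\<^sup>+z. of_bool (d1 (?r1 z) \<noteq> m1) \<partial>?N) + (\<integral>\<^sup>+z. of_bool (d2 (?r2 z) \<noteq> m2) \<partial>?N)"
      by (simp add: em ennreal_plus)
    also have "\<dots> = (\<integral>\<^sup>+z. of_bool (d1 (?r1 z) \<noteq> m1) + of_bool (d2 (?r2 z) \<noteq> m2) \<partial>?N)"
      by (rule nn_integral_add [symmetric]) measurable
    also have "\<dots> \<le> (\<integral>\<^sup>+z. bad ((g1 m1, g2 m2), z) + (\<Sum>m'\<in>{..<M1} - {m1}. ennreal (exp (i1 (g1 m') (y1 (g1 m1) (g2 m2) z) - t1)))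
          + (\<Sum>m2'\<in>{..<M2} - {m2}. e m1 m2' (y2 (g1 m1) (g2 m2) z)) \<partial>?N)"
      by (intro nn_integral_mono pointwise)
    also have "\<dots> = (\<integral>\<^sup>+z. bad ((g1 m1, g2 m2), z) \<partial>?N) + (\<Sum>m'\<in>{..<M1} - {m1}. f1 ((g1 m', g1 m1), g2 m2))
          + (\<Sum>m2'\<in>{..<M2} - {m2}. \<integral>\<^sup>+z. e m1 m2' (y2 (g1 m1) (g2 m2) z) \<partial>?N)"
    proof -
      have me: "(\<lambda>z. e m1 m2' (y2 (g1 m1) (g2 m2) z)) \<in> borel_measurable ?N" if "m2' \<in> {..<M2} - {m2}" for m2'
        unfolding e_def using that by (intro borel_measurable_add borel_measurable_sum em2 em3)
      have s1: "(\<lambda>z. \<Sum>m'\<in>{..<M1} - {m1}. ennreal (exp (i1 (g1 m') (y1 (g1 m1) (g2 m2) z) - t1))) \<in> borel_measurable ?N"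
        by (intro borel_measurable_sum em1)
      have s2: "(\<lambda>z. \<Sum>m2'\<in>{..<M2} - {m2}. e m1 m2' (y2 (g1 m1) (g2 m2) z)) \<in> borel_measurable ?N"
        by (intro borel_measurable_sum me)
      show ?thesis
        by (simp only: nn_integral_add [OF borel_measurable_add [OF bm s1] s2] nn_integral_add [OF bm s1]
            nn_integral_sum [OF em1] nn_integral_sum [OF me] f1_def fst_conv snd_conv)
    qed
    also have "(\<Sum>m2'\<in>{..<M2} - {m2}. \<integral>\<^sup>+z. e m1 m2' (y2 (g1 m1) (g2 m2) z) \<partial>?N)
      = (\<Sum>m2'\<in>{..<M2} - {m2}. f2 ((g2 m2', g2 m2), g1 m1) + (\<Sum>m1'\<in>{..<M1} - {m1}. f12 ((g1 m1', g1 m1), (g2 m2', g2 m2))))"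
    proof (rule sum.cong [OF refl])
      fix m2' assume m2': "m2' \<in> {..<M2} - {m2}"
      have s3: "(\<lambda>z. \<Sum>m1'\<in>{..<M1} - {m1}. ennreal (exp (i3 (g1 m1') (g2 m2') (y2 (g1 m1) (g2 m2) z) - t3))) \<in> borel_measurable ?N"
        using m2' by (intro borel_measurable_sum em3)
      have n3: "(\<integral>\<^sup>+z. (\<Sum>m1'\<in>{..<M1} - {m1}. ennreal (exp (i3 (g1 m1') (g2 m2') (y2 (g1 m1) (g2 m2) z) - t3))) \<partial>?N)
        = (\<Sum>m1'\<in>{..<M1} - {m1}. \<integral>\<^sup>+z. ennreal (exp (i3 (g1 m1') (g2 m2') (y2 (g1 m1) (g2 m2) z) - t3)) \<partial>?N)"
        by (rule nn_integral_sum) (rule em3 [OF _ m2'])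
      show "(\<integral>\<^sup>+z. e m1 m2' (y2 (g1 m1) (g2 m2) z) \<partial>?N)
        = f2 ((g2 m2', g2 m2), g1 m1) + (\<Sum>m1'\<in>{..<M1} - {m1}. f12 ((g1 m1', g1 m1), (g2 m2', g2 m2)))"
        by (simp only: e_def nn_integral_add [OF em2 [OF m2'] s3] n3 f2_def f12_def fst_conv snd_conv)
    qed
    also have "\<dots> = (\<Sum>m2'\<in>{..<M2} - {m2}. f2 ((g2 m2', g2 m2), g1 m1))
      + (\<Sum>m1'\<in>{..<M1} - {m1}. \<Sum>m2'\<in>{..<M2} - {m2}. f12 ((g1 m1', g1 m1), (g2 m2', g2 m2)))"
      unfolding sum.distrib by (intro arg_cong2 [where f = plus] refl sum.swap)
    finally show ?thesis by (simp add: add.assoc)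
  qed
  define q where "q m1 m2 = power_penalty n L1 P1 (g1 m1) + power_penalty n L2 P2 (g2 m2)" for m1 m2
  define r where "r m1 m2 = measure ?N {z \<in> space ?N. d1 (received n H1 H2 (x1 m1) (x2 m2) z) \<noteq> m1}
      + measure ?N {z \<in> space ?N. d2 (received n H3 H4 (x1 m1) (x2 m2) z) \<noteq> m2}" for m1 m2
  have pp: "0 \<le> power_penalty n L P a" for L :: "real^'n^'n" and P a by (simp add: power_penalty_def)
  have qr: "0 \<le> q m1 m2" "0 \<le> r m1 m2" for m1 m2 by (simp_all add: q_def r_def pp)
  have "ennreal (\<Sum>m1<M1. \<Sum>m2<M2. r m1 m2 + q m1 m2) = (\<Sum>m1<M1. \<Sum>m2<M2. ennreal (r m1 m2) + ennreal (q m1 m2))"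
    using qr by (simp add: sum_nonneg ennreal_plus [symmetric] del: ennreal_plus)
  also have "\<dots> \<le> (\<Sum>m1<M1. \<Sum>m2<M2. f0 (g1 m1, g2 m2) + (\<Sum>m'\<in>{..<M1} - {m1}. f1 ((g1 m', g1 m1), g2 m2))
        + (\<Sum>m'\<in>{..<M2} - {m2}. f2 ((g2 m', g2 m2), g1 m1))
        + (\<Sum>m1'\<in>{..<M1} - {m1}. \<Sum>m2'\<in>{..<M2} - {m2}. f12 ((g1 m1', g1 m1), (g2 m2', g2 m2))))"
  proof (intro sum_mono)
    fix m1 m2 assume "m1 \<in> {..<M1}" "m2 \<in> {..<M2}"
    then have "ennreal (r m1 m2) + ennreal (q m1 m2) \<le> ((\<integral>\<^sup>+z. bad ((g1 m1, g2 m2), z) \<partial>?N) + (\<Sum>m'\<in>{..<M1} - {m1}. f1 ((g1 m', g1 m1), g2 m2))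
        + (\<Sum>m'\<in>{..<M2} - {m2}. f2 ((g2 m', g2 m2), g1 m1))
        + (\<Sum>m1'\<in>{..<M1} - {m1}. \<Sum>m2'\<in>{..<M2} - {m2}. f12 ((g1 m1', g1 m1), (g2 m2', g2 m2)))) + ennreal (q m1 m2)"
      unfolding r_def by (intro add_mono err order_refl) simp_all
    also have "\<dots> = f0 (g1 m1, g2 m2) + (\<Sum>m'\<in>{..<M1} - {m1}. f1 ((g1 m', g1 m1), g2 m2))
        + (\<Sum>m'\<in>{..<M2} - {m2}. f2 ((g2 m', g2 m2), g1 m1))
        + (\<Sum>m1'\<in>{..<M1} - {m1}. \<Sum>m2'\<in>{..<M2} - {m2}. f12 ((g1 m1', g1 m1), (g2 m2', g2 m2)))"
      by (simp only: q_def ennreal_plus [OF pp pp] f0_def fst_conv snd_conv add_ac)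
    finally show "ennreal (r m1 m2) + ennreal (q m1 m2) \<le> f0 (g1 m1, g2 m2) + (\<Sum>m'\<in>{..<M1} - {m1}. f1 ((g1 m', g1 m1), g2 m2))
        + (\<Sum>m'\<in>{..<M2} - {m2}. f2 ((g2 m', g2 m2), g1 m1))
        + (\<Sum>m1'\<in>{..<M1} - {m1}. \<Sum>m2'\<in>{..<M2} - {m2}. f12 ((g1 m1', g1 m1), (g2 m2', g2 m2)))" .
  qed
  also have "\<dots> < ennreal (real M1 * real M2 * \<epsilon>)" using U unfolding MM .
  finally have tot: "(\<Sum>m1<M1. \<Sum>m2<M2. r m1 m2) + (\<Sum>m1<M1. \<Sum>m2<M2. q m1 m2) < real M1 * real M2 * \<epsilon>"
    using qr by (subst (asm) ennreal_less_iff) (simp_all add: sum_nonneg sum.distrib)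
  have rn: "0 \<le> (\<Sum>m1<M1. \<Sum>m2<M2. r m1 m2)" and qn: "0 \<le> (\<Sum>m1<M1. \<Sum>m2<M2. q m1 m2)"
    using qr by (intro sum_nonneg; simp)+
  have qsum: "(\<Sum>m1<M1. \<Sum>m2<M2. q m1 m2) = real M2 * (\<Sum>m<M1. power_penalty n L1 P1 (g1 m)) + real M1 * (\<Sum>m<M2. power_penalty n L2 P2 (g2 m))"
    by (simp add: q_def sum.distrib sum_distrib_left)
  \<comment> \<open>As \<open>\<epsilon> \<le> 1\<close>, the combined total is below
    \<open>M1 * M2\<close>, so each average penalty is below 1, as \<open>avg_power_codebook\<close>
    demands.\<close>
  have \<epsilon>M: "real M1 * real M2 * \<epsilon> \<le> real M1 * real M2" using \<epsilon>(2) by (simp add: mult_left_le)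
  have pn: "0 \<le> (\<Sum>m<M. power_penalty n L P (g m))" for M and L :: "real^'n^'n" and P g by (intro sum_nonneg pp)
  have "real M2 * (\<Sum>m<M1. power_penalty n L1 P1 (g1 m)) < real M2 * real M1"
    using tot rn qsum \<epsilon>M mult_nonneg_nonneg [OF of_nat_0_le_iff pn, of M1 L2 P2 g2 M2] by (simp add: mult.commute)
  then have "(\<Sum>m<M1. power_penalty n L1 P1 (g1 m)) < real M1" using M by simp
  then have pow1: "avg_power n M1 x1 \<le> P1"
    using avg_power_codebook [OF n M(1) P1, of g1] by (simp add: x1_def [abs_def])
  have "real M1 * (\<Sum>m<M2. power_penalty n L2 P2 (g2 m)) < real M1 * real M2"
    using tot rn qsum \<epsilon>M mult_nonneg_nonneg [OF of_nat_0_le_iff pn, of M2 L1 P1 g1 M1] by (simp add: mult.commute)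
  then have "(\<Sum>m<M2. power_penalty n L2 P2 (g2 m)) < real M2" using M by simp
  then have pow2: "avg_power n M2 x2 \<le> P2"
    using avg_power_codebook [OF n M(2) P2, of g2] by (simp add: x2_def [abs_def])
  have "error_sum H1 H2 n M1 M2 x1 x2 d1 fst + error_sum H3 H4 n M1 M2 x1 x2 d2 snd = (\<Sum>m1<M1. \<Sum>m2<M2. r m1 m2)"
    unfolding error_sum_def r_def by (simp add: sum.cartesian_product' sum.distrib)
  then have "error_sum H1 H2 n M1 M2 x1 x2 d1 fst + error_sum H3 H4 n M1 M2 x1 x2 d2 snd < real M1 * real M2 * \<epsilon>"
    using tot qn by simp
  with md1 md2 pow1 pow2 show ?thesis by blast
qed

section \<open>The capacity\<close>

lemma measure_uniform_pair:
  fixes Q :: "'s::countable \<Rightarrow> 'z \<Rightarrow> bool"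
  assumes S: "finite S" "S \<noteq> {}" and N: "prob_space N" and Q: "\<And>s. Measurable.pred N (Q s)"
  shows "measure (measure_pmf (pmf_of_set S) \<Otimes>\<^sub>M N) {x \<in> space (measure_pmf (pmf_of_set S) \<Otimes>\<^sub>M N). Q (fst x) (snd x)}
    = (\<Sum>s\<in>S. measure N {z \<in> space N. Q s z}) / real (card S)"
proof -
  let ?P = "measure_pmf (pmf_of_set S) \<Otimes>\<^sub>M N"
  interpret N: prob_space N by fact
  interpret P: prob_space ?P by (intro prob_space_pair measure_pmf.prob_space_axioms N)
  have "Measurable.pred (count_space UNIV \<Otimes>\<^sub>M N) (\<lambda>x. Q (fst x) (snd x))"
    by (rule measurable_pair_measure_countable1) (use Q in simp_all)
  then have Q' [measurable]: "Measurable.pred ?P (\<lambda>x. Q (fst x) (snd x))"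
    by (simp cong: measurable_cong_sets sets_pair_measure_cong)
  have A: "{x \<in> space ?P. Q (fst x) (snd x)} \<in> sets ?P" by measurable
  have "emeasure ?P {x \<in> space ?P. Q (fst x) (snd x)} = (\<integral>\<^sup>+s. emeasure N {z \<in> space N. Q s z} \<partial>measure_pmf (pmf_of_set S))"
    by (subst N.emeasure_pair_measure_alt [OF A])
       (intro nn_integral_cong arg_cong2 [where f = emeasure] refl, auto simp: space_pair_measure)
  also have "\<dots> = (\<Sum>s\<in>S. emeasure N {z \<in> space N. Q s z}) / of_nat (card S)"
    by (rule nn_integral_pmf_of_set [OF S(2,1)])
  also have "\<dots> = ennreal ((\<Sum>s\<in>S. measure N {z \<in> space N. Q s z}) / real (card S))"
    using S by (simp add: N.emeasure_eq_measure sum_nonneg divide_ennreal card_gt_0_iff ennreal_of_nat_eq_real_of_nat)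
  finally show ?thesis
    by (subst (asm) P.emeasure_eq_measure) (simp add: sum_nonneg)
qed

lemma num_msgs_pos: "0 < num_msgs n R"
  by (simp add: num_msgs_def)

lemma num_msgs_ge: "exp (real n * R) \<le> real (num_msgs n R)"
  unfolding num_msgs_def by (rule real_nat_ceiling_ge)

text \<open>A single message has no wrong codeword, so a user at rate 0 escapes both its own
  condition and the sum condition in \<open>achievable_if_rates\<close>.\<close>

lemma num_msgs_0: "num_msgs n 0 = 1"
  by (simp add: num_msgs_def)

text \<open>The ceiling adds less than 1, and leaving out the true message absorbs the rounding in
  the count of wrong ones.\<close>

lemma num_msgs_diff_le: "real (num_msgs n R - 1) \<le> exp (real n * R)"
proof -
  have "real (num_msgs n R) = of_int \<lceil>exp (real n * R)\<rceil>"
    by (simp add: num_msgs_def)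
  also have "\<dots> < exp (real n * R) + 1" by linarith
  finally show ?thesis using num_msgs_pos [of n R] by (simp add: of_nat_diff)
qed

lemma measurable_count_space_UNIV: "f \<in> Y \<rightarrow>\<^sub>M count_space A \<Longrightarrow> f \<in> Y \<rightarrow>\<^sub>M count_space UNIV"
  by (erule measurable_compose) simp

lemma error1_eq:
  fixes C :: "('n::finite, 'n, 'n, 'n) ic_code"
  assumes C: "is_code n P1 P2 R1 R2 C"
  shows "error1 H1 H2 n R1 R2 C = error_sum H1 H2 n (num_msgs n R1) (num_msgs n R2) (enc1 C) (enc2 C) (dec1 C) fst
    / (real (num_msgs n R1) * real (num_msgs n R2))"
proof -
  have d [measurable]: "dec1 C \<in> PiM {..<n} (\<lambda>_. borel) \<rightarrow>\<^sub>M count_space UNIV"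
    using C unfolding is_code_def by (blast intro: measurable_count_space_UNIV)
  have "error1 H1 H2 n R1 R2 C = (\<Sum>m\<in>{..<num_msgs n R1} \<times> {..<num_msgs n R2}.
      measure (noise n) {z \<in> space (noise n). dec1 C (received n H1 H2 (enc1 C (fst m)) (enc2 C (snd m)) z) \<noteq> fst m})
      / real (card ({..<num_msgs n R1} \<times> {..<num_msgs n R2}))"
    unfolding error1_def channel_space_def case_prod_beta prod.collapse
    by (rule measure_uniform_pair [where Q = "\<lambda>m z. dec1 C (received n H1 H2 (enc1 C (fst m)) (enc2 C (snd m)) z) \<noteq> fst m"])
       (use num_msgs_pos in \<open>auto simp: lessThan_empty_iff prob_space_noise\<close>)
  then show ?thesis by (simp add: error_sum_def)
qed

lemma error2_eq:
  fixes C :: "('n::finite, 'n, 'n, 'n) ic_code"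
  assumes C: "is_code n P1 P2 R1 R2 C"
  shows "error2 H3 H4 n R1 R2 C = error_sum H3 H4 n (num_msgs n R1) (num_msgs n R2) (enc1 C) (enc2 C) (dec2 C) snd
    / (real (num_msgs n R1) * real (num_msgs n R2))"
proof -
  have d [measurable]: "dec2 C \<in> PiM {..<n} (\<lambda>_. borel) \<rightarrow>\<^sub>M count_space UNIV"
    using C unfolding is_code_def by (blast intro: measurable_count_space_UNIV)
  have "error2 H3 H4 n R1 R2 C = (\<Sum>m\<in>{..<num_msgs n R1} \<times> {..<num_msgs n R2}.
      measure (noise n) {z \<in> space (noise n). dec2 C (received n H3 H4 (enc1 C (fst m)) (enc2 C (snd m)) z) \<noteq> snd m})
      / real (card ({..<num_msgs n R1} \<times> {..<num_msgs n R2}))"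
    unfolding error2_def channel_space_def case_prod_beta prod.collapse
    by (rule measure_uniform_pair [where Q = "\<lambda>m z. dec2 C (received n H3 H4 (enc1 C (fst m)) (enc2 C (snd m)) z) \<noteq> snd m"])
       (use num_msgs_pos in \<open>auto simp: lessThan_empty_iff prob_space_noise\<close>)
  then show ?thesis by (simp add: error_sum_def)
qed

section \<open>The rate function and the feasible set\<close>

lemma det_mat_1_add_mult_inv:
  fixes X K :: "real^'n^'n"
  assumes "invertible K"
  shows "det (mat 1 + X ** matrix_inv K) = det (K + X) / det K"
proof -
  have "(mat 1 + X ** matrix_inv K) ** K = K + X"
    by (simp add: matrix_add_rdistrib matrix_mul_assoc [symmetric] matrix_inv_cancel [OF assms])
  then have "det (mat 1 + X ** matrix_inv K) * det K = det (K + X)"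
    by (simp flip: det_mul)
  then show ?thesis using assms by (simp add: invertible_det_nz field_simps)
qed

text \<open>Covariance of a received vector for Gaussian inputs with the covariances in
  \<open>S\<close>. With \<open>A = 0\<close> it is that of the second signal plus noise, so one
  family of matrices covers every determinant of \<open>sum_rate\<close>.\<close>

definition output_cov :: "real^'n^'n \<Rightarrow> real^'n^'n \<Rightarrow> (real^'n^'n) \<times> (real^'n^'n) \<Rightarrow> real^'n^'n" where
  "output_cov A B S = mat 1 + A ** fst S ** transpose A + B ** snd S ** transpose B"

lemma posdef_output_cov:
  assumes "psd (fst S)" "psd (snd S)" shows "posdef (output_cov A B S)"
  unfolding output_cov_def by (intro posdef_add_psd posdef_mat_1 psd_congruence assms)

text \<open>The determinant with an inverse inside splits into a quotient, so that only positive
  definite matrices remain, for which square roots and continuity are at hand.\<close>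

lemma sum_rate_output_cov:
  assumes "psd (fst S)" "psd (snd S)"
  shows "sum_rate H1 H2 H3 H4 S = min (1/2 * ln (det (output_cov H3 H4 S)))
    (1/2 * ln (det (output_cov H1 H2 S)) - 1/2 * ln (det (output_cov 0 H2 S)) + 1/2 * ln (det (output_cov 0 H4 S)))"
proof -
  have K2: "posdef (output_cov 0 H2 S)" and K1: "posdef (output_cov H1 H2 S)" by (intro posdef_output_cov assms)+
  have "det (mat 1 + H1 ** fst S ** transpose H1 ** matrix_inv (output_cov 0 H2 S))
     = det (output_cov H1 H2 S) / det (output_cov 0 H2 S)"
    by (subst det_mat_1_add_mult_inv [OF posdef_invertible [OF K2]]) (simp add: output_cov_def add_ac)
  then have "ln (det (mat 1 + H1 ** fst S ** transpose H1 ** matrix_inv (output_cov 0 H2 S)))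
    = ln (det (output_cov H1 H2 S)) - ln (det (output_cov 0 H2 S))"
    using det_posdef_pos [OF K1] det_posdef_pos [OF K2] by (simp add: ln_div)
  then show ?thesis
    by (cases S) (simp add: sum_rate_def output_cov_def diff_divide_distrib)
qed

lemma linear_congruence: "linear (\<lambda>S. A ** S ** transpose A)" for A :: "real^'n^'n"
  by (intro linearI) (simp_all add: matrix_add_ldistrib matrix_add_rdistrib matrix_congruence_scaleR)

lemma continuous_on_det:
  fixes f :: "'a::topological_space \<Rightarrow> real^'n^'n"
  assumes "continuous_on S f" shows "continuous_on S (\<lambda>x. det (f x))"
  unfolding det_def by (intro continuous_intros assms)

lemma continuous_on_output_cov:
  fixes A B :: "real^'n^'n"
  shows "continuous_on S (output_cov A B)"
proof -
  have cont: "continuous_on T (\<lambda>S. A ** S ** transpose A)" for T and A :: "real^'n^'n"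
    using linear_congruence [of A] linear_continuous_on linear_conv_bounded_linear by blast
  have comp: "continuous_on S (\<lambda>x. A ** f x ** transpose A)"
    if "continuous_on S f" for f :: "(real^'n^'n) \<times> (real^'n^'n) \<Rightarrow> real^'n^'n" and A :: "real^'n^'n"
    by (rule continuous_on_compose2 [OF cont [of UNIV A] that subset_UNIV])
  show ?thesis
    unfolding output_cov_def [abs_def] by (intro continuous_intros comp)
qed

lemma feasible_psd: "S \<in> feasible P1 P2 \<Longrightarrow> psd (fst S) \<and> psd (snd S)"
  by (auto simp: feasible_def)

lemma continuous_on_sum_rate:
  fixes H1 H2 H3 H4 :: "real^'n^'n"
  shows "continuous_on (feasible P1 P2) (sum_rate H1 H2 H3 H4)"
proof -
  have c: "continuous_on (feasible P1 P2) (\<lambda>S. ln (det (output_cov A B S)))" for A B :: "real^'n^'n"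
    by (intro continuous_on_ln continuous_on_det continuous_on_output_cov)
       (metis det_posdef_pos feasible_psd less_irrefl posdef_output_cov)
  have "continuous_on (feasible P1 P2) (\<lambda>S. min (1/2 * ln (det (output_cov H3 H4 S)))
    (1/2 * ln (det (output_cov H1 H2 S)) - 1/2 * ln (det (output_cov 0 H2 S)) + 1/2 * ln (det (output_cov 0 H4 S))))"
    by (intro continuous_intros c)
  then show ?thesis
    by (rule continuous_on_eq) (simp add: sum_rate_output_cov feasible_psd)
qed

lemma compact_psd_trace_le: "compact {S :: real^'n^'n. psd S \<and> trace S \<le> P}"
proof -
  let ?F = "{S :: real^'n^'n. psd S \<and> trace S \<le> P}"
  have "bounded ?F"
    unfolding bounded_iff
  proof (intro exI ballI)
    fix S :: "real^'n^'n" assume "S \<in> ?F"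
    then have "norm S \<le> real CARD('n) * real CARD('n) * trace S" "trace S \<le> P"
      using norm_psd_le_trace by auto
    then show "norm S \<le> real CARD('n) * real CARD('n) * P"
      by (meson mult_left_mono mult_nonneg_nonneg of_nat_0_le_iff order_trans)
  qed
  moreover have "closed ?F"
  proof -
    have mv: "continuous_on UNIV (\<lambda>S :: real^'n^'n. S *v x)" for x
      unfolding matrix_vector_mult_def by (intro continuous_on_vec_lambda continuous_intros)
    have "closed {S :: real^'n^'n. transpose S = S}"
      unfolding transpose_def
      by (intro closed_Collect_eq continuous_on_vec_lambda continuous_intros)
    moreover have "closed {S :: real^'n^'n. \<forall>x. 0 \<le> x \<bullet> (S *v x)}"
      by (intro closed_Collect_all closed_Collect_le continuous_intros mv)
    moreover have "closed {S :: real^'n^'n. trace S \<le> P}"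
      unfolding trace_def by (intro closed_Collect_le continuous_intros)
    ultimately have "closed ({S :: real^'n^'n. transpose S = S} \<inter> {S. \<forall>x. 0 \<le> x \<bullet> (S *v x)} \<inter> {S. trace S \<le> P})"
      by (intro closed_Int)
    also have "\<dots> = ?F" by (auto simp: psd_def)
    finally show ?thesis .
  qed
  ultimately show ?thesis by (simp add: compact_eq_bounded_closed)
qed

lemma compact_feasible: "compact (feasible P1 P2 :: ((real^'n^'n) \<times> (real^'m^'m)) set)"
proof -
  have "feasible P1 P2 = {S :: real^'n^'n. psd S \<and> trace S \<le> P1} \<times> {S :: real^'m^'m. psd S \<and> trace S \<le> P2}"
    by (auto simp: feasible_def)
  then show ?thesis by (simp add: compact_Times compact_psd_trace_le)
qed

section \<open>Upper and lower bounds on the achievable sum rate\<close>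

text \<open>The two converse bounds refer to the same \<open>S\<close>, the covariances of the code
  itself, and so combine into the minimum. Each is applied with its own \<open>B\<close> and
  \<open>L\<close>: from \<open>H3\<close> to \<open>H1\<close> for joint decoding, from
  \<open>H4\<close> to \<open>H2\<close> for treating interference as noise.\<close>

lemma code_converse:
  fixes H1 H2 H3 H4 :: "real^'n^'n" and C :: "('n, 'n, 'n, 'n) ic_code"
  assumes inv: "invertible H1" "invertible H2" "invertible H3" "invertible H4"
    and weak: "psd (transpose H4 ** H4 - transpose H2 ** H2)" and strong: "psd (transpose H3 ** H3 - transpose H1 ** H1)"
    and n: "0 < n" and C: "is_code n P1 P2 R1 R2 C"
  shows "\<exists>S \<in> feasible P1 P2. (1 - (error1 H1 H2 n R1 R2 C + error2 H3 H4 n R1 R2 C))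
      * ln (real (num_msgs n R1) * real (num_msgs n R2)) \<le> real n * sum_rate H1 H2 H3 H4 S + ln 2"
proof -
  let ?M1 = "num_msgs n R1" and ?M2 = "num_msgs n R2"
  note M = num_msgs_pos [of n R1] num_msgs_pos [of n R2]
  define S where "S = (code_cov n ?M1 (enc1 C), code_cov n ?M2 (enc2 C))"
  have psd: "psd (fst S)" "psd (snd S)" by (simp_all add: S_def psd_code_cov)
  have "S \<in> feasible P1 P2"
    using C trace_code_cov_le [OF M(1), of n "enc1 C"] trace_code_cov_le [OF M(2), of n "enc2 C"]
    by (auto simp: feasible_def S_def psd_code_cov is_code_def)
  have d1: "dec1 C \<in> PiM {..<n} (\<lambda>_. borel) \<rightarrow>\<^sub>M count_space UNIV"
    using C unfolding is_code_def by (blast intro: measurable_count_space_UNIV)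
  have d2: "dec2 C \<in> PiM {..<n} (\<lambda>_. borel) \<rightarrow>\<^sub>M count_space UNIV"
    using C unfolding is_code_def by (blast intro: measurable_count_space_UNIV)
  obtain E1 where E1: "invertible E1" "output_cov H1 H2 S = E1 ** transpose E1" "ln \<bar>det E1\<bar> = 1/2 * ln (det (output_cov H1 H2 S))"
    by (rule posdef_factorization [OF posdef_output_cov [OF psd]])
  obtain E2 where E2: "invertible E2" "output_cov 0 H2 S = E2 ** transpose E2" "ln \<bar>det E2\<bar> = 1/2 * ln (det (output_cov 0 H2 S))"
    by (rule posdef_factorization [OF posdef_output_cov [OF psd]])
  obtain E3 where E3: "invertible E3" "output_cov H3 H4 S = E3 ** transpose E3" "ln \<bar>det E3\<bar> = 1/2 * ln (det (output_cov H3 H4 S))"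
    by (rule posdef_factorization [OF posdef_output_cov [OF psd]])
  obtain E4 where E4: "invertible E4" "output_cov 0 H4 S = E4 ** transpose E4" "ln \<bar>det E4\<bar> = 1/2 * ln (det (output_cov 0 H4 S))"
    by (rule posdef_factorization [OF posdef_output_cov [OF psd]])
  let ?lhs = "(1 - (error1 H1 H2 n R1 R2 C + error2 H3 H4 n R1 R2 C)) * ln (real ?M1 * real ?M2)"
  have eq: "error1 H1 H2 n R1 R2 C + error2 H3 H4 n R1 R2 C
      = (error_sum H1 H2 n ?M1 ?M2 (enc1 C) (enc2 C) (dec1 C) fst + error_sum H3 H4 n ?M1 ?M2 (enc1 C) (enc2 C) (dec2 C) snd)
        / (real ?M1 * real ?M2)"
    by (simp add: error1_eq [OF C] error2_eq [OF C] add_divide_distrib)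
  obtain B L :: "real^'n^'n" where "invertible B" "B ** H3 = H1" "B ** transpose B + L ** transpose L = mat 1"
    by (rule degradation_matrices [OF inv(1,3) strong])
  then have joint: "?lhs \<le> real n * ln \<bar>det E3\<bar> + ln 2"
    unfolding eq using E3(1,2) d1 d2 M n
    by (intro converse_joint) (simp_all add: output_cov_def S_def)
  obtain B L :: "real^'n^'n" where "invertible B" "B ** H4 = H2" "B ** transpose B + L ** transpose L = mat 1"
    by (rule degradation_matrices [OF inv(2,4) weak])
  then have "?lhs \<le> real n * (ln \<bar>det E1\<bar> + ln \<bar>det E4\<bar> - ln \<bar>det E2\<bar>) + ln 2"
    unfolding eq using E1(1,2) E2(1,2) E4(1,2) d1 d2 M n
    by (intro converse_treat_as_noise) (simp_all add: output_cov_def S_def)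
  with joint have "?lhs \<le> real n * sum_rate H1 H2 H3 H4 S + ln 2"
    unfolding sum_rate_output_cov [OF psd] E1(3) [symmetric] E2(3) [symmetric] E3(3) [symmetric] E4(3) [symmetric] min_def
    by (simp add: algebra_simps)
  with \<open>S \<in> feasible P1 P2\<close> show ?thesis by blast
qed

lemma achievable_sum_le:
  fixes H1 H2 H3 H4 :: "real^'n^'n"
  assumes inv: "invertible H1" "invertible H2" "invertible H3" "invertible H4"
    and weak: "psd (transpose H4 ** H4 - transpose H2 ** H2)" and strong: "psd (transpose H3 ** H3 - transpose H1 ** H1)"
    and max: "\<And>S. S \<in> feasible P1 P2 \<Longrightarrow> sum_rate H1 H2 H3 H4 S \<le> c"
    and ach: "achievable H1 H2 H3 H4 P1 P2 R1 R2"
  shows "R1 + R2 \<le> c"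
proof -
  from ach obtain C where R: "0 \<le> R1" "0 \<le> R2" and C: "\<And>n. 1 \<le> n \<Longrightarrow> is_code n P1 P2 R1 R2 (C n)"
    and e1: "(\<lambda>n. error1 H1 H2 n R1 R2 (C n)) \<longlonglongrightarrow> 0" and e2: "(\<lambda>n. error2 H3 H4 n R1 R2 (C n)) \<longlonglongrightarrow> 0"
    unfolding achievable_def by blast
  define e where "e n = error1 H1 H2 n R1 R2 (C n) + error2 H3 H4 n R1 R2 (C n)" for n
  have e: "e \<longlonglongrightarrow> 0" unfolding e_def [abs_def] using tendsto_add [OF e1 e2] by simp
  have "\<forall>\<^sub>F n in sequentially. e n < 1" using e by (rule order_tendstoD) simp
  then have "\<forall>\<^sub>F n in sequentially. (1 - e n) * (R1 + R2) \<le> c + ln 2 / real n"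
    using eventually_gt_at_top [of 0]
  proof eventually_elim
    case (elim n)
    obtain S where S: "S \<in> feasible P1 P2"
      and le: "(1 - e n) * ln (real (num_msgs n R1) * real (num_msgs n R2)) \<le> real n * sum_rate H1 H2 H3 H4 S + ln 2"
      using code_converse [OF inv weak strong elim(2) C] elim by (auto simp: e_def)
    have "exp (real n * (R1 + R2)) \<le> real (num_msgs n R1) * real (num_msgs n R2)"
      unfolding distrib_left exp_add by (intro mult_mono num_msgs_ge) simp_all
    then have "real n * (R1 + R2) \<le> ln (real (num_msgs n R1) * real (num_msgs n R2))"
      using num_msgs_pos by (subst ln_ge_iff) simp_all
    then have "(1 - e n) * (real n * (R1 + R2)) \<le> (1 - e n) * ln (real (num_msgs n R1) * real (num_msgs n R2))"
      using elim by (intro mult_left_mono) simp_all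
    also note le
    also have "real n * sum_rate H1 H2 H3 H4 S + ln 2 \<le> real n * c + ln 2"
      using max [OF S] by (simp add: mult_left_mono)
    finally have "real n * ((1 - e n) * (R1 + R2)) \<le> real n * (c + ln 2 / real n)"
      using elim by (simp add: algebra_simps)
    then show ?case using elim by simp
  qed
  moreover have "(\<lambda>n. (1 - e n) * (R1 + R2)) \<longlonglongrightarrow> (1 - 0) * (R1 + R2)"
    by (intro tendsto_intros e)
  moreover have "(\<lambda>n. c + ln 2 / real n) \<longlonglongrightarrow> c + 0"
    by (intro tendsto_intros lim_const_over_n)
  ultimately show ?thesis
    using tendsto_le [OF sequentially_bot, of "\<lambda>n. c + ln 2 / real n" "c + 0" "\<lambda>n. (1 - e n) * (R1 + R2)" "(1 - 0) * (R1 + R2)"]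
    by simp
qed

lemma prob_space_channel_space: "prob_space (channel_space n R1 R2 :: ((nat \<times> nat) \<times> (nat \<Rightarrow> real^'r)) measure)"
  unfolding channel_space_def by (intro prob_space_pair measure_pmf.prob_space_axioms prob_space_noise)

lemma error_le_1: "error1 H1 H2 n R1 R2 C \<le> 1" "error2 H3 H4 n R1 R2 C \<le> 1"
  unfolding error1_def error2_def by (rule prob_space.prob_le_1 [OF prob_space_channel_space])+

lemma error_nonneg: "0 \<le> error1 H1 H2 n R1 R2 C" "0 \<le> error2 H3 H4 n R1 R2 C"
  by (simp_all add: error1_def error2_def)

text \<open>The alternatives with rate 0 keep the conditions satisfiable when a bound such as
  \<open>c1\<close> is 0 and a strict inequality cannot hold.\<close>

lemma achievable_if_rates:
  fixes H1 H2 H3 H4 L1 L2 E1 E2 E3 E4 :: "real^'n^'n"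
  assumes E1: "invertible E1" "E1 ** transpose E1 = mat 1 + (H1 ** L1) ** transpose (H1 ** L1) + (H2 ** L2) ** transpose (H2 ** L2)"
    and E2: "invertible E2" "E2 ** transpose E2 = mat 1 + (H2 ** L2) ** transpose (H2 ** L2)"
    and E3: "invertible E3" "E3 ** transpose E3 = mat 1 + (H3 ** L1) ** transpose (H3 ** L1) + (H4 ** L2) ** transpose (H4 ** L2)"
    and E4: "invertible E4" "E4 ** transpose E4 = mat 1 + (H4 ** L2) ** transpose (H4 ** L2)"
    and P1: "(norm L1)\<^sup>2 < P1 \<or> L1 = 0 \<and> 0 \<le> P1" and P2: "(norm L2)\<^sup>2 < P2 \<or> L2 = 0 \<and> 0 \<le> P2"
    and c1: "c1 = ln \<bar>det E1\<bar> - ln \<bar>det E2\<bar>" and c2: "c2 = ln \<bar>det E4\<bar>" and c3: "c3 = ln \<bar>det E3\<bar>"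
    and R: "0 \<le> R1" "0 \<le> R2"
    and R1: "R1 = 0 \<or> R1 < c1" and R2: "R2 = 0 \<or> R2 < c2" and R3: "R1 = 0 \<or> R2 = 0 \<or> R1 + R2 < c3"
  shows "achievable H1 H2 H3 H4 P1 P2 R1 R2"
proof -
  \<comment> \<open>Half of the smallest gap: one \<open>\<delta>\<close> is spent on the thresholds
    \<open>c - \<delta>\<close>, the other remains as exponent of decay. The value 1 stands in for a
    waived condition.\<close>
  define \<delta> where "\<delta> = min (if R1 = 0 then 1 else (c1 - R1) / 2)
    (min (if R2 = 0 then 1 else (c2 - R2) / 2) (if R1 = 0 \<or> R2 = 0 then 1 else (c3 - (R1 + R2)) / 2))"
  have \<delta>: "0 < \<delta>" using R1 R2 R3 by (auto simp: \<delta>_def)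
  have gap1: "R1 \<noteq> 0 \<Longrightarrow> R1 + 2 * \<delta> \<le> c1"
    and gap2: "R2 \<noteq> 0 \<Longrightarrow> R2 + 2 * \<delta> \<le> c2"
    and gap3: "R1 \<noteq> 0 \<Longrightarrow> R2 \<noteq> 0 \<Longrightarrow> R1 + R2 + 2 * \<delta> \<le> c3"
    by (auto simp: \<delta>_def min_def field_simps)
  have P: "0 \<le> P1" "0 \<le> P2" using P1 P2 zero_le_power2 [of "norm L1"] zero_le_power2 [of "norm L2"] by linarith+
  define K where "K = 6 * chi2_var TYPE('n) / \<delta>\<^sup>2 + power_var L1 P1 + power_var L2 P2"
  \<comment> \<open>Each of the three wrong-codeword terms is at most
    \<open>exp (- real n * \<delta>)\<close>; the summand \<open>1 / real n\<close> makes the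
    inequality asked by \<open>random_code_exists\<close> strict.\<close>
  define e where "e n = K / real n + 3 * exp (- real n * \<delta>) + 1 / real n" for n
  have decay: "exp (real n * r) * exp (- real n * (c - \<delta>)) \<le> exp (- real n * \<delta>)" if "r + 2 * \<delta> \<le> c" for n r c
  proof -
    have "real n * (r + 2 * \<delta>) \<le> real n * c" using that by (rule mult_left_mono) simp
    then show ?thesis by (simp add: exp_add [symmetric] algebra_simps)
  qed
  have "\<exists>C :: ('n, 'n, 'n, 'n) ic_code. is_code n P1 P2 R1 R2 C \<and>
      error1 H1 H2 n R1 R2 C \<le> e n \<and> error2 H3 H4 n R1 R2 C \<le> e n" if n: "1 \<le> n" for n
  proof (cases "e n \<le> 1")
    case True
    let ?M1 = "num_msgs n R1" and ?M2 = "num_msgs n R2"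
    have t1: "real (?M1 - 1) * exp (- real n * (c1 - \<delta>)) \<le> exp (- real n * \<delta>)"
    proof (cases "R1 = 0")
      case False
      have "real (?M1 - 1) * exp (- real n * (c1 - \<delta>)) \<le> exp (real n * R1) * exp (- real n * (c1 - \<delta>))"
        by (intro mult_right_mono num_msgs_diff_le) simp
      also note decay [OF gap1 [OF False]]
      finally show ?thesis .
    qed (simp add: num_msgs_0)
    have t2: "real (?M2 - 1) * exp (- real n * (c2 - \<delta>)) \<le> exp (- real n * \<delta>)"
    proof (cases "R2 = 0")
      case False
      have "real (?M2 - 1) * exp (- real n * (c2 - \<delta>)) \<le> exp (real n * R2) * exp (- real n * (c2 - \<delta>))"
        by (intro mult_right_mono num_msgs_diff_le) simp
      also note decay [OF gap2 [OF False]]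
      finally show ?thesis .
    qed (simp add: num_msgs_0)
    have t3: "real (?M1 - 1) * real (?M2 - 1) * exp (- real n * (c3 - \<delta>)) \<le> exp (- real n * \<delta>)"
    proof (cases "R1 = 0 \<or> R2 = 0")
      case False
      have "real (?M1 - 1) * real (?M2 - 1) * exp (- real n * (c3 - \<delta>))
          \<le> exp (real n * R1) * exp (real n * R2) * exp (- real n * (c3 - \<delta>))"
        by (intro mult_mono mult_right_mono num_msgs_diff_le) simp_all
      also have "\<dots> = exp (real n * (R1 + R2)) * exp (- real n * (c3 - \<delta>))"
        by (simp add: exp_add distrib_left)
      also have "\<dots> \<le> exp (- real n * \<delta>)" using False by (intro decay gap3) simp_all
      finally show ?thesis .
    qed (auto simp: num_msgs_0)
    have "K / real n + real (?M1 - 1) * exp (- real n * (c1 - \<delta>)) + real (?M2 - 1) * exp (- real n * (c2 - \<delta>))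
        + real (?M1 - 1) * real (?M2 - 1) * exp (- real n * (c3 - \<delta>)) < e n"
    proof -
      have "0 < 1 / real n" using n by simp
      then show ?thesis unfolding e_def using t1 t2 t3 by linarith
    qed
    moreover have "0 < n" using n by simp
    ultimately obtain x1 x2 :: "nat \<Rightarrow> nat \<Rightarrow> real^'n" and d1 d2
      where d: "d1 \<in> PiM {..<n} (\<lambda>_. borel) \<rightarrow>\<^sub>M count_space {..<?M1}" "d2 \<in> PiM {..<n} (\<lambda>_. borel) \<rightarrow>\<^sub>M count_space {..<?M2}"
      and pow: "avg_power n ?M1 x1 \<le> P1" "avg_power n ?M2 x2 \<le> P2"
      and err: "error_sum H1 H2 n ?M1 ?M2 x1 x2 d1 fst + error_sum H3 H4 n ?M1 ?M2 x1 x2 d2 snd < real ?M1 * real ?M2 * e n"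
      using random_code_exists [OF _ num_msgs_pos num_msgs_pos \<delta> E1 E2 E3 E4 P1 P2 c1 c2 c3 K_def _ True] by blast
    let ?C = "\<lparr>enc1 = x1, enc2 = x2, dec1 = d1, dec2 = d2\<rparr>"
    have C: "is_code n P1 P2 R1 R2 ?C" using d pow by (simp add: is_code_def)
    have pos: "0 < real ?M1 * real ?M2" using num_msgs_pos by simp
    have "error1 H1 H2 n R1 R2 ?C + error2 H3 H4 n R1 R2 ?C < e n"
      unfolding error1_eq [OF C] error2_eq [OF C] using err pos
      by (simp add: add_divide_distrib [symmetric] pos_divide_less_eq mult.commute)
    then have "error1 H1 H2 n R1 R2 ?C \<le> e n" "error2 H3 H4 n R1 R2 ?C \<le> e n"
      using error_nonneg [of H1 H2 n R1 R2 ?C] error_nonneg(2) [of H3 H4 n R1 R2 ?C] by linarith+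
    with C show ?thesis by blast
  next
    case False
    \<comment> \<open>Codes are demanded for every \<open>n \<ge> 1\<close>. The blocklengths with
      \<open>e n > 1\<close>, finitely many as \<open>e\<close> tends to 0, are served by the zero
      code.\<close>
    let ?C = "\<lparr>enc1 = \<lambda>_ _. 0, enc2 = \<lambda>_ _. 0, dec1 = \<lambda>_. 0, dec2 = \<lambda>_. 0\<rparr> :: ('n, 'n, 'n, 'n) ic_code"
    have "is_code n P1 P2 R1 R2 ?C"
      using P num_msgs_pos by (simp add: is_code_def avg_power_def)
    moreover have "error1 H1 H2 n R1 R2 ?C \<le> e n" "error2 H3 H4 n R1 R2 ?C \<le> e n"
      using False error_le_1(1) [of H1 H2 n R1 R2 ?C] error_le_1(2) [of H3 H4 n R1 R2 ?C] by linarith+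
    ultimately show ?thesis by blast
  qed
  then obtain C :: "nat \<Rightarrow> ('n, 'n, 'n, 'n) ic_code" where C: "\<And>n. 1 \<le> n \<Longrightarrow> is_code n P1 P2 R1 R2 (C n) \<and>
      error1 H1 H2 n R1 R2 (C n) \<le> e n \<and> error2 H3 H4 n R1 R2 (C n) \<le> e n"
    by metis
  have "(\<lambda>n. K / real n + 3 * (exp (- \<delta>)) ^ n + 1 / real n) \<longlonglongrightarrow> 0 + 3 * 0 + 0"
    by (intro tendsto_intros lim_const_over_n LIMSEQ_power_zero) (simp add: \<delta>)
  then have e: "e \<longlonglongrightarrow> 0"
    by (simp add: e_def [abs_def] exp_of_nat_mult [symmetric])
  have "(\<lambda>n. error1 H1 H2 n R1 R2 (C n)) \<longlonglongrightarrow> 0" "(\<lambda>n. error2 H3 H4 n R1 R2 (C n)) \<longlonglongrightarrow> 0"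
    by (rule tendsto_sandwich [OF _ _ tendsto_const e];
        rule eventually_sequentiallyI [of 1], simp add: C error_nonneg)+
  with R C show ?thesis unfolding achievable_def by blast
qed

lemma feasible_scaleR:
  assumes "S \<in> feasible P1 P2" "0 \<le> t" "t \<le> 1" "0 \<le> P1" "0 \<le> P2"
  shows "t *\<^sub>R S \<in> feasible P1 P2"
proof -
  have "t * a \<le> P" if "a \<le> P" "0 \<le> P" for a P
    using mult_left_mono [OF that(1) assms(2)] mult_left_le_one_le [OF that(2) assms(2,3)] by linarith
  then show ?thesis
    using assms by (auto simp: feasible_def psd_scaleR trace_scaleR)
qed

text \<open>Scaling by \<open>t < 1\<close> gives strict slack in the power unless the covariance
  vanishes; in that case the power bound may itself be 0, whence the second alternative.\<close>

lemma psd_scaled_factorization: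
  fixes S :: "real^'n^'n"
  assumes "psd S" "trace S \<le> P" "0 \<le> P" "0 < t" "t < 1"
  obtains L :: "real^'n^'n" where "t *\<^sub>R S = L ** transpose L" "(norm L)\<^sup>2 < P \<or> L = 0 \<and> 0 \<le> P"
proof -
  obtain L :: "real^'n^'n" where L: "t *\<^sub>R S = L ** transpose L"
    using psd_factorization psd_scaleR assms by (metis less_imp_le)
  have n: "(norm L)\<^sup>2 = t * trace S" unfolding trace_gram [symmetric] L [symmetric] by (rule trace_scaleR)
  have "(norm L)\<^sup>2 < P \<or> L = 0 \<and> 0 \<le> P"
  proof (cases "L = 0")
    case False
    then have "0 < t * trace S" by (simp flip: n)
    then have "0 < trace S" using assms by (simp add: zero_less_mult_iff)
    then have "t * trace S < trace S" using assms by simp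
    then show ?thesis using n assms by simp
  qed (use assms in simp)
  with L show ?thesis by (rule that)
qed

lemma achievable_near_sum_rate:
  fixes H1 H2 H3 H4 :: "real^'n^'n"
  assumes P: "0 \<le> P1" "0 \<le> P2" and S: "S \<in> feasible P1 P2" and t: "0 < t" "t < 1" and \<eta>: "0 < \<eta>"
  shows "\<exists>R1 R2. achievable H1 H2 H3 H4 P1 P2 R1 R2 \<and> sum_rate H1 H2 H3 H4 (t *\<^sub>R S) - 2 * \<eta> \<le> R1 + R2"
proof -
  have psd: "psd (fst (t *\<^sub>R S))" "psd (snd (t *\<^sub>R S))"
    using feasible_psd [OF S] t by (simp_all add: psd_scaleR)
  have SF: "psd (fst S)" "trace (fst S) \<le> P1" "psd (snd S)" "trace (snd S) \<le> P2"
    using S by (auto simp: feasible_def)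
  obtain L1 :: "real^'n^'n" where L1: "fst (t *\<^sub>R S) = L1 ** transpose L1" "(norm L1)\<^sup>2 < P1 \<or> L1 = 0 \<and> 0 \<le> P1"
    by (rule psd_scaled_factorization [OF SF(1,2) P(1) t, folded fst_scaleR])
  obtain L2 :: "real^'n^'n" where L2: "snd (t *\<^sub>R S) = L2 ** transpose L2" "(norm L2)\<^sup>2 < P2 \<or> L2 = 0 \<and> 0 \<le> P2"
    by (rule psd_scaled_factorization [OF SF(3,4) P(2) t, folded snd_scaleR])
  have cov: "output_cov A B (t *\<^sub>R S) = mat 1 + (A ** L1) ** transpose (A ** L1) + (B ** L2) ** transpose (B ** L2)" for A B
    by (simp only: output_cov_def L1 L2 matrix_transpose_mul matrix_mul_assoc)
  obtain E1 where E1: "invertible E1" "output_cov H1 H2 (t *\<^sub>R S) = E1 ** transpose E1" "ln \<bar>det E1\<bar> = 1/2 * ln (det (output_cov H1 H2 (t *\<^sub>R S)))"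
    by (rule posdef_factorization [OF posdef_output_cov [OF psd]])
  obtain E2 where E2: "invertible E2" "output_cov 0 H2 (t *\<^sub>R S) = E2 ** transpose E2" "ln \<bar>det E2\<bar> = 1/2 * ln (det (output_cov 0 H2 (t *\<^sub>R S)))"
    by (rule posdef_factorization [OF posdef_output_cov [OF psd]])
  obtain E3 where E3: "invertible E3" "output_cov H3 H4 (t *\<^sub>R S) = E3 ** transpose E3" "ln \<bar>det E3\<bar> = 1/2 * ln (det (output_cov H3 H4 (t *\<^sub>R S)))"
    by (rule posdef_factorization [OF posdef_output_cov [OF psd]])
  obtain E4 where E4: "invertible E4" "output_cov 0 H4 (t *\<^sub>R S) = E4 ** transpose E4" "ln \<bar>det E4\<bar> = 1/2 * ln (det (output_cov 0 H4 (t *\<^sub>R S)))"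
    by (rule posdef_factorization [OF posdef_output_cov [OF psd]])
  define c1 c2 c3 where "c1 = ln \<bar>det E1\<bar> - ln \<bar>det E2\<bar>" and "c2 = ln \<bar>det E4\<bar>" and "c3 = ln \<bar>det E3\<bar>"
  define T where "T = min c3 (c1 + c2)"
  have T: "T = sum_rate H1 H2 H3 H4 (t *\<^sub>R S)"
    unfolding sum_rate_output_cov [OF psd] E1(3) [symmetric] E2(3) [symmetric] E3(3) [symmetric] E4(3) [symmetric]
    by (simp add: T_def c1_def c2_def c3_def)
  \<comment> \<open>User 1 takes as much of the target \<open>T\<close> as \<open>c1\<close> allows
    and user 2 takes the rest, which is 0 or at most \<open>c2\<close>. Each share is lowered by
    \<open>\<eta>\<close> for strictness and truncated at 0.\<close>
  define R1 R2 where "R1 = max 0 (min c1 T - \<eta>)" and "R2 = max 0 (T - min c1 T - \<eta>)"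
  have "achievable H1 H2 H3 H4 P1 P2 R1 R2"
  proof (rule achievable_if_rates [OF E1(1) _ E2(1) _ E3(1) _ E4(1) _ L1(2) L2(2) c1_def c2_def c3_def])
    show "R1 = 0 \<or> R1 < c1" "R1 = 0 \<or> R2 = 0 \<or> R1 + R2 < c3"
      using \<eta> by (auto simp: R1_def R2_def T_def)
    show "R2 = 0 \<or> R2 < c2"
      using \<eta> by (auto simp: R1_def R2_def T_def)
  qed (simp_all add: E1(2) [symmetric] E2(2) [symmetric] E3(2) [symmetric] E4(2) [symmetric] cov R1_def R2_def)
  moreover have "T - 2 * \<eta> \<le> R1 + R2" by (simp add: R1_def R2_def)
  ultimately show ?thesis unfolding T by blast
qed

theorem theorem5:
  fixes H1 H2 H3 H4 :: "real^'n^'n" and P1 P2 :: real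
  assumes "0 \<le> P1" and "0 \<le> P2"
    and "invertible H1" and "invertible H2" and "invertible H3" and "invertible H4"
    and "posdef (transpose H4 ** H4 - transpose H2 ** H2)"
    and "psd (transpose H3 ** H3 - transpose H1 ** H1)"
  shows "\<exists>S \<in> feasible P1 P2.
    (\<forall>S' \<in> feasible P1 P2. sum_rate H1 H2 H3 H4 S' \<le> sum_rate H1 H2 H3 H4 S) \<and>
    sum_capacity H1 H2 H3 H4 P1 P2 = ereal (sum_rate H1 H2 H3 H4 S)"
proof -
  let ?f = "sum_rate H1 H2 H3 H4" and ?F = "feasible P1 P2 :: ((real^'n^'n) \<times> (real^'n^'n)) set"
  have "(0, 0) \<in> ?F" using assms(1,2) by (simp add: feasible_def psd_def trace_def transpose_def vec_eq_iff)
  then have "?F \<noteq> {}" by blast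
  then obtain S where S: "S \<in> ?F" and max: "\<And>S'. S' \<in> ?F \<Longrightarrow> ?f S' \<le> ?f S"
    using continuous_attains_sup [OF compact_feasible _ continuous_on_sum_rate] by metis
  let ?A = "{(R1, R2). achievable H1 H2 H3 H4 P1 P2 R1 R2}"
  have upper: "R1 + R2 \<le> ?f S" if "(R1, R2) \<in> capacity_region H1 H2 H3 H4 P1 P2" for R1 R2
  proof -
    have "closure ?A \<subseteq> {p. fst p + snd p \<le> ?f S}"
    proof (rule closure_minimal)
      show "?A \<subseteq> {p. fst p + snd p \<le> ?f S}"
        using achievable_sum_le [OF assms(3-6) posdef_imp_psd [OF assms(7)] assms(8) max] by auto
      show "closed {p :: real \<times> real. fst p + snd p \<le> ?f S}"
        by (intro closed_Collect_le continuous_intros)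
    qed
    then show ?thesis using that by (auto simp: capacity_region_def)
  qed
  have lower: "ereal (?f (t *\<^sub>R S) - 2 * \<eta>) \<le> sum_capacity H1 H2 H3 H4 P1 P2"
    if t: "0 < t" "t < 1" and \<eta>: "0 < \<eta>" for t \<eta>
  proof -
    obtain R1 R2 where R: "achievable H1 H2 H3 H4 P1 P2 R1 R2" "?f (t *\<^sub>R S) - 2 * \<eta> \<le> R1 + R2"
      using achievable_near_sum_rate [OF assms(1,2) S t \<eta>] by blast
    then have "(R1, R2) \<in> capacity_region H1 H2 H3 H4 P1 P2"
      unfolding capacity_region_def by (intro closure_subset [THEN subsetD]) simp
    then have "ereal (R1 + R2) \<le> sum_capacity H1 H2 H3 H4 P1 P2"
      unfolding sum_capacity_def by (intro SUP_upper2 [where i = "(R1, R2)"]) simp_all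
    with R(2) show ?thesis by (metis ereal_less_eq(3) order_trans)
  qed
  \<comment> \<open>Choosing \<open>\<eta> = 1 - t\<close> merges both losses into the limit of
    \<open>t\<close> to 1, where continuity of \<open>sum_rate\<close> along the segment from 0 to
    \<open>S\<close> recovers the maximum.\<close>
  have "((\<lambda>t. ?f (t *\<^sub>R S) - 2 * (1 - t)) \<longlongrightarrow> ?f (1 *\<^sub>R S) - 2 * (1 - 1)) (at 1 within {0<..<1})"
  proof (intro tendsto_intros)
    have "continuous_on {0..1} (\<lambda>t. ?f (t *\<^sub>R S))"
      by (rule continuous_on_compose2 [OF continuous_on_sum_rate [where ?P1.0 = P1 and ?P2.0 = P2]])
         (use feasible_scaleR [OF S _ _ assms(1,2)] in \<open>auto intro!: continuous_intros\<close>)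
    then have "((\<lambda>t. ?f (t *\<^sub>R S)) \<longlongrightarrow> ?f (1 *\<^sub>R S)) (at 1 within {0..1})"
      unfolding continuous_on_def by (rule bspec) simp
    then show "((\<lambda>t. ?f (t *\<^sub>R S)) \<longlongrightarrow> ?f (1 *\<^sub>R S)) (at 1 within {0<..<1})"
      by (rule tendsto_within_subset) auto
  qed
  then have "((\<lambda>t. ereal (?f (t *\<^sub>R S) - 2 * (1 - t))) \<longlongrightarrow> ereal (?f S)) (at 1 within {0<..<1})"
    by simp
  then have "ereal (?f S) \<le> sum_capacity H1 H2 H3 H4 P1 P2"
  proof (rule tendsto_upperbound)
    show "\<forall>\<^sub>F t in at 1 within {0<..<1}. ereal (?f (t *\<^sub>R S) - 2 * (1 - t)) \<le> sum_capacity H1 H2 H3 H4 P1 P2"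
      unfolding eventually_at_filter by (intro always_eventually allI impI lower) simp_all
    show "at (1::real) within {0<..<1} \<noteq> bot"
      by (simp add: trivial_limit_within islimpt_greaterThanLessThan2)
  qed
  moreover have "sum_capacity H1 H2 H3 H4 P1 P2 \<le> ereal (?f S)"
    unfolding sum_capacity_def by (rule SUP_least) (auto dest: upper)
  ultimately show ?thesis using S max by (metis antisym)
qed

end
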